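(* Let $X$ be a UMD Banach space, let $p\in(1,\infty)$ and let $I=(0,2\pi)$. For $n\in\mathbb{N}=\{1,2,\dots\}$ and $x\in I$ put $$\varphi_0^c(x)=1,\qquad \varphi_n^c(x)=\cos(nx),\qquad \varphi_n^s(x)=-\frac{x}{2n}\sin(nx),$$ $$v_0^c(x)=\frac{2\pi-x}{2\pi^2},\qquad v_n^c(x)=\frac{2\pi-x}{\pi^2}\cos(nx),\qquad v_n^s(x)=-\frac{2n}{\pi^2}\sin(nx),$$ and for $f\in L^p(I;X)$ put (Bochner integrals) $$t_0^c(f)=\int_0^{2\pi}v_0^c(x)f(x)\,dx,\qquad t_n^c(f)=\int_0^{2\pi}v_n^c(x)f(x)\,dx,\qquad t_n^s(f)=\int_0^{2\pi}v_n^s(x)f(x)\,dx .$$ Then the system $\{\varphi_0^c,\varphi_n^c,\varphi_n^s\}_{n\in\mathbb{N}}$ is $\otimes$-complete in $L^p(I;X)$ and admits a unique $\otimes$-biorthonormal system, namely the one given by $\{v_0^c,v_n^c,v_n^s\}_{n\in\mathbb{N}}$, i.e. by the operators $\{t_0^c,t_n^c,t_n^s\}_{n\in\mathbb{N}}$. Moreover, the partial-sum operators $$P_nf=t_0^c(f)\varphi_0^c+\sum_{k=1}^n\left[t_k^c(f)\varphi_k^c+t_k^s(f)\varphi_k^s\right]$$ are uniformly bounded on $L^p(I;X)$: there exists a constant $C>0$, independent of $n$ and $f$, such that $$\|P_nf\|_{L^p(I;X)}\le C\|f\|_{L^p(I;X)}\qquad\text{for every } f\in L^p(I;X)\text{ and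 every } n\in\mathbb{N}.$$
   Context: $L^p(I;X)$ is the Bochner space of (classes of) strongly measurable functions $f:I\to X$ with norm $\|f\|_{L^p(I;X)}=\left(\int_I\|f(x)\|_X^p\,dx\right)^{1/p}$. For $z\in X$ and a scalar function $h\in L^p(I)$, $zh=hz$ denotes the $X$-valued function $x\mapsto h(x)z$ (the elementary tensor $h\otimes z$). A Banach space $X$ is UMD if for every $p\in(1,\infty)$ there is a constant $\beta_{p,X}\ge 1$ such that for every $\sigma$-finite measure space, every finite filtration, every finite $X$-valued $L^p$-martingale $\{f_k\}_{k=0}^n$ adapted to the filtration and all scalars $|\xi_k|=1$ one has $\left\|\sum_{k=1}^n\xi_k(f_k-f_{k-1})\right\|_{L^p}\le\beta_{p,X}\left\|\sum_{k=1}^n(f_k-f_{k-1})\right\|_{L^p}$. Let $\{f_k\}_k\subset L^p(I)$ be a countable system of scalar functions. - The system is $\otimes$-complete in $L^p(I;X)$ if the set of all finite sums $\sum_{k\in F}x_kf_k$ ($F$ a finite index set, $x_k\in X$) is dense in $L^p(I;X)$. - A system of bounded linear operators $t_n:L^p(I;X)\to X$ (indexed by the same set) is $\otimes$-biorthonormal to $\{f_k\}_k$ if $t_n(xf_k)=\delta_{nk}x$ for all $x\in X$ and all indices $n,k$. Here the operators $t_0^c,t_n^c,t_n^s$ correspond to the functions $\varphi_0^c,\varphi_n^c,\varphi_n^s$, respectively. *)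

theory Defs
  imports "HOL-Analysis.Analysis" "HOL-Probability.Conditional_Expectation"
begin

section \<open>Scalars\<close>

text \<open>
  A real normed field is isometrically isomorphic to the real or to the complex numbers, so
  the following predicate makes the real Banach space \<open>'x\<close> a Banach space over one of
  these two fields.
\<close>

definition normed_scaling :: "('k::real_normed_field \<Rightarrow> 'x::real_normed_vector \<Rightarrow> 'x) \<Rightarrow> bool" where
  "normed_scaling sc \<longleftrightarrow>
     vector_space sc \<and>
     (\<forall>r x. sc (of_real r) x = r *\<^sub>R x) \<and>
     (\<forall>c x. norm (sc c x) = norm c * norm x)"

lemma normed_scaling_scaleR: "normed_scaling (scaleR :: real \<Rightarrow> 'x::real_normed_vector \<Rightarrow> 'x)"
  unfolding normed_scaling_def by (simp add: real_vector.vector_space_axioms)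

lemma normed_scaling_complex: "normed_scaling ((*) :: complex \<Rightarrow> complex \<Rightarrow> complex)"
  unfolding normed_scaling_def
  by (auto simp: vector_space_def algebra_simps norm_mult scaleR_conv_of_real)

section \<open>Strong measurability, Bochner integral, Bochner spaces\<close>

text \<open>
  The Bochner integral of the library is only available for second countable (that is,
  separable) spaces. The definitions below are those of the library with Borel measurability
  replaced by strong measurability, so that they apply to every Banach space.
\<close>

definition strongly_measurable :: "'m measure \<Rightarrow> ('m \<Rightarrow> 'x::real_normed_vector) \<Rightarrow> bool" where
  "strongly_measurable M f \<longleftrightarrow>
     (\<exists>s. (\<forall>i. simple_function M (s i)) \<and> (\<forall>x\<in>space M. (\<lambda>i::nat. s i x) \<longlonglongrightarrow> f x))"

definition has_strong_integral ::
  "'m measure \<Rightarrow> ('m \<Rightarrow> 'x::real_normed_vector) \<Rightarrow> 'x \<Rightarrow> bool" where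
  "has_strong_integral M f z \<longleftrightarrow>
     strongly_measurable M f \<and>
     (\<exists>s. (\<forall>i. Bochner_Integration.simple_bochner_integrable M (s i)) \<and>
          (\<lambda>i::nat. \<integral>\<^sup>+x. ennreal (norm (f x - s i x)) \<partial>M) \<longlonglongrightarrow> 0 \<and>
          (\<lambda>i. Bochner_Integration.simple_bochner_integral M (s i)) \<longlonglongrightarrow> z)"

definition strong_integral :: "'m measure \<Rightarrow> ('m \<Rightarrow> 'x::real_normed_vector) \<Rightarrow> 'x" where
  "strong_integral M f = (THE z. has_strong_integral M f z)"

lemma has_strong_integral_iff_has_bochner_integral:
  fixes f :: "'m \<Rightarrow> 'x::{real_normed_vector, second_countable_topology}"
  shows "has_strong_integral M f z \<longleftrightarrow> has_bochner_integral M f z"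
proof -
  have "strongly_measurable M f \<longleftrightarrow> f \<in> borel_measurable M"
  proof
    assume "strongly_measurable M f"
    then show "f \<in> borel_measurable M"
      unfolding strongly_measurable_def
      by (blast intro: borel_measurable_LIMSEQ_metric borel_measurable_simple_function)
  next
    assume "f \<in> borel_measurable M"
    then show "strongly_measurable M f"
      unfolding strongly_measurable_def
      using borel_measurable_implies_sequence_metric[of f M 0] by blast
  qed
  then show ?thesis
    unfolding has_strong_integral_def has_bochner_integral.simps by blast
qed

text \<open>
  Elements of the Bochner space are represented by functions; two functions represent the same
  class iff \<open>Lp_norm\<close> of their difference vanishes.
\<close>

definition Lp_space :: "'m measure \<Rightarrow> real \<Rightarrow> ('m \<Rightarrow> 'x::real_normed_vector) set" where
  "Lp_space M p = {f. strongly_measurable M f \<and> integrable M (\<lambda>x. norm (f x) powr p)}"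

definition Lp_norm :: "'m measure \<Rightarrow> real \<Rightarrow> ('m \<Rightarrow> 'x::real_normed_vector) \<Rightarrow> real" where
  "Lp_norm M p f = (\<integral>x. norm (f x) powr p \<partial>M) powr (1 / p)"

section \<open>UMD spaces\<close>

definition finite_filtration :: "'m measure \<Rightarrow> nat \<Rightarrow> (nat \<Rightarrow> 'm measure) \<Rightarrow> bool" where
  "finite_filtration M n F \<longleftrightarrow>
     (\<forall>k\<le>n. sigma_finite_subalgebra M (F k)) \<and>
     (\<forall>j k. j \<le> k \<and> k \<le> n \<longrightarrow> sets (F j) \<subseteq> sets (F k))"

text \<open>
  The last clause says that the conditional expectation of \<open>f (Suc k)\<close> with respect to
  \<open>F k\<close> is \<open>f k\<close>. Sets of finite measure suffice, as \<open>F k\<close> is sigma-finite, and on them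
  functions in the Bochner space are integrable.
\<close>

definition Lp_martingale ::
  "'m measure \<Rightarrow> real \<Rightarrow> nat \<Rightarrow> (nat \<Rightarrow> 'm measure) \<Rightarrow> (nat \<Rightarrow> 'm \<Rightarrow> 'x::real_normed_vector) \<Rightarrow> bool"
  where
  "Lp_martingale M p n F f \<longleftrightarrow>
     (\<forall>k\<le>n. f k \<in> Lp_space M p \<and> strongly_measurable (restr_to_subalg M (F k)) (f k)) \<and>
     (\<forall>k<n. \<forall>A\<in>sets (F k). emeasure M A < \<infinity> \<longrightarrow>
        strong_integral M (\<lambda>x. indicator A x *\<^sub>R f (Suc k) x) =
        strong_integral M (\<lambda>x. indicator A x *\<^sub>R f k x))"

definition UMD_bound ::
  "('k::real_normed_field \<Rightarrow> 'x::real_normed_vector \<Rightarrow> 'x) \<Rightarrow> real \<Rightarrow> real \<Rightarrow> 'm measure \<Rightarrow> bool" where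
  "UMD_bound sc p \<beta> M \<longleftrightarrow>
     (\<forall>n F f. \<forall>\<xi> :: nat \<Rightarrow> 'k.
        finite_filtration M n F \<and> Lp_martingale M p n F f \<and> (\<forall>k\<in>{1..n}. norm (\<xi> k) = 1) \<longrightarrow>
        Lp_norm M p (\<lambda>x. \<Sum>k=1..n. sc (\<xi> k) (f k x - f (k - 1) x))
          \<le> \<beta> * Lp_norm M p (\<lambda>x. \<Sum>k=1..n. f k x - f (k - 1) x))"

text \<open>
  A formula cannot quantify over the type of the points of the measure space. The points are
  taken to be real numbers (with an arbitrary sigma-algebra on an arbitrary set of reals, and an
  arbitrary sigma-finite measure); this loses no generality, since a finite martingale of
  strongly measurable functions only involves countably many measurable sets. As a hypothesis,
  the property is formally weaker than the one for measure spaces over all types.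
\<close>

definition UMD :: "('k::real_normed_field \<Rightarrow> 'x::real_normed_vector \<Rightarrow> 'x) \<Rightarrow> bool" where
  "UMD sc \<longleftrightarrow>
     (\<forall>p>1. \<exists>\<beta>\<ge>1. \<forall>M :: real measure. sigma_finite_measure M \<longrightarrow> UMD_bound sc p \<beta> M)"

section \<open>Complete and biorthonormal systems\<close>

text \<open>
  Systems are indexed by a set \<open>J\<close>. The elementary tensor of a scalar function \<open>h\<close> and a
  vector \<open>z\<close> is \<open>\<lambda>x. sc (h x) z\<close>.
\<close>

definition scalar_system ::
  "'m measure \<Rightarrow> real \<Rightarrow> 'i set \<Rightarrow> ('i \<Rightarrow> 'm \<Rightarrow> 'k::real_normed_field) \<Rightarrow> bool" where
  "scalar_system M p J f \<longleftrightarrow> countable J \<and> (\<forall>k\<in>J. f k \<in> Lp_space M p)"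

definition tensor_complete ::
  "('k::real_normed_field \<Rightarrow> 'x::real_normed_vector \<Rightarrow> 'x) \<Rightarrow> 'm measure \<Rightarrow> real \<Rightarrow>
   'i set \<Rightarrow> ('i \<Rightarrow> 'm \<Rightarrow> 'k) \<Rightarrow> bool" where
  "tensor_complete sc M p J f \<longleftrightarrow>
     scalar_system M p J f \<and>
     (\<forall>g \<in> Lp_space M p. \<forall>\<epsilon>>0. \<exists>F z. finite F \<and> F \<subseteq> J \<and>
        Lp_norm M p (\<lambda>x. g x - (\<Sum>k\<in>F. sc (f k x) (z k))) < \<epsilon>)"

definition bounded_linear_Lp ::
  "('k::real_normed_field \<Rightarrow> 'x::real_normed_vector \<Rightarrow> 'x) \<Rightarrow> 'm measure \<Rightarrow> real \<Rightarrow>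
   (('m \<Rightarrow> 'x) \<Rightarrow> 'x) \<Rightarrow> bool" where
  "bounded_linear_Lp sc M p T \<longleftrightarrow>
     (\<forall>f\<in>Lp_space M p. \<forall>g\<in>Lp_space M p. T (\<lambda>x. f x + g x) = T f + T g) \<and>
     (\<forall>c. \<forall>f\<in>Lp_space M p. T (\<lambda>x. sc c (f x)) = sc c (T f)) \<and>
     (\<exists>C. \<forall>f\<in>Lp_space M p. norm (T f) \<le> C * Lp_norm M p f)"

definition tensor_biorthonormal ::
  "('k::real_normed_field \<Rightarrow> 'x::real_normed_vector \<Rightarrow> 'x) \<Rightarrow> 'm measure \<Rightarrow> real \<Rightarrow>
   'i set \<Rightarrow> ('i \<Rightarrow> 'm \<Rightarrow> 'k) \<Rightarrow> ('i \<Rightarrow> ('m \<Rightarrow> 'x) \<Rightarrow> 'x) \<Rightarrow> bool" where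
  "tensor_biorthonormal sc M p J f t \<longleftrightarrow>
     scalar_system M p J f \<and>
     (\<forall>n\<in>J. bounded_linear_Lp sc M p (t n)) \<and>
     (\<forall>n\<in>J. \<forall>k\<in>J. \<forall>z. t n (\<lambda>x. sc (f k x) z) = (if n = k then z else 0))"

section \<open>The trigonometric-type system\<close>

datatype trig_index = CosIx nat | SinIx nat

definition trig_indices :: "trig_index set" where
  "trig_indices = range CosIx \<union> SinIx ` {1..}"

abbreviation I_measure :: "real measure" where
  "I_measure \<equiv> lebesgue_on {0<..<2 * pi}"

fun phi_real :: "trig_index \<Rightarrow> real \<Rightarrow> real" where
  "phi_real (CosIx n) x = (if n = 0 then 1 else cos (real n * x))"
| "phi_real (SinIx n) x = - (x / (2 * real n)) * sin (real n * x)"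

fun v_real :: "trig_index \<Rightarrow> real \<Rightarrow> real" where
  "v_real (CosIx n) x =
     (if n = 0 then (2 * pi - x) / (2 * pi\<^sup>2) else (2 * pi - x) / pi\<^sup>2 * cos (real n * x))"
| "v_real (SinIx n) x = - (2 * real n / pi\<^sup>2) * sin (real n * x)"

definition phi :: "trig_index \<Rightarrow> real \<Rightarrow> 'k::real_normed_field" where
  "phi k x = of_real (phi_real k x)"

definition v :: "trig_index \<Rightarrow> real \<Rightarrow> 'k::real_normed_field" where
  "v k x = of_real (v_real k x)"

definition t_op ::
  "('k::real_normed_field \<Rightarrow> 'x::real_normed_vector \<Rightarrow> 'x) \<Rightarrow> trig_index \<Rightarrow> (real \<Rightarrow> 'x) \<Rightarrow> 'x" where
  "t_op sc k f = strong_integral I_measure (\<lambda>x. sc (v k x) (f x))"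

definition partial_sum_op ::
  "('k::real_normed_field \<Rightarrow> 'x::real_normed_vector \<Rightarrow> 'x) \<Rightarrow> nat \<Rightarrow> (real \<Rightarrow> 'x) \<Rightarrow> real \<Rightarrow> 'x" where
  "partial_sum_op sc n f = (\<lambda>x.
     sc (phi (CosIx 0) x) (t_op sc (CosIx 0) f) +
     (\<Sum>k=1..n. sc (phi (CosIx k) x) (t_op sc (CosIx k) f) +
               sc (phi (SinIx k) x) (t_op sc (SinIx k) f)))"

end

theory Submission
  imports Defs
begin

text \<open>
  With \<open>D\<close> the Dirichlet kernel, the kernel of \<open>P\<^sub>n\<close> is
  \<open>((2 * pi - y + x) * D (x - y) + (2 * pi - y - x) * D (x + y)) / (2 * pi\<^sup>2)\<close>, so that \<open>P\<^sub>n\<close> is a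
  combination of multiplications by bounded functions, the reflection \<open>x \<mapsto> 2 * pi - x\<close> and the partial
  sums of the Fourier series. The uniform bound therefore reduces to the one for the Fourier
  partial sums, and further, by modulation, to the boundedness of the periodic Hilbert transform.

  The latter is derived from the UMD property following Petermichl. On the cyclic group with \<open>4 ^ m\<close>
  elements, the shift that sends the Haar function \<open>(1, 1, -1, -1)\<close> of each 4-adic interval to
  \<open>(1, -1, -1, 1)\<close> is, up to a projection, a martingale transform. Its average over translations is a
  convolution operator with an odd symbol, and averaging over the dilations by odd integers \<open>r\<close>, which
  permute the group, with weights \<open>1 / r\<close> turns the symbol into a multiple of the sign function.

  Completeness comes from the identity \<open>pi * f = e ((2 * pi - x) * f) + x * o f\<close>, where \<open>e\<close> and \<open>o\<close> denote the
  even and odd parts with respect to the midpoint \<open>pi\<close>; uniqueness follows from completeness.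
\<close>

section \<open>Strong measurability and the strong integral\<close>

text \<open>The translation average alone is not enough: its limiting symbol
  \<open>profile_sum\<close> is tied to the scale 4. It agrees at the integers k and 4 * k, but
  nothing forces equal values elsewhere, and only the dilations remove this. A dilation costs
  nothing if it permutes the sample points; hence the martingale work is done on a cyclic group of
  order \<open>4 ^ m\<close>, where every odd r is admissible, and the circle is reached afterwards
  by Riemann sums. The Haar pair makes the symbol computable. Its profile is sin^3 s * (1 - cos s) /
  s^2, whose numerator combines sin (c * s) for c = 1, 2, 3, 4. With weight 1 / r the sum over odd r
  consists of series of sin (r * c * t) / r^3, quadratic in t for small t; the linear terms cancel
  and the constant pi / 16 remains. For r < 4^a about a scales contribute this constant, so division
  by a yields (pi / 16) * sgn k. The estimates use real scalars only: characters become cosines with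
  phases, and an imaginary symbol turns cosines into sines.\<close>

lemma simple_function_compose_pair:
  assumes "simple_function M f" "simple_function M g"
  shows "simple_function M (\<lambda>x. h (f x) (g x))"
  using simple_function_compose2[OF assms, of h] .

lemma strongly_measurable_simple: "simple_function M f \<Longrightarrow> strongly_measurable M f"
  unfolding strongly_measurable_def by (intro exI[of _ "\<lambda>_. f"]) auto

text \<open>The condition on \<open>h\<close> is sequential continuity, so composed simple
  approximants converge pointwise. Sums, differences, scalar products and bounded linear images are
  all instances.\<close>

lemma strongly_measurable_compose_pair:
  assumes "strongly_measurable M f" "strongly_measurable M g"
    and "\<And>X Y u v. X \<longlonglongrightarrow> u \<Longrightarrow> Y \<longlonglongrightarrow> v \<Longrightarrow> (\<lambda>i::nat. h (X i) (Y i)) \<longlonglongrightarrow> h u v"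
  shows "strongly_measurable M (\<lambda>x. h (f x) (g x))"
proof -
  from assms obtain s t where
    "\<And>i. simple_function M (s i)" "\<And>x. x \<in> space M \<Longrightarrow> (\<lambda>i::nat. s i x) \<longlonglongrightarrow> f x"
    "\<And>i. simple_function M (t i)" "\<And>x. x \<in> space M \<Longrightarrow> (\<lambda>i::nat. t i x) \<longlonglongrightarrow> g x"
    unfolding strongly_measurable_def by metis
  then show ?thesis unfolding strongly_measurable_def
    by (intro exI[of _ "\<lambda>i x. h (s i x) (t i x)"]) (auto intro: simple_function_compose_pair assms(3))
qed

lemma strongly_measurable_add:
  "strongly_measurable M f \<Longrightarrow> strongly_measurable M g \<Longrightarrow> strongly_measurable M (\<lambda>x. f x + g x)"
  by (rule strongly_measurable_compose_pair) (auto intro: tendsto_add)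

lemma strongly_measurable_diff:
  "strongly_measurable M f \<Longrightarrow> strongly_measurable M g \<Longrightarrow> strongly_measurable M (\<lambda>x. f x - g x)"
  by (rule strongly_measurable_compose_pair) (auto intro: tendsto_diff)

lemma strongly_measurable_borel:
  fixes g :: "'m \<Rightarrow> real"
  assumes "g \<in> borel_measurable M"
  shows "strongly_measurable M g"
  unfolding strongly_measurable_def
  using borel_measurable_implies_sequence_metric[OF assms, of 0] by blast

lemma strongly_measurable_scaleR:
  assumes "g \<in> borel_measurable M" "strongly_measurable M f"
  shows "strongly_measurable M (\<lambda>x. g x *\<^sub>R f x)"
  using strongly_measurable_borel[OF assms(1)] assms(2)
  by (rule strongly_measurable_compose_pair) (auto intro: tendsto_scaleR)

lemma strongly_measurable_const: "strongly_measurable M (\<lambda>x. z)"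
  by (rule strongly_measurable_simple) simp

lemma strongly_measurable_bounded_linear:
  assumes "bounded_linear L" "strongly_measurable M f"
  shows "strongly_measurable M (\<lambda>x. L (f x))"
  using assms(2,2)
  by (rule strongly_measurable_compose_pair) (rule bounded_linear.tendsto[OF assms(1)])

lemma strongly_measurable_norm:
  assumes "strongly_measurable M f"
  shows "(\<lambda>x. norm (f x)) \<in> borel_measurable M"
proof -
  from assms obtain s where "\<And>i. simple_function M (s i)"
    "\<And>x. x \<in> space M \<Longrightarrow> (\<lambda>i::nat. s i x) \<longlonglongrightarrow> f x"
    unfolding strongly_measurable_def by metis
  note s = this
  show ?thesis
  proof (rule borel_measurable_LIMSEQ_real)
    show "(\<lambda>i. norm (s i x)) \<longlonglongrightarrow> norm (f x)" if "x \<in> space M" for x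
      by (rule tendsto_norm[OF s(2)[OF that]])
    show "(\<lambda>x. norm (s i x)) \<in> borel_measurable M" for i
      by (rule borel_measurable_simple_function[OF simple_function_compose1[OF s(1)]])
  qed
qed

text \<open>Approximants are replaced by 0 wherever they exceed \<open>2 * norm (f x)\<close>. Where
  \<open>f x\<close> is nonzero the cut eventually stops acting; where \<open>f x = 0\<close> it
  forces the value 0. The bound supplies the dominating function for all later limits.\<close>

lemma strongly_measurable_approx:
  assumes "strongly_measurable M f"
  obtains s where "\<And>i::nat. simple_function M (s i)" "\<And>x. x \<in> space M \<Longrightarrow> (\<lambda>i. s i x) \<longlonglongrightarrow> f x"
    "\<And>i x. norm (s i x) \<le> 2 * norm (f x)"
proof -
  from assms obtain t where t: "\<And>i. simple_function M (t i)"
    "\<And>x. x \<in> space M \<Longrightarrow> (\<lambda>i::nat. t i x) \<longlonglongrightarrow> f x"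
    unfolding strongly_measurable_def by metis
  define A where "A i = {x\<in>space M. norm (t i x) \<le> 2 * norm (f x)}" for i
  have A: "A i \<in> sets M" for i
  proof -
    have [measurable]: "(\<lambda>x. norm (t i x)) \<in> borel_measurable M" "(\<lambda>x. norm (f x)) \<in> borel_measurable M"
      using strongly_measurable_norm t(1) strongly_measurable_simple assms by blast+
    show ?thesis unfolding A_def by measurable
  qed
  define s where "s i x = (if x \<in> A i then t i x else 0)" for i x
  have "simple_function M (s i)" for i
  proof -
    have "simple_function M (\<lambda>x. indicator (A i) x *\<^sub>R t i x)"
      by (rule simple_function_compose_pair[OF _ t(1)]) (use A in auto)
    moreover have "s i = (\<lambda>x. (indicator (A i) x :: real) *\<^sub>R t i x)"
      by (auto simp: s_def)
    ultimately show ?thesis by simp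
  qed
  moreover have "(\<lambda>i. s i x) \<longlonglongrightarrow> f x" if x: "x \<in> space M" for x
  proof (cases "f x = 0")
    case True
    then have "s i x = 0" for i by (auto simp: s_def A_def)
    with True show ?thesis by simp
  next
    case False
    then have "norm (f x) < 2 * norm (f x)" by simp
    with tendsto_norm[OF t(2)[OF x]] have "\<forall>\<^sub>F i in sequentially. norm (t i x) < 2 * norm (f x)"
      by (rule order_tendstoD(2))
    then have "\<forall>\<^sub>F i in sequentially. t i x = s i x"
      by eventually_elim (auto simp: s_def A_def x)
    then show ?thesis using t(2)[OF x] by (rule Lim_transform_eventually[rotated])
  qed
  moreover have "norm (s i x) \<le> 2 * norm (f x)" for i x
    by (auto simp: s_def A_def)
  ultimately show thesis by (rule that)
qed

text \<open>Both integrals are compared through \<open>f\<close>. With two approximating sequences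
  this gives uniqueness of the integral, with a single one the Cauchy property, and with
  \<open>t = 0\<close> the norm bound.\<close>

lemma simple_bochner_integral_strong_bounded:
  assumes f: "strongly_measurable M f"
  assumes s: "Bochner_Integration.simple_bochner_integrable M s" and t: "Bochner_Integration.simple_bochner_integrable M t"
  shows "ennreal (norm (Bochner_Integration.simple_bochner_integral M s - Bochner_Integration.simple_bochner_integral M t)) \<le>
    (\<integral>\<^sup>+ x. norm (f x - s x) \<partial>M) + (\<integral>\<^sup>+ x. norm (f x - t x) \<partial>M)"
proof -
  have sm: "simple_function M s" "simple_function M t"
    using s t by (auto elim: simple_bochner_integrable.cases)
  have [measurable]: "(\<lambda>x. norm (f x - s x)) \<in> borel_measurable M" "(\<lambda>x. norm (f x - t x)) \<in> borel_measurable M"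
    using sm f by (auto intro!: strongly_measurable_norm strongly_measurable_diff intro: strongly_measurable_simple)
  have "ennreal (norm (Bochner_Integration.simple_bochner_integral M s - Bochner_Integration.simple_bochner_integral M t))
      = norm (Bochner_Integration.simple_bochner_integral M (\<lambda>x. s x - t x))"
    using s t by (subst simple_bochner_integral_diff) auto
  also have "\<dots> \<le> Bochner_Integration.simple_bochner_integral M (\<lambda>x. norm (s x - t x))"
    using simple_bochner_integrable_compose2[of "(-)" M "s" "t"] s t
    by (auto intro!: simple_bochner_integral_norm_bound)
  also have "\<dots> = (\<integral>\<^sup>+x. norm (s x - t x) \<partial>M)"
    using simple_bochner_integrable_compose2[of "\<lambda>x y. norm (x - y)" M "s" "t"] s t
    by (auto intro!: simple_bochner_integral_eq_nn_integral)
  also have "\<dots> \<le> (\<integral>\<^sup>+x. ennreal (norm (f x - s x)) + ennreal (norm (f x - t x)) \<partial>M)"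
  proof -
    have "norm (s x - t x) \<le> norm (f x - s x) + norm (f x - t x)" for x
      by (metis dual_order.refl norm_diff_triangle_le norm_minus_commute)
    then show ?thesis
      by (metis (mono_tags, lifting) ennreal_leI ennreal_plus nn_integral_mono norm_ge_zero)
  qed
  also have "\<dots> = (\<integral>\<^sup>+ x. norm (f x - s x) \<partial>M) + (\<integral>\<^sup>+ x. norm (f x - t x) \<partial>M)"
   by (rule nn_integral_add) auto
  finally show ?thesis .
qed

lemma has_strong_integralE:
  assumes "has_strong_integral M f z"
  obtains s where "strongly_measurable M f" "\<And>i. Bochner_Integration.simple_bochner_integrable M (s i)"
       "(\<lambda>i::nat. \<integral>\<^sup>+x. ennreal (norm (f x - s i x)) \<partial>M) \<longlonglongrightarrow> 0"
       "(\<lambda>i. Bochner_Integration.simple_bochner_integral M (s i)) \<longlonglongrightarrow> z"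
proof -
  from assms have f: "strongly_measurable M f"
    and ex: "\<exists>s. (\<forall>i. Bochner_Integration.simple_bochner_integrable M (s i)) \<and>
          (\<lambda>i::nat. \<integral>\<^sup>+x. ennreal (norm (f x - s i x)) \<partial>M) \<longlonglongrightarrow> 0 \<and>
          (\<lambda>i. Bochner_Integration.simple_bochner_integral M (s i)) \<longlonglongrightarrow> z"
    unfolding has_strong_integral_def by simp_all
  from ex show thesis
    by (elim exE conjE) (rule that[OF f], simp_all)
qed

lemma has_strong_integral_unique:
  assumes "has_strong_integral M f z" "has_strong_integral M f w"
  shows "z = w"
proof -
  from assms(1) obtain s where f: "strongly_measurable M f"
    and s: "\<And>i. Bochner_Integration.simple_bochner_integrable M (s i)"
       "(\<lambda>i::nat. \<integral>\<^sup>+x. ennreal (norm (f x - s i x)) \<partial>M) \<longlonglongrightarrow> 0"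
       "(\<lambda>i. Bochner_Integration.simple_bochner_integral M (s i)) \<longlonglongrightarrow> z"
    by (rule has_strong_integralE) blast
  from assms(2) obtain t where t: "\<And>i. Bochner_Integration.simple_bochner_integrable M (t i)"
       "(\<lambda>i::nat. \<integral>\<^sup>+x. ennreal (norm (f x - t i x)) \<partial>M) \<longlonglongrightarrow> 0"
       "(\<lambda>i. Bochner_Integration.simple_bochner_integral M (t i)) \<longlonglongrightarrow> w"
    by (rule has_strong_integralE) blast
  have "(\<lambda>i. ennreal (norm (Bochner_Integration.simple_bochner_integral M (s i) - Bochner_Integration.simple_bochner_integral M (t i)))) \<longlonglongrightarrow> ennreal 0"
  proof (rule tendsto_sandwich[where f="\<lambda>_. 0"])
    show "(\<lambda>i. (\<integral>\<^sup>+ x. norm (f x - s i x) \<partial>M) + (\<integral>\<^sup>+ x. norm (f x - t i x) \<partial>M)) \<longlonglongrightarrow> ennreal 0"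
      using tendsto_add[OF s(2) t(2)] by simp
  qed (auto simp: simple_bochner_integral_strong_bounded[OF f s(1) t(1)])
  then have "(\<lambda>i. norm (Bochner_Integration.simple_bochner_integral M (s i) - Bochner_Integration.simple_bochner_integral M (t i))) \<longlonglongrightarrow> 0"
    by (simp flip: ennreal_0)
  moreover have "(\<lambda>i. norm (Bochner_Integration.simple_bochner_integral M (s i) - Bochner_Integration.simple_bochner_integral M (t i))) \<longlonglongrightarrow> norm (z - w)"
    by (rule tendsto_norm[OF tendsto_diff[OF s(3) t(3)]])
  ultimately show ?thesis using LIMSEQ_unique by fastforce
qed

lemma strong_integral_eq: "has_strong_integral M f z \<Longrightarrow> strong_integral M f = z"
  unfolding strong_integral_def by (rule the_equality) (auto intro: has_strong_integral_unique)

lemma has_strong_integral_bound: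
  assumes "has_strong_integral M f z"
  shows "ennreal (norm z) \<le> (\<integral>\<^sup>+x. ennreal (norm (f x)) \<partial>M)"
proof -
  from assms obtain s where f: "strongly_measurable M f"
    and s: "\<And>i. Bochner_Integration.simple_bochner_integrable M (s i)"
       "(\<lambda>i::nat. \<integral>\<^sup>+x. ennreal (norm (f x - s i x)) \<partial>M) \<longlonglongrightarrow> 0"
       "(\<lambda>i. Bochner_Integration.simple_bochner_integral M (s i)) \<longlonglongrightarrow> z"
    by (rule has_strong_integralE) blast
  have z: "Bochner_Integration.simple_bochner_integrable M (\<lambda>x. 0::'b)" "Bochner_Integration.simple_bochner_integral M (\<lambda>x. 0::'b) = 0"
    by (auto intro: simple_bochner_integrable.intros simp: simple_bochner_integral_def image_constant_conv)
  have "(\<lambda>i. ennreal (norm (Bochner_Integration.simple_bochner_integral M (s i)))) \<longlonglongrightarrow> ennreal (norm z)"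
    by (rule tendsto_ennrealI[OF tendsto_norm[OF s(3)]])
  moreover have "(\<lambda>i. (\<integral>\<^sup>+x. ennreal (norm (f x - s i x)) \<partial>M) + (\<integral>\<^sup>+x. ennreal (norm (f x)) \<partial>M))
      \<longlonglongrightarrow> 0 + (\<integral>\<^sup>+x. ennreal (norm (f x)) \<partial>M)"
    by (rule tendsto_add[OF s(2) tendsto_const])
  ultimately have "ennreal (norm z) \<le> 0 + (\<integral>\<^sup>+x. ennreal (norm (f x)) \<partial>M)"
  proof (rule LIMSEQ_le)
    show "\<exists>N. \<forall>n\<ge>N. ennreal (norm (Bochner_Integration.simple_bochner_integral M (s n)))
        \<le> (\<integral>\<^sup>+x. ennreal (norm (f x - s n x)) \<partial>M) + (\<integral>\<^sup>+x. ennreal (norm (f x)) \<partial>M)"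
      using simple_bochner_integral_strong_bounded[OF f s(1) z(1)] z(2) by simp
  qed
  then show ?thesis by simp
qed

text \<open>The truncated approximants are dominated by a multiple of \<open>norm (f x)\<close>, so
  their L1 distance to \<open>f\<close> tends to 0. Their integrals are then Cauchy, and
  completeness of the range provides the value.\<close>

lemma has_strong_integral_exists:
  fixes f :: "'m \<Rightarrow> 'x::banach"
  assumes f: "strongly_measurable M f" and int: "(\<integral>\<^sup>+x. ennreal (norm (f x)) \<partial>M) < \<infinity>"
  shows "\<exists>z. has_strong_integral M f z"
proof -
  obtain s where s: "\<And>i::nat. simple_function M (s i)" "\<And>x. x \<in> space M \<Longrightarrow> (\<lambda>i. s i x) \<longlonglongrightarrow> f x"
    "\<And>i x. norm (s i x) \<le> 2 * norm (f x)"
    using strongly_measurable_approx[OF f] by blast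
  note [measurable] = strongly_measurable_norm[OF f]
  have b: "Bochner_Integration.simple_bochner_integrable M (s i)" for i
  proof (rule simple_bochner_integrableI_bounded[OF s(1)])
    have "(\<integral>\<^sup>+x. norm (s i x) \<partial>M) \<le> (\<integral>\<^sup>+x. 2 * ennreal (norm (f x)) \<partial>M)"
      using s(3) by (intro nn_integral_mono) (metis ennreal_leI ennreal_mult' ennreal_numeral zero_le_numeral)
    also have "\<dots> = 2 * (\<integral>\<^sup>+x. ennreal (norm (f x)) \<partial>M)"
      by (rule nn_integral_cmult) measurable
    also have "\<dots> < \<infinity>" using int by (auto simp: ennreal_mult_less_top)
    finally show "(\<integral>\<^sup>+x. norm (s i x) \<partial>M) < \<infinity>" .
  qed
  have lim: "(\<lambda>i. \<integral>\<^sup>+x. ennreal (norm (f x - s i x)) \<partial>M) \<longlonglongrightarrow> (\<integral>\<^sup>+x. 0 \<partial>M)"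
  proof (rule nn_integral_dominated_convergence[where w="\<lambda>x. 3 * ennreal (norm (f x))"])
    show "(\<lambda>x. ennreal (norm (f x - s i x))) \<in> borel_measurable M" for i
      using strongly_measurable_norm[OF strongly_measurable_diff[OF f strongly_measurable_simple[OF s(1)]]]
      by measurable
    have "norm (f x - s i x) \<le> 3 * norm (f x)" for i x
      using norm_triangle_ineq4[of "f x" "s i x"] s(3)[of i x] by linarith
    then show "AE x in M. ennreal (norm (f x - s i x)) \<le> 3 * ennreal (norm (f x))" for i
      by (intro AE_I2) (metis ennreal_leI ennreal_mult' ennreal_numeral zero_le_numeral)
    show "AE x in M. (\<lambda>i. ennreal (norm (f x - s i x))) \<longlonglongrightarrow> 0"
    proof (intro AE_I2)
      fix x assume "x \<in> space M"
      then have "(\<lambda>i. norm (f x - s i x)) \<longlonglongrightarrow> norm (f x - f x)"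
        using s(2) by (intro tendsto_norm tendsto_diff tendsto_const)
      then show "(\<lambda>i. ennreal (norm (f x - s i x))) \<longlonglongrightarrow> 0"
        using tendsto_ennrealI by fastforce
    qed
    have "(\<integral>\<^sup>+x. 3 * ennreal (norm (f x)) \<partial>M) = 3 * (\<integral>\<^sup>+x. ennreal (norm (f x)) \<partial>M)"
      by (rule nn_integral_cmult) measurable
    then show "(\<integral>\<^sup>+x. 3 * ennreal (norm (f x)) \<partial>M) < \<infinity>" using int by (auto simp: ennreal_mult_less_top)
  qed auto
  have "Cauchy (\<lambda>i. Bochner_Integration.simple_bochner_integral M (s i))"
  proof (rule CauchyI)
    fix e :: real assume e: "e > 0"
    have "\<forall>\<^sub>F i in sequentially. (\<integral>\<^sup>+x. ennreal (norm (f x - s i x)) \<partial>M) < ennreal (e/2)"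
      using lim e by (intro order_tendstoD(2)[OF lim]) (auto simp: ennreal_zero_less_divide)
    then obtain N where N: "\<And>i. i \<ge> N \<Longrightarrow> (\<integral>\<^sup>+x. ennreal (norm (f x - s i x)) \<partial>M) < ennreal (e/2)"
      unfolding eventually_sequentially by blast
    have "norm (Bochner_Integration.simple_bochner_integral M (s i) - Bochner_Integration.simple_bochner_integral M (s j)) < e"
      if "i \<ge> N" "j \<ge> N" for i j
    proof -
      have "ennreal (norm (Bochner_Integration.simple_bochner_integral M (s i) - Bochner_Integration.simple_bochner_integral M (s j)))
         < ennreal (e/2) + ennreal (e/2)"
        by (rule le_less_trans[OF simple_bochner_integral_strong_bounded[OF f b b]])
           (intro add_strict_mono N that)
      also have "\<dots> = ennreal e" using e by (simp flip: ennreal_plus)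
      finally show ?thesis using e by (simp add: ennreal_less_iff)
    qed
    then show "\<exists>N. \<forall>i\<ge>N. \<forall>j\<ge>N. norm (Bochner_Integration.simple_bochner_integral M (s i) - Bochner_Integration.simple_bochner_integral M (s j)) < e"
      by blast
  qed
  then obtain z where "(\<lambda>i. Bochner_Integration.simple_bochner_integral M (s i)) \<longlonglongrightarrow> z"
    using Cauchy_convergent convergent_def by blast
  then show ?thesis unfolding has_strong_integral_def using f b lim by auto
qed

lemma has_strong_integral_strong_integral:
  fixes f :: "'m \<Rightarrow> 'x::banach"
  assumes "strongly_measurable M f" "integrable M (\<lambda>x. norm (f x))"
  shows "has_strong_integral M f (strong_integral M f)"
proof -
  have "(\<integral>\<^sup>+x. ennreal (norm (f x)) \<partial>M) < \<infinity>"
    using assms(2) by (simp add: integrable_iff_bounded)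
  from has_strong_integral_exists[OF assms(1) this] show ?thesis
    using strong_integral_eq by metis
qed

lemma norm_strong_integral_le:
  fixes f :: "'m \<Rightarrow> 'x::banach"
  assumes "strongly_measurable M f" "integrable M (\<lambda>x. norm (f x))"
  shows "norm (strong_integral M f) \<le> (\<integral>x. norm (f x) \<partial>M)"
proof -
  have "ennreal (norm (strong_integral M f)) \<le> (\<integral>\<^sup>+x. ennreal (norm (f x)) \<partial>M)"
    by (rule has_strong_integral_bound[OF has_strong_integral_strong_integral[OF assms]])
  also have "\<dots> = ennreal (\<integral>x. norm (f x) \<partial>M)"
    by (rule nn_integral_eq_integral[OF assms(2)]) simp
  finally show ?thesis by (simp add: ennreal_le_iff integral_nonneg)
qed

lemma has_strong_integral_add:
  assumes "has_strong_integral M f z" "has_strong_integral M g w"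
  shows "has_strong_integral M (\<lambda>x. f x + g x) (z + w)"
proof -
  from assms(1) obtain s where f: "strongly_measurable M f"
    and s: "\<And>i. Bochner_Integration.simple_bochner_integrable M (s i)"
       "(\<lambda>i::nat. \<integral>\<^sup>+x. ennreal (norm (f x - s i x)) \<partial>M) \<longlonglongrightarrow> 0"
       "(\<lambda>i. Bochner_Integration.simple_bochner_integral M (s i)) \<longlonglongrightarrow> z"
    by (rule has_strong_integralE) blast
  from assms(2) obtain t where g: "strongly_measurable M g" and t: "\<And>i. Bochner_Integration.simple_bochner_integrable M (t i)"
       "(\<lambda>i::nat. \<integral>\<^sup>+x. ennreal (norm (g x - t i x)) \<partial>M) \<longlonglongrightarrow> 0"
       "(\<lambda>i. Bochner_Integration.simple_bochner_integral M (t i)) \<longlonglongrightarrow> w"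
    by (rule has_strong_integralE) blast
  have sm: "simple_function M (s i)" "simple_function M (t i)" for i
    using s t by (auto elim: simple_bochner_integrable.cases)
  have [measurable]: "(\<lambda>x. norm (f x - s i x)) \<in> borel_measurable M"
      "(\<lambda>x. norm (g x - t i x)) \<in> borel_measurable M" for i
    using sm f g by (auto intro!: strongly_measurable_norm strongly_measurable_diff intro: strongly_measurable_simple)
  have "(\<lambda>i. \<integral>\<^sup>+x. ennreal (norm (f x + g x - (s i x + t i x))) \<partial>M) \<longlonglongrightarrow> 0"
  proof (rule tendsto_sandwich[where f="\<lambda>_. 0"])
    show "(\<lambda>i. (\<integral>\<^sup>+ x. norm (f x - s i x) \<partial>M) + (\<integral>\<^sup>+ x. norm (g x - t i x) \<partial>M)) \<longlonglongrightarrow> 0"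
      using tendsto_add[OF s(2) t(2)] by simp
    have "(\<integral>\<^sup>+x. ennreal (norm (f x + g x - (s i x + t i x))) \<partial>M)
       \<le> (\<integral>\<^sup>+x. ennreal (norm (f x - s i x)) + ennreal (norm (g x - t i x)) \<partial>M)" for i
      by (auto intro!: nn_integral_mono norm_diff_triangle_ineq simp flip: ennreal_plus)
    also have "\<dots> i = (\<integral>\<^sup>+ x. norm (f x - s i x) \<partial>M) + (\<integral>\<^sup>+ x. norm (g x - t i x) \<partial>M)" for i
      by (intro nn_integral_add) auto
    finally show "\<forall>\<^sub>F i in sequentially. (\<integral>\<^sup>+x. ennreal (norm (f x + g x - (s i x + t i x))) \<partial>M)
       \<le> (\<integral>\<^sup>+ x. norm (f x - s i x) \<partial>M) + (\<integral>\<^sup>+ x. norm (g x - t i x) \<partial>M)" by simp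
  qed auto
  moreover have "(\<lambda>i. Bochner_Integration.simple_bochner_integral M (\<lambda>x. s i x + t i x)) \<longlonglongrightarrow> z + w"
    using tendsto_add[OF s(3) t(3)] s t by (simp add: simple_bochner_integral_add)
  moreover have "\<And>i. Bochner_Integration.simple_bochner_integrable M (\<lambda>x. s i x + t i x)"
    using s t by (simp add: simple_bochner_integrable_compose2)
  ultimately show ?thesis unfolding has_strong_integral_def
    by (intro conjI strongly_measurable_add[OF f g] exI[of _ "\<lambda>i x. s i x + t i x"]) simp_all
qed

lemma has_strong_integral_bounded_linear:
  assumes L: "bounded_linear L" and "has_strong_integral M f z"
  shows "has_strong_integral M (\<lambda>x. L (f x)) (L z)"
proof -
  interpret L: bounded_linear L by fact
  from assms(2) obtain s where f: "strongly_measurable M f"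
    and s: "\<And>i. Bochner_Integration.simple_bochner_integrable M (s i)"
       "(\<lambda>i::nat. \<integral>\<^sup>+x. ennreal (norm (f x - s i x)) \<partial>M) \<longlonglongrightarrow> 0"
       "(\<lambda>i. Bochner_Integration.simple_bochner_integral M (s i)) \<longlonglongrightarrow> z"
    by (rule has_strong_integralE) blast
  have sm: "simple_function M (s i)" for i
    using s by (auto elim: simple_bochner_integrable.cases)
  have [measurable]: "(\<lambda>x. norm (f x - s i x)) \<in> borel_measurable M" for i
    using sm f by (auto intro!: strongly_measurable_norm strongly_measurable_diff intro: strongly_measurable_simple)
  obtain K where K: "K > 0" "\<And>x. norm (L x) \<le> norm x * K" using L.pos_bounded by blast
  have "(\<lambda>i. \<integral>\<^sup>+x. ennreal (norm (L (f x) - L (s i x))) \<partial>M) \<longlonglongrightarrow> 0"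
  proof (rule tendsto_sandwich[where f="\<lambda>_. 0"])
    show "(\<lambda>i. ennreal K * (\<integral>\<^sup>+ x. norm (f x - s i x) \<partial>M)) \<longlonglongrightarrow> 0"
      using ennreal_tendsto_cmult[OF _ s(2), of "ennreal K"] by simp
    have "(\<integral>\<^sup>+x. ennreal (norm (L (f x) - L (s i x))) \<partial>M)
       \<le> (\<integral>\<^sup>+x. ennreal K * ennreal (norm (f x - s i x)) \<partial>M)" for i
      using K(2)[of "f _ - s i _"] K(1)
      by (auto intro!: nn_integral_mono simp: L.diff mult.commute simp flip: ennreal_mult)
    also have "\<dots> i = ennreal K * (\<integral>\<^sup>+ x. norm (f x - s i x) \<partial>M)" for i
      by (intro nn_integral_cmult) auto
    finally show "\<forall>\<^sub>F i in sequentially. (\<integral>\<^sup>+x. ennreal (norm (L (f x) - L (s i x))) \<partial>M)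
       \<le> ennreal K * (\<integral>\<^sup>+ x. norm (f x - s i x) \<partial>M)" by simp
  qed auto
  moreover have "(\<lambda>i. Bochner_Integration.simple_bochner_integral M (\<lambda>x. L (s i x))) \<longlonglongrightarrow> L z"
    using L.tendsto[OF s(3)] s by (simp add: simple_bochner_integral_linear L.linear_axioms)
  moreover have "\<And>i. Bochner_Integration.simple_bochner_integrable M (\<lambda>x. L (s i x))"
    by (rule simple_bochner_integrable_compose2[where p="\<lambda>x y. L x", OF _ s(1) s(1)]) (rule L.zero)
  ultimately show ?thesis unfolding has_strong_integral_def
    by (intro conjI strongly_measurable_bounded_linear[OF L f] exI[of _ "\<lambda>i x. L (s i x)"]) simp_all
qed

text \<open>For real functions the strong integral is the usual one; it is pushed through the
  bounded linear map from r to r times \<open>z\<close>.\<close>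

lemma has_strong_integral_scaleR_left:
  fixes z :: "'x::real_normed_vector" and g :: "'m \<Rightarrow> real"
  assumes "integrable M g"
  shows "has_strong_integral M (\<lambda>x. g x *\<^sub>R z) ((\<integral>x. g x \<partial>M) *\<^sub>R z)"
  by (rule has_strong_integral_bounded_linear[OF bounded_linear_scaleR_left])
     (simp add: has_strong_integral_iff_has_bochner_integral has_bochner_integral_integrable assms)

lemma has_strong_integral_0: "has_strong_integral M (\<lambda>x. 0) 0"
  using has_strong_integral_scaleR_left[of M "\<lambda>x. 0" 0] by simp

lemma has_strong_integral_sum:
  "(\<And>i. i \<in> S \<Longrightarrow> has_strong_integral M (f i) (z i)) \<Longrightarrow>
   has_strong_integral M (\<lambda>x. \<Sum>i\<in>S. f i x) (\<Sum>i\<in>S. z i)"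
  by (induction S rule: infinite_finite_induct)
     (auto intro: has_strong_integral_add has_strong_integral_0)

section \<open>Martingale transforms on finite sets\<close>

text \<open>The inequality for positive points extends to the endpoint 0, where it reduces to u^p
  \<le> u for 0 < u < 1.\<close>

lemma convex_on_powr:
  fixes p :: real
  assumes "1 \<le> p"
  shows "convex_on {0..} (\<lambda>x. x powr p)"
proof (rule convex_onI)
  fix t x y :: real
  assume t: "0 < t" "t < 1" and xy: "x \<in> {0..}" "y \<in> {0..}"
  have small: "(u * z) powr p \<le> u * z powr p" if "0 < u" "u < 1" "0 \<le> z" for u z
  proof -
    have "u powr p \<le> u powr 1" using that assms by (intro powr_mono') auto
    then show ?thesis using that by (simp add: powr_mult mult_right_mono)
  qed
  consider "x = 0" | "y = 0" | "x > 0" "y > 0" using xy by force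
  then show "((1 - t) *\<^sub>R x + t *\<^sub>R y) powr p \<le> (1 - t) * x powr p + t * y powr p"
  proof cases
    case 3
    then show ?thesis using convex_onD[OF powr_convex[OF assms], of t x y] t by simp
  qed (use small[of t y] small[of "1 - t" x] t xy in auto)
qed simp

text \<open>Jensen's inequality for the weights divided by their total; undoing the normalisation
  costs the factor total^(p - 1). An arbitrary total is allowed because the weights of the dilation
  average are only known to sum to at most 2.\<close>

lemma norm_weighted_sum_powr_le:
  fixes x :: "'i \<Rightarrow> 'x::real_normed_vector"
  assumes S: "finite S" and w: "\<And>i. i \<in> S \<Longrightarrow> 0 \<le> w i" and p: "1 \<le> p"
  shows "norm (\<Sum>i\<in>S. w i *\<^sub>R x i) powr p \<le> (\<Sum>i\<in>S. w i) powr (p - 1) * (\<Sum>i\<in>S. w i * norm (x i) powr p)"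
proof -
  define W where "W = (\<Sum>i\<in>S. w i)"
  have "W \<ge> 0" unfolding W_def by (intro sum_nonneg w)
  show ?thesis
  proof (cases "W = 0")
    case True
    then have "\<And>i. i \<in> S \<Longrightarrow> w i = 0" unfolding W_def using S w by (simp add: sum_nonneg_eq_0_iff)
    then show ?thesis using p by simp
  next
    case False
    with \<open>W \<ge> 0\<close> have W: "W > 0" by simp
    then have ne: "S \<noteq> {}" unfolding W_def by auto
    have "norm (\<Sum>i\<in>S. w i *\<^sub>R x i) \<le> (\<Sum>i\<in>S. w i * norm (x i))"
      by (rule order_trans[OF norm_sum]) (auto intro!: sum_mono simp: w)
    also have "\<dots> = W * (\<Sum>i\<in>S. (w i / W) *\<^sub>R norm (x i))"
      using W by (simp add: sum_distrib_left)
    finally have "norm (\<Sum>i\<in>S. w i *\<^sub>R x i) powr p \<le> (W * (\<Sum>i\<in>S. (w i / W) *\<^sub>R norm (x i))) powr p"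
      using p by (intro powr_mono2) auto
    also have "\<dots> = W powr p * (\<Sum>i\<in>S. (w i / W) *\<^sub>R norm (x i)) powr p"
      using W w by (intro powr_mult)
    also have "\<dots> \<le> W powr p * (\<Sum>i\<in>S. (w i / W) * norm (x i) powr p)"
      using W w by (intro mult_left_mono convex_on_sum[OF S ne convex_on_powr[OF p]])
        (auto simp: W_def simp flip: sum_divide_distrib)
    also have "\<dots> = W powr (p - 1) * (\<Sum>i\<in>S. w i * norm (x i) powr p)"
      using W by (simp add: sum_distrib_left powr_diff field_simps)
    finally show ?thesis unfolding W_def .
  qed
qed

lemma norm_sum_powr_le:
  fixes x :: "'i \<Rightarrow> 'x::real_normed_vector"
  assumes "finite S" "1 \<le> p"
  shows "norm (\<Sum>i\<in>S. x i) powr p \<le> real (card S) powr (p - 1) * (\<Sum>i\<in>S. norm (x i) powr p)"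
  using norm_weighted_sum_powr_le[of S "\<lambda>_. 1" p x] assms by simp

lemma norm_add_powr_le:
  fixes x y :: "'x::real_normed_vector"
  assumes "1 \<le> p"
  shows "norm (x + y) powr p \<le> 2 powr (p - 1) * (norm x powr p + norm y powr p)"
  using norm_sum_powr_le[of UNIV p "\<lambda>b. if b then x else y"] assms by (simp add: UNIV_bool add.commute)

lemma norm_diff_powr_le:
  fixes x y :: "'x::real_normed_vector"
  assumes "1 \<le> p"
  shows "norm (x - y) powr p \<le> 2 powr (p - 1) * (norm x powr p + norm y powr p)"
  using norm_add_powr_le[of p x "-y"] assms by simp

lemma simple_function_count_space_finite: "finite A \<Longrightarrow> simple_function (count_space A) f"
  by (auto simp: simple_function_def)

lemma has_strong_integral_count_space:
  assumes A: "finite A"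
  shows "has_strong_integral (count_space A) f (\<Sum>x\<in>A. f x)"
proof -
  have b: "Bochner_Integration.simple_bochner_integrable (count_space A) f"
  proof
    have "emeasure (count_space A) {y \<in> space (count_space A). f y \<noteq> 0} = card {y \<in> A. f y \<noteq> 0}"
      using A by (subst emeasure_count_space_finite) auto
    then show "emeasure (count_space A) {y \<in> space (count_space A). f y \<noteq> 0} \<noteq> \<infinity>" by simp
  qed (rule simple_function_count_space_finite[OF A])
  have "Bochner_Integration.simple_bochner_integral (count_space A) f
     = (\<Sum>y\<in>(\<lambda>x. x) ` space (count_space A). measure (count_space A) {x\<in>space (count_space A). x = y} *\<^sub>R f y)"
    by (rule simple_bochner_integral_partition[OF b simple_function_count_space_finite[OF A]]) auto
  also have "\<dots> = (\<Sum>y\<in>A. f y)"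
  proof -
    have "measure (count_space A) {x\<in>A. x = y} = 1" if "y \<in> A" for y
    proof -
      have "{x\<in>A. x = y} = {y}" using that by auto
      then show ?thesis using that A by (simp add: measure_def)
    qed
    then show ?thesis by (intro sum.cong) auto
  qed
  finally have "Bochner_Integration.simple_bochner_integral (count_space A) f = (\<Sum>x\<in>A. f x)" .
  then show ?thesis unfolding has_strong_integral_def
    using b strongly_measurable_simple[OF simple_function_count_space_finite[OF A]]
    by (intro conjI exI[of _ "\<lambda>_. f"]) auto
qed

lemma strong_integral_count_space: "finite A \<Longrightarrow> strong_integral (count_space A) f = (\<Sum>x\<in>A. f x)"
  by (rule strong_integral_eq[OF has_strong_integral_count_space])

lemma Lp_space_count_space: "finite A \<Longrightarrow> f \<in> Lp_space (count_space A) p"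
  by (auto simp: Lp_space_def integrable_count_space
      intro: strongly_measurable_simple simple_function_count_space_finite)

lemma Lp_norm_count_space:
  "finite A \<Longrightarrow> Lp_norm (count_space A) p f = (\<Sum>x\<in>A. norm (f x) powr p) powr (1 / p)"
  by (simp add: Lp_norm_def lebesgue_integral_count_space_finite)

lemma normed_scaling_of_real: "normed_scaling sc \<Longrightarrow> sc (of_real r) x = r *\<^sub>R x"
  by (simp add: normed_scaling_def)

text \<open>The sigma-algebra of the \<open>k\<close>-th step is generated by the label map \<open>\<pi> k\<close>.\<close>

lemma UMD_finite:
  fixes sc :: "'k::real_normed_field \<Rightarrow> 'x::banach \<Rightarrow> 'x"
  assumes sc: "normed_scaling sc" and umd: "UMD sc" and p: "1 < p"
  obtains B where "0 \<le> B"
    "\<And>(K::nat) n (\<pi> :: nat \<Rightarrow> nat \<Rightarrow> 'l) d \<epsilon>.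
       \<lbrakk>\<And>k x y. k < n \<Longrightarrow> x < K \<Longrightarrow> y < K \<Longrightarrow> \<pi> (Suc k) x = \<pi> (Suc k) y \<Longrightarrow> \<pi> k x = \<pi> k y;
        \<And>k x y. k < n \<Longrightarrow> x < K \<Longrightarrow> y < K \<Longrightarrow> \<pi> (Suc k) x = \<pi> (Suc k) y \<Longrightarrow> d k x = d k y;
        \<And>k x. k < n \<Longrightarrow> x < K \<Longrightarrow> (\<Sum>y\<in>{y. y < K \<and> \<pi> k y = \<pi> k x}. d k y :: 'x) = 0;
        \<And>k. k < n \<Longrightarrow> \<bar>\<epsilon> k\<bar> = (1::real)\<rbrakk> \<Longrightarrow>
       (\<Sum>x<K. norm (\<Sum>k<n. \<epsilon> k *\<^sub>R d k x) powr p) \<le> B * (\<Sum>x<K. norm (\<Sum>k<n. d k x) powr p)"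
proof -
  from umd p obtain \<beta> where \<beta>: "\<beta> \<ge> 1"
    "\<And>M :: real measure. sigma_finite_measure M \<Longrightarrow> UMD_bound sc p \<beta> M"
    unfolding UMD_def by blast
  show thesis
  proof (rule that[of "\<beta> powr p"])
    fix K n :: nat and \<pi> :: "nat \<Rightarrow> nat \<Rightarrow> 'l" and d :: "nat \<Rightarrow> nat \<Rightarrow> 'x" and \<epsilon> :: "nat \<Rightarrow> real"
    assume nest: "\<And>k x y. k < n \<Longrightarrow> x < K \<Longrightarrow> y < K \<Longrightarrow> \<pi> (Suc k) x = \<pi> (Suc k) y \<Longrightarrow> \<pi> k x = \<pi> k y"
      and adapt: "\<And>k x y. k < n \<Longrightarrow> x < K \<Longrightarrow> y < K \<Longrightarrow> \<pi> (Suc k) x = \<pi> (Suc k) y \<Longrightarrow> d k x = d k y"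
      and mean: "\<And>k x. k < n \<Longrightarrow> x < K \<Longrightarrow> (\<Sum>y\<in>{y. y < K \<and> \<pi> k y = \<pi> k x}. d k y) = 0"
      and eps: "\<And>k. k < n \<Longrightarrow> \<bar>\<epsilon> k\<bar> = 1"
    \<comment> \<open>The points are embedded in the reals because \<open>UMD\<close> ranges over
      measures on real numbers. Counting measure turns all integrals into finite sums.\<close>
    define \<Omega> where "\<Omega> = real ` {..<K}"
    define M where "M = count_space \<Omega>"
    define P where "P k x = \<pi> k (nat \<lfloor>x::real\<rfloor>)" for k x
    define F where "F k = vimage_algebra \<Omega> (P k) (count_space UNIV)" for k
    define f where "f k x = (\<Sum>j<k. d j (nat \<lfloor>x::real\<rfloor>))" for k x
    have fin: "finite \<Omega>" by (simp add: \<Omega>_def)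
    have nest': "P j x = P j y" if "P k x = P k y" "j \<le> k" "k \<le> n" "x \<in> \<Omega>" "y \<in> \<Omega>" for j k x y
      using that(2,1,3-)
    proof (induction rule: inc_induct)
      case (step m)
      then have "P (Suc m) x = P (Suc m) y" by simp
      with step.prems step.hyps nest[of m "nat \<lfloor>x\<rfloor>" "nat \<lfloor>y\<rfloor>"] show ?case
        by (auto simp: P_def \<Omega>_def)
    qed auto
    have setsF: "sets (F k) = {P k -` A \<inter> \<Omega> | A. True}" for k
      unfolding F_def by (subst sets_vimage_algebra2) auto
    have spF: "space (F k) = \<Omega>" for k by (simp add: F_def)
    have sub: "subalgebra M (F k)" for k
      unfolding subalgebra_def setsF spF M_def by auto
    interpret M: finite_measure M
      unfolding M_def by (rule finite_measure_count_space[OF fin])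
    have sfs: "sigma_finite_subalgebra M (F k)" for k
    proof (rule finite_measure_subalgebra_is_sigma_finite)
      show "finite_measure_subalgebra M (F k)"
        by (intro finite_measure_subalgebra.intro finite_measure_subalgebra_axioms.intro sub M.finite_measure_axioms)
    qed
    have filt: "finite_filtration M n F"
      unfolding finite_filtration_def
    proof (intro conjI allI impI)
      fix j k assume jk: "j \<le> k \<and> k \<le> n"
      show "sets (F j) \<subseteq> sets (F k)"
      proof
        fix S assume "S \<in> sets (F j)"
        then obtain A where A: "S = P j -` A \<inter> \<Omega>" unfolding setsF by auto
        have "S = P k -` (P k ` S) \<inter> \<Omega>"
          using nest'[of k _ _ j] jk unfolding A by auto
        then show "S \<in> sets (F k)" unfolding setsF by blast
      qed
    qed (rule sfs)
    have mart: "Lp_martingale M p n F f"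
      unfolding Lp_martingale_def
    proof (intro conjI allI impI ballI)
      fix k assume k: "k \<le> n"
      show "f k \<in> Lp_space M p" unfolding M_def by (rule Lp_space_count_space[OF fin])
      show "strongly_measurable (restr_to_subalg M (F k)) (f k)"
      proof (rule strongly_measurable_simple)
        have sp: "space (restr_to_subalg M (F k)) = \<Omega>" by (simp add: space_restr_to_subalg M_def)
        have fc: "f k x = f k y" if "P k x = P k y" "x \<in> \<Omega>" "y \<in> \<Omega>" for x y
          unfolding f_def
        proof (rule sum.cong[OF refl])
          fix j assume j: "j \<in> {..<k}"
          then have "P (Suc j) x = P (Suc j) y" using nest'[OF that(1), of "Suc j"] that k by auto
          then show "d j (nat \<lfloor>x\<rfloor>) = d j (nat \<lfloor>y\<rfloor>)"
            using adapt[of j "nat \<lfloor>x\<rfloor>" "nat \<lfloor>y\<rfloor>"] that j k by (auto simp: P_def \<Omega>_def)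
        qed
        have "f k -` {f k x} \<inter> \<Omega> \<in> sets (F k)" for x
        proof -
          define S where "S = f k -` {f k x} \<inter> \<Omega>"
          have "S = P k -` (P k ` S) \<inter> \<Omega>"
            using fc unfolding S_def by auto
          then have "S \<in> sets (F k)" unfolding setsF by blast
          then show ?thesis unfolding S_def .
        qed
        then show "simple_function (restr_to_subalg M (F k)) (f k)"
          unfolding simple_function_def sp sets_restr_to_subalg[OF sub] using fin by auto
      qed
    next
      fix k A assume k: "k < n" and A: "A \<in> sets (F k)"
      then obtain L where L: "A = P k -` L \<inter> \<Omega>" unfolding setsF by auto
      \<comment> \<open>A set of \<open>F k\<close> is a union of label classes, so the sum of
        \<open>d k\<close> over it splits into the class sums, which vanish by assumption.\<close>
      define A' where "A' = {y. y < K \<and> \<pi> k y \<in> L}"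
      have finA: "finite A'" unfolding A'_def by simp
      have "(\<Sum>y\<in>A'. d k y) = (\<Sum>l\<in>\<pi> k ` A'. \<Sum>y\<in>{y\<in>A'. \<pi> k y = l}. d k y)"
        by (rule sum.image_gen[OF finA])
      also have "\<dots> = 0"
      proof (rule sum.neutral, safe)
        fix y assume y: "y \<in> A'"
        have "{ya \<in> A'. \<pi> k ya = \<pi> k y} = {z. z < K \<and> \<pi> k z = \<pi> k y}"
          using y by (auto simp: A'_def)
        then show "(\<Sum>ya\<in>{ya \<in> A'. \<pi> k ya = \<pi> k y}. d k ya) = 0"
          using mean[OF k] y by (simp add: A'_def)
      qed
      finally have z: "(\<Sum>y\<in>A'. d k y) = 0" .
      have "(\<Sum>x\<in>\<Omega>. indicator A x *\<^sub>R d k (nat \<lfloor>x\<rfloor>)) = (\<Sum>x<K. indicator A (real x) *\<^sub>R d k x)"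
        unfolding \<Omega>_def by (subst sum.reindex) auto
      also have "\<dots> = (\<Sum>x<K. if x \<in> A' then d k x else 0)"
        by (intro sum.cong) (auto simp: L A'_def P_def \<Omega>_def split: split_indicator)
      also have "\<dots> = (\<Sum>y\<in>A'. d k y)"
        by (subst sum.inter_restrict[symmetric]) (auto intro!: sum.cong simp: A'_def)
      finally have "(\<Sum>x\<in>\<Omega>. indicator A x *\<^sub>R d k (nat \<lfloor>x\<rfloor>)) = 0" using z by simp
      then show "strong_integral M (\<lambda>x. indicator A x *\<^sub>R f (Suc k) x) = strong_integral M (\<lambda>x. indicator A x *\<^sub>R f k x)"
        unfolding M_def strong_integral_count_space[OF fin] f_def
        by (simp add: scaleR_add_right sum.distrib)
    qed
    have S: "(\<Sum>k=1..n. g k) = (\<Sum>k<n. g (Suc k))" for g :: "nat \<Rightarrow> 'x"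
      by (simp add: sum.atLeast1_atMost_eq)
    \<comment> \<open>The martingale \<open>f\<close> starts at 0, so its difference at time k is
      \<open>d (k - 1)\<close>; the signs are shifted accordingly and become scalars of modulus
      1.\<close>
    define \<xi> :: "nat \<Rightarrow> 'k" where "\<xi> k = of_real (\<epsilon> (k - 1))" for k
    have "\<forall>k\<in>{1..n}. norm (\<xi> k) = 1" using eps by (auto simp: \<xi>_def)
    then have ub: "Lp_norm M p (\<lambda>x. \<Sum>k=1..n. sc (\<xi> k) (f k x - f (k - 1) x))
          \<le> \<beta> * Lp_norm M p (\<lambda>x. \<Sum>k=1..n. f k x - f (k - 1) x)"
      using \<beta>(2)[of M] filt mart M.sigma_finite_measure_axioms unfolding UMD_bound_def by blast
    have e1: "(\<Sum>k=1..n. sc (\<xi> k) (f k x - f (k - 1) x)) = (\<Sum>k<n. \<epsilon> k *\<^sub>R d k (nat \<lfloor>x\<rfloor>))" for x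
      unfolding S by (simp add: \<xi>_def normed_scaling_of_real[OF sc] f_def)
    have e2: "(\<Sum>k=1..n. f k x - f (k - 1) x) = (\<Sum>k<n. d k (nat \<lfloor>x\<rfloor>))" for x
      unfolding S by (simp add: f_def)
    have R: "(\<Sum>x\<in>\<Omega>. g (nat \<lfloor>x\<rfloor>)) = (\<Sum>x<K. g x)" for g :: "nat \<Rightarrow> real"
      unfolding \<Omega>_def by (subst sum.reindex) auto
    define a where "a = (\<Sum>x<K. norm (\<Sum>k<n. \<epsilon> k *\<^sub>R d k x) powr p)"
    define b where "b = (\<Sum>x<K. norm (\<Sum>k<n. d k x) powr p)"
    have ab: "a \<ge> 0" "b \<ge> 0" unfolding a_def b_def by (auto intro: sum_nonneg)
    have "a powr (1 / p) \<le> \<beta> * b powr (1 / p)"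
      using ub unfolding M_def Lp_norm_count_space[OF fin] e1 e2 a_def b_def
      by (simp add: R[of "\<lambda>x. norm (\<Sum>k<n. \<epsilon> k *\<^sub>R d k x) powr p"] R[of "\<lambda>x. norm (\<Sum>k<n. d k x) powr p"])
    then have "(a powr (1 / p)) powr p \<le> (\<beta> * b powr (1 / p)) powr p"
      using p by (intro powr_mono2) auto
    then show "(\<Sum>x<K. norm (\<Sum>k<n. \<epsilon> k *\<^sub>R d k x) powr p) \<le> \<beta> powr p * (\<Sum>x<K. norm (\<Sum>k<n. d k x) powr p)"
      using p ab \<beta>(1) unfolding a_def[symmetric] b_def[symmetric] by (simp add: powr_mult powr_powr)
  qed simp
qed

section \<open>A dyadic shift\<close>

lemma sum_lessThan_4: "(\<Sum>j<4. F j) = F 0 + F 1 + F 2 + F (3::nat)"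
  by (simp add: eval_nat_numeral)

lemma sum_div_blocks:
  fixes \<phi> :: "nat \<Rightarrow> 'x::real_vector"
  assumes q: "0 < q"
  shows "(\<Sum>y | y < N * q \<and> R (y div q). \<phi> (y div q)) = real q *\<^sub>R (\<Sum>c | c < N \<and> R c. \<phi> c)"
proof -
  have "(\<Sum>y | y < N * q \<and> R (y div q). \<phi> (y div q)) = (\<Sum>(c, s)\<in>{c. c < N \<and> R c} \<times> {..<q}. \<phi> c)"
  proof (rule sum.reindex_bij_witness[where i="\<lambda>(c, s). c * q + s" and j="\<lambda>y. (y div q, y mod q)"])
    fix cs assume "cs \<in> {c. c < N \<and> R c} \<times> {..<q}"
    then obtain c s where cs: "cs = (c, s)" "c < N" "R c" "s < q" by auto
    have "c * q + s < Suc c * q" using cs by simp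
    also have "\<dots> \<le> N * q" using cs by (intro mult_right_mono) auto
    finally show "(case cs of (c, s) \<Rightarrow> c * q + s) \<in> {y. y < N * q \<and> R (y div q)}" using cs by simp
  qed (use q in \<open>auto simp: less_mult_imp_div_less\<close>)
  also have "\<dots> = real q *\<^sub>R (\<Sum>c | c < N \<and> R c. \<phi> c)"
    by (subst sum.cartesian_product[symmetric]) (simp add: scaleR_sum_right sum_constant_scaleR)
  finally show ?thesis .
qed

lemma sum_block_mod:
  fixes G :: "nat \<Rightarrow> 'x::real_vector"
  assumes q: "0 < q"
  shows "(\<Sum>x<N * q. G (x mod q)) = real N *\<^sub>R (\<Sum>s<q. G s)"
proof -
  have "(\<Sum>x<N * q. G (x mod q)) = (\<Sum>m<N. sum (\<lambda>x. G (x mod q)) {m * q..<m * q + q})"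
    by (rule sum.nat_group[symmetric])
  also have "\<dots> = (\<Sum>m<N. \<Sum>s<q. G s)"
  proof (rule sum.cong[OF refl])
    fix m assume "m \<in> {..<N}"
    have "sum (\<lambda>x. G (x mod q)) {m * q..<m * q + q} = sum (\<lambda>x. G ((x + m * q) mod q)) {0..<q}"
      using sum.shift_bounds_nat_ivl[of "\<lambda>x. G (x mod q)" 0 "m * q" q] by (simp add: add.commute)
    also have "\<dots> = (\<Sum>s<q. G s)" by (rule sum.cong) auto
    finally show "sum (\<lambda>x. G (x mod q)) {m * q..<m * q + q} = (\<Sum>s<q. G s)" .
  qed
  also have "\<dots> = real N *\<^sub>R (\<Sum>s<q. G s)" by (simp add: sum_constant_scaleR)
  finally show ?thesis .
qed

lemma div_mod_4: "(x::nat) div 4 ^ i = 4 * (x div 4 ^ Suc i) + (x div 4 ^ i) mod 4"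
proof -
  have "x div 4 ^ Suc i = x div 4 ^ i div 4" by (simp only: power_Suc2 div_mult2_eq)
  then show ?thesis by (simp only:) simp
qed

text \<open>The two martingale differences \<open>u i\<close> and \<open>w i\<close> of a level are revealed one after the other:
  first the value of \<open>l\<close> at the base-4 digit, then the digit itself.\<close>

lemma UMD_base4:
  fixes sc :: "'k::real_normed_field \<Rightarrow> 'x::banach \<Rightarrow> 'x"
  assumes sc: "normed_scaling sc" and umd: "UMD sc" and p: "1 < p"
  obtains B where "0 \<le> B"
    "\<And>m (l :: nat \<Rightarrow> nat) u w.
       \<lbrakk>\<And>i b j j'. i < m \<Longrightarrow> j < 4 \<Longrightarrow> j' < 4 \<Longrightarrow> l j = l j' \<Longrightarrow> u i (4 * b + j) = u i (4 * b + j');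
        \<And>i b. i < m \<Longrightarrow> (\<Sum>j<4. u i (4 * b + j) :: 'x) = 0;
        \<And>i b a. i < m \<Longrightarrow> (\<Sum>j<4. if l j = a then w i (4 * b + j) else 0) = 0\<rbrakk> \<Longrightarrow>
       (\<Sum>x<4^m. norm (\<Sum>i<m. u i (x div 4^i) - w i (x div 4^i)) powr p)
         \<le> B * (\<Sum>x<4^m. norm (\<Sum>i<m. u i (x div 4^i) + w i (x div 4^i)) powr p)"
proof -
  obtain B where B: "0 \<le> B" and UB: "\<And>(K::nat) n (\<pi> :: nat \<Rightarrow> nat \<Rightarrow> nat \<times> nat) d \<epsilon>.
       \<lbrakk>\<And>k x y. k < n \<Longrightarrow> x < K \<Longrightarrow> y < K \<Longrightarrow> \<pi> (Suc k) x = \<pi> (Suc k) y \<Longrightarrow> \<pi> k x = \<pi> k y;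
        \<And>k x y. k < n \<Longrightarrow> x < K \<Longrightarrow> y < K \<Longrightarrow> \<pi> (Suc k) x = \<pi> (Suc k) y \<Longrightarrow> d k x = d k y;
        \<And>k x. k < n \<Longrightarrow> x < K \<Longrightarrow> (\<Sum>y\<in>{y. y < K \<and> \<pi> k y = \<pi> k x}. d k y :: 'x) = 0;
        \<And>k. k < n \<Longrightarrow> \<bar>\<epsilon> k\<bar> = (1::real)\<rbrakk> \<Longrightarrow>
       (\<Sum>x<K. norm (\<Sum>k<n. \<epsilon> k *\<^sub>R d k x) powr p) \<le> B * (\<Sum>x<K. norm (\<Sum>k<n. d k x) powr p)"
    using UMD_finite[OF assms, where 'l = "nat \<times> nat"] by blast
  show thesis
  proof (rule that[OF B])
    fix m and l :: "nat \<Rightarrow> nat" and u w :: "nat \<Rightarrow> nat \<Rightarrow> 'x"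
    assume u1: "\<And>i b j j'. i < m \<Longrightarrow> j < 4 \<Longrightarrow> j' < 4 \<Longrightarrow> l j = l j' \<Longrightarrow> u i (4 * b + j) = u i (4 * b + j')"
      and u2: "\<And>i b. i < m \<Longrightarrow> (\<Sum>j<4. u i (4 * b + j)) = 0"
      and w: "\<And>i b a. i < m \<Longrightarrow> (\<Sum>j<4. if l j = a then w i (4 * b + j) else 0) = 0"
    \<comment> \<open>Time 2 * s knows the s leading base-4 digits; time 2 * s + 1 also knows the
      label of the next one. Time runs from coarse to fine, whereas the level i = m - 1 - s counts
      from the finest digit.\<close>
    define \<pi> where "\<pi> k x = (x div 4 ^ (m - k div 2), if even k then 0 else l ((x div 4 ^ (m - 1 - k div 2)) mod 4))" for k x :: nat
    define d where "d k x = (if even k then u (m - 1 - k div 2) (x div 4 ^ (m - 1 - k div 2))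
        else w (m - 1 - k div 2) (x div 4 ^ (m - 1 - k div 2)))" for k x :: nat
    define \<epsilon> where "\<epsilon> k = (if even k then 1 else -1 :: real)" for k :: nat
    have lev: "\<exists>i s. i < m \<and> s < m \<and> m - s = Suc i \<and> m - Suc s = i \<and> (k = 2 * s \<or> k = Suc (2 * s))"
      if "k < 2 * m" for k :: nat
      by (rule exI[of _ "m - 1 - k div 2"], rule exI[of _ "k div 2"]) (use that in presburger)
    \<comment> \<open>A label class fixes the block \<open>b\<close> and a condition
      \<open>R\<close> on the next digit. Each value of \<open>\<phi>\<close> occurs
      \<open>4^i\<close> times in it, so only the sum over four digits matters.\<close>
    have zero: "(\<Sum>y | y < 4^m \<and> Q (y div 4^i). \<phi> (y div 4^i)) = 0"
      if "i < m" "b < 4^(m - Suc i)" "Q = (\<lambda>c. c div 4 = b \<and> R (c mod 4))" 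
         "(\<Sum>j<4. if R j then \<phi> (4 * b + j) else 0) = 0"
      for i b Q R and \<phi> :: "nat \<Rightarrow> 'x"
    proof -
      have e: "(4::nat)^m = 4^(m - i) * 4^i" using that(1) by (simp flip: power_add)
      have e2: "(4::nat)^(m - i) = 4 * 4^(m - Suc i)" using that(1)
        by (metis Suc_diff_Suc power_Suc)
      have "(\<Sum>c | c < 4^(m - i) \<and> Q c. \<phi> c) = (\<Sum>j | j < 4 \<and> R j. \<phi> (4 * b + j))"
        by (rule sum.reindex_bij_witness[where i="\<lambda>j. 4 * b + j" and j="\<lambda>c. c mod 4"])
           (use that(2) e2 in \<open>auto simp: that(3)\<close>)
      also have "\<dots> = (\<Sum>j\<in>{..<4} \<inter> {j. R j}. \<phi> (4 * b + j))"
        by (rule sum.cong) auto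
      also have "\<dots> = 0" using that(4) by (simp add: sum.inter_restrict)
      finally show ?thesis unfolding e by (subst sum_div_blocks) auto
    qed
    have d4: "y div 4 ^ Suc i = y div 4 ^ i div 4" for y i :: nat by (simp only: power_Suc2 div_mult2_eq)
    have bl: "x div 4^Suc i < 4^(m - Suc i)" if "x < 4^m" "i < m" for x i :: nat
    proof (rule less_mult_imp_div_less)
      have "(4::nat)^(m - Suc i) * 4^Suc i = 4^m" using that(2)
        by (metis Suc_leI le_add_diff_inverse2 power_add)
      then show "x < 4^(m - Suc i) * 4^Suc i" using that by simp
    qed
    have "(\<Sum>x<4^m. norm (\<Sum>k<2*m. \<epsilon> k *\<^sub>R d k x) powr p) \<le> B * (\<Sum>x<4^m. norm (\<Sum>k<2*m. d k x) powr p)"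
    proof (rule UB[where \<pi>=\<pi>])
      fix k x y assume k: "k < 2 * m" and xy: "x < 4^m" "y < 4^m" "\<pi> (Suc k) x = \<pi> (Suc k) y"
      obtain i s where ix: "i < m" "s < m" "m - s = Suc i" "m - Suc s = i" "k = 2 * s \<or> k = Suc (2 * s)"
        using lev[OF k] by blast
      have i': "m - Suc 0 - s = i" using ix by simp
      show "\<pi> k x = \<pi> k y"
        using ix(5) xy(3) by (auto simp: \<pi>_def ix(3,4) i' d4 simp del: power_Suc)
      show "d k x = d k y"
        using ix(5)
      proof
        assume ks: "k = 2 * s"
        then have "x div 4^Suc i = y div 4^Suc i" "l (x div 4^i mod 4) = l (y div 4^i mod 4)"
          using xy(3) by (auto simp: \<pi>_def ix(3,4) i')
        then have "u i (4 * (x div 4^Suc i) + x div 4^i mod 4) = u i (4 * (y div 4^Suc i) + y div 4^i mod 4)"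
          by (simp only:) (rule u1[OF ix(1)], simp_all)
        then have "u i (x div 4^i) = u i (y div 4^i)"
          by (simp only: div_mod_4[symmetric])
        then show ?thesis using ks by (simp add: d_def ix(4) i')
      next
        assume ks: "k = Suc (2 * s)"
        then show ?thesis using xy(3) by (simp add: \<pi>_def d_def ix(3,4) i')
      qed
    next
      fix k x assume k: "k < 2 * m" and x: "x < (4::nat)^m"
      obtain i s where ix: "i < m" "s < m" "m - s = Suc i" "m - Suc s = i" "k = 2 * s \<or> k = Suc (2 * s)"
        using lev[OF k] by blast
      have i': "m - Suc 0 - s = i" using ix by simp
      show "(\<Sum>y\<in>{y. y < 4^m \<and> \<pi> k y = \<pi> k x}. d k y) = 0"
        using ix(5)
      proof
        assume ks: "k = 2 * s"
        have "(\<Sum>y | y < 4^m \<and> (y div 4^i) div 4 = x div 4^Suc i \<and> True. u i (y div 4^i)) = 0"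
          by (rule zero[OF ix(1) bl[OF x ix(1)], where R="\<lambda>_. True"]) (use u2[OF ix(1)] in auto)
        then show ?thesis using ks
          by (simp add: \<pi>_def d_def ix(3,4) i' d4 del: power_Suc)
      next
        assume ks: "k = Suc (2 * s)"
        have "(\<Sum>y | y < 4^m \<and> (y div 4^i) div 4 = x div 4^Suc i \<and> l ((y div 4^i) mod 4) = l ((x div 4^i) mod 4). w i (y div 4^i)) = 0"
          by (rule zero[OF ix(1) bl[OF x ix(1)], where R="\<lambda>j. l j = l ((x div 4^i) mod 4)"]) (use w[OF ix(1)] in auto)
        then show ?thesis using ks
          by (simp add: \<pi>_def d_def ix(3,4) i' d4 del: power_Suc)
      qed
    qed (auto simp: \<epsilon>_def)
    moreover have S: "(\<Sum>k<2*m. g k) = (\<Sum>i<m. g (2 * (m - 1 - i)) + g (Suc (2 * (m - 1 - i))))" for g :: "nat \<Rightarrow> 'x"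
    proof -
      have "(\<Sum>k<2*m. g k) = (\<Sum>s<m. g (2 * s) + g (Suc (2 * s)))"
        by (induction m) auto
      also have "\<dots> = (\<Sum>i<m. g (2 * (m - Suc i)) + g (Suc (2 * (m - Suc i))))"
        by (rule sum.nat_diff_reindex[symmetric])
      finally show ?thesis by simp
    qed
    moreover have "(\<Sum>k<2*m. \<epsilon> k *\<^sub>R d k x) = (\<Sum>i<m. u i (x div 4^i) - w i (x div 4^i))" for x
      unfolding S by (intro sum.cong) (auto simp: \<epsilon>_def d_def)
    moreover have "(\<Sum>k<2*m. d k x) = (\<Sum>i<m. u i (x div 4^i) + w i (x div 4^i))" for x
      unfolding S by (intro sum.cong) (auto simp: d_def)
    ultimately show "(\<Sum>x<4^m. norm (\<Sum>i<m. u i (x div 4^i) - w i (x div 4^i)) powr p)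
         \<le> B * (\<Sum>x<4^m. norm (\<Sum>i<m. u i (x div 4^i) + w i (x div 4^i)) powr p)"
      by simp
  qed
qed

section \<open>The Haar shift on 4-adic blocks and its bound from the UMD property\<close>

fun block_avg :: "(nat \<Rightarrow> 'x::real_vector) \<Rightarrow> nat \<Rightarrow> nat \<Rightarrow> 'x" where
  "block_avg f 0 b = f b"
| "block_avg f (Suc i) b = (1/4) *\<^sub>R (\<Sum>j<4. block_avg f i (4 * b + j))"

definition haar_h :: "nat \<Rightarrow> real" where "haar_h j = (if j < 2 then 1 else -1)"

definition haar_g :: "nat \<Rightarrow> real" where "haar_g j = (if j = 0 \<or> j = 3 then 1 else -1)"

text \<open>The factor 1/4 is the reciprocal of the sum of squares of \<open>haar_h\<close>, so
  \<open>haar_h\<close> times this coefficient is the orthogonal projection of the four block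
  averages onto \<open>haar_h\<close>.\<close>

definition haar_coeff :: "(nat \<Rightarrow> 'x::real_vector) \<Rightarrow> nat \<Rightarrow> nat \<Rightarrow> 'x" where
  "haar_coeff f i b = (1/4) *\<^sub>R (\<Sum>j<4. haar_h j *\<^sub>R block_avg f i (4 * b + j))"

definition dyadic_shift :: "nat \<Rightarrow> (nat \<Rightarrow> 'x::real_vector) \<Rightarrow> nat \<Rightarrow> 'x" where
  "dyadic_shift m f x = (\<Sum>i<m. haar_g ((x div 4 ^ i) mod 4) *\<^sub>R haar_coeff f i (x div 4 ^ Suc i))"

lemma block_avg_eq:
  "block_avg f i b = (1 / 4 ^ i) *\<^sub>R (\<Sum>s<4 ^ i. f (4 ^ i * b + s))"
proof (induction i arbitrary: b)
  case (Suc i)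
  have "(\<Sum>s<4 ^ Suc i. f (4 ^ Suc i * b + s)) = (\<Sum>s<4 * 4 ^ i. f (4 ^ Suc i * b + s))" by simp
  also have "\<dots> = (\<Sum>j<4. sum (\<lambda>s. f (4 ^ Suc i * b + s)) {j * 4 ^ i..<j * 4 ^ i + 4 ^ i})"
    by (rule sum.nat_group[symmetric])
  also have "\<dots> = (\<Sum>j<4. \<Sum>s<4 ^ i. f (4 ^ i * (4 * b + j) + s))"
  proof (rule sum.cong[OF refl])
    fix j :: nat
    show "sum (\<lambda>s. f (4 ^ Suc i * b + s)) {j * 4 ^ i..<j * 4 ^ i + 4 ^ i} = (\<Sum>s<4 ^ i. f (4 ^ i * (4 * b + j) + s))"
      using sum.shift_bounds_nat_ivl[of "\<lambda>s. f (4 ^ Suc i * b + s)" 0 "j * 4 ^ i" "4 ^ i"]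
      by (simp add: algebra_simps atLeast0LessThan)
  qed
  finally show ?case by (simp add: Suc.IH scaleR_sum_right)
qed simp

lemma haar_coeff_eq:
  "haar_coeff f i b = (1 / 4 ^ Suc i) *\<^sub>R (\<Sum>s<4 ^ Suc i. haar_h (s div 4 ^ i) *\<^sub>R f (4 ^ Suc i * b + s))"
proof -
  have "(\<Sum>s<4 ^ Suc i. haar_h (s div 4 ^ i) *\<^sub>R f (4 ^ Suc i * b + s))
      = (\<Sum>s<4 * 4 ^ i. haar_h (s div 4 ^ i) *\<^sub>R f (4 ^ Suc i * b + s))" by simp
  also have "\<dots> = (\<Sum>j<4. sum (\<lambda>s. haar_h (s div 4 ^ i) *\<^sub>R f (4 ^ Suc i * b + s)) {j * 4 ^ i..<j * 4 ^ i + 4 ^ i})"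
    by (rule sum.nat_group[symmetric])
  also have "\<dots> = (\<Sum>j<4. haar_h j *\<^sub>R (\<Sum>s<4 ^ i. f (4 ^ i * (4 * b + j) + s)))"
  proof (rule sum.cong[OF refl])
    fix j :: nat
    have "sum (\<lambda>s. haar_h (s div 4 ^ i) *\<^sub>R f (4 ^ Suc i * b + s)) {j * 4 ^ i..<j * 4 ^ i + 4 ^ i}
       = (\<Sum>s<4 ^ i. haar_h ((s + j * 4 ^ i) div 4 ^ i) *\<^sub>R f (4 ^ Suc i * b + (s + j * 4 ^ i)))"
      using sum.shift_bounds_nat_ivl[of "\<lambda>s. haar_h (s div 4 ^ i) *\<^sub>R f (4 ^ Suc i * b + s)" 0 "j * 4 ^ i" "4 ^ i"]
      by (simp add: algebra_simps atLeast0LessThan)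
    also have "\<dots> = haar_h j *\<^sub>R (\<Sum>s<4 ^ i. f (4 ^ i * (4 * b + j) + s))"
      unfolding scaleR_sum_right by (intro sum.cong) (auto simp: algebra_simps)
    finally show "sum (\<lambda>s. haar_h (s div 4 ^ i) *\<^sub>R f (4 ^ Suc i * b + s)) {j * 4 ^ i..<j * 4 ^ i + 4 ^ i}
       = haar_h j *\<^sub>R (\<Sum>s<4 ^ i. f (4 ^ i * (4 * b + j) + s))" .
  qed
  finally show ?thesis by (simp add: haar_coeff_def block_avg_eq scaleR_sum_right mult.commute)
qed

lemma norm_block_avg_powr_le:
  fixes f :: "nat \<Rightarrow> 'x::real_normed_vector"
  assumes p: "1 \<le> p"
  shows "4 ^ m * norm (block_avg f m 0) powr p \<le> (\<Sum>x<4 ^ m. norm (f x) powr p)"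
proof -
  have "norm (block_avg f m 0) powr p = norm (\<Sum>s<4 ^ m. (1 / 4 ^ m) *\<^sub>R f s) powr p"
    by (simp add: block_avg_eq scaleR_sum_right)
  also have "\<dots> \<le> (\<Sum>s<(4::nat) ^ m. 1 / 4 ^ m) powr (p - 1) * (\<Sum>s<4 ^ m. (1 / 4 ^ m) * norm (f s) powr p)"
    by (rule norm_weighted_sum_powr_le) (use p in auto)
  also have "\<dots> = (1 / 4 ^ m) * (\<Sum>s<4 ^ m. norm (f s) powr p)"
    by (simp add: sum_distrib_left sum_divide_distrib)
  finally show ?thesis by (simp add: field_simps)
qed

text \<open>Two martingale transforms are used. The first changes the sign of everything but the
  \<open>haar_h\<close> component; half the sum of the original and its transform is the projection
  onto that component. The second splits (1, 1, -1, -1) into (1, 0, -1, 0) and (0, 1, 0, -1), and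
  changing the sign of the second part produces (1, -1, -1, 1), which is
  \<open>haar_g\<close>.\<close>

lemma dyadic_shift_bounded:
  fixes sc :: "'k::real_normed_field \<Rightarrow> 'x::banach \<Rightarrow> 'x"
  assumes sc: "normed_scaling sc" and umd: "UMD sc" and p: "1 < p"
  obtains C where "0 \<le> C"
    "\<And>m (f :: nat \<Rightarrow> 'x). (\<Sum>x<4^m. norm (dyadic_shift m f x) powr p) \<le> C * (\<Sum>x<4^m. norm (f x) powr p)"
proof -
  obtain B where B: "0 \<le> B" and UB: "\<And>m (l :: nat \<Rightarrow> nat) u w.
       \<lbrakk>\<And>i b j j'. i < m \<Longrightarrow> j < 4 \<Longrightarrow> j' < 4 \<Longrightarrow> l j = l j' \<Longrightarrow> u i (4 * b + j) = u i (4 * b + j');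
        \<And>i b. i < m \<Longrightarrow> (\<Sum>j<4. u i (4 * b + j) :: 'x) = 0;
        \<And>i b a. i < m \<Longrightarrow> (\<Sum>j<4. if l j = a then w i (4 * b + j) else 0) = 0\<rbrakk> \<Longrightarrow>
       (\<Sum>x<4^m. norm (\<Sum>i<m. u i (x div 4^i) - w i (x div 4^i)) powr p)
         \<le> B * (\<Sum>x<4^m. norm (\<Sum>i<m. u i (x div 4^i) + w i (x div 4^i)) powr p)"
    using UMD_base4[OF assms] by blast
  have l4: "j = 0 \<or> j = 1 \<or> j = 2 \<or> j = 3" if "j < 4" for j :: nat using that by auto
  \<comment> \<open>Cost of the projection: \<open>2 powr (p - 1) * 2\<close> for subtracting the
    mean, and \<open>(1 / 2) powr p * 2 powr (p - 1) * (B + 1)\<close> for halving the sum of a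
    function and its transform.\<close>
  define D where "D = (2 powr (p - 1))\<^sup>2 * 2 * (1 / 2) powr p * (B + 1)"
  have D: "0 \<le> D" unfolding D_def using B by simp
  show thesis
  proof (rule that[of "B * D"])
    fix m and f :: "nat \<Rightarrow> 'x"
    define c where "c = haar_coeff f"
    define A where "A = block_avg f"
    define u where "u i k = haar_h (k mod 4) *\<^sub>R c i (k div 4)" for i k
    define w where "w i k = A i k - A (Suc i) (k div 4) - u i k" for i k
    define u' where "u' i k = (if k mod 4 = 0 then 1 else if k mod 4 = 2 then -1 else 0) *\<^sub>R c i (k div 4)" for i k
    define w' where "w' i k = (if k mod 4 = 1 then 1 else if k mod 4 = 3 then -1 else 0) *\<^sub>R c i (k div 4)" for i k
    define F where "F = (\<Sum>x<4^m. norm (f x) powr p)"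
    have c: "c i b = (1/4) *\<^sub>R (A i (4*b) + A i (4*b+1) - A i (4*b+2) - A i (4*b+3))" for i b
      by (simp add: c_def haar_coeff_def sum_lessThan_4 haar_h_def A_def)
    have A: "A (Suc i) b = (1/4) *\<^sub>R (A i (4*b) + A i (4*b+1) + A i (4*b+2) + A i (4*b+3))" for i b
      by (simp add: A_def sum_lessThan_4)
    have quarter: "a = (1/4::real) *\<^sub>R a + (1/4) *\<^sub>R a + (1/4) *\<^sub>R a + (1/4) *\<^sub>R a" for a :: 'x
      by (simp flip: scaleR_add_left)
    have zz: "(4 * b + 3) div 4 = b" "(4 * b + 2) div 4 = b" "(4 * b + 1) div 4 = b" "(4*b) div 4 = b"
      "(4 * b + 3) mod 4 = 3" "(4 * b + 2) mod 4 = 2" "(4 * b + 1) mod 4 = 1" "(4*b) mod 4 = 0"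
      "Suc (4 * b) div 4 = b" "Suc (Suc (4 * b)) div 4 = b" "Suc (4 * b) mod 4 = 1" "Suc (Suc (4 * b)) mod 4 = 2" for b :: nat
      by presburger+
    have first: "(\<Sum>x<4^m. norm (\<Sum>i<m. u i (x div 4^i) - w i (x div 4^i)) powr p)
         \<le> B * (\<Sum>x<4^m. norm (\<Sum>i<m. u i (x div 4^i) + w i (x div 4^i)) powr p)"
    \<comment> \<open>The label tells the left half from the right half of a block.
      \<open>haar_h\<close> is constant on halves, and \<open>w\<close> sums to 0 over each half
      because \<open>A (Suc i)\<close> plus or minus \<open>c i\<close> are the averages over the
      two halves.\<close>
    proof (rule UB[where l="\<lambda>j. j div 2"])
      show "u i (4 * b + j) = u i (4 * b + j')" if "i < m" "j < 4" "j' < 4" "j div 2 = j' div 2" for i b j j'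
        using l4[OF that(2)] l4[OF that(3)] that(4) by (auto simp: u_def haar_h_def zz)
      show "(\<Sum>j<4. u i (4 * b + j)) = 0" if "i < m" for i b
        unfolding sum_lessThan_4 by (simp add: u_def haar_h_def zz)
      show "(\<Sum>j<4. if j div 2 = a then w i (4 * b + j) else 0) = 0" if "i < m" for i b a
      proof -
        have "w i (4*b) + w i (4*b+1) = 0" "w i (4*b+2) + w i (4*b+3) = 0"
          unfolding w_def u_def zz A c haar_h_def
          by (subst (1 2) quarter[of "A i _"]; simp add: scaleR_add_right scaleR_diff_right; fail)+ 
        then show ?thesis unfolding sum_lessThan_4 by (cases "a = 0"; cases "a = 1") auto
      qed
    qed
    have second: "(\<Sum>x<4^m. norm (\<Sum>i<m. u' i (x div 4^i) - w' i (x div 4^i)) powr p)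
         \<le> B * (\<Sum>x<4^m. norm (\<Sum>i<m. u' i (x div 4^i) + w' i (x div 4^i)) powr p)"
    \<comment> \<open>The classes are now {0}, {2} and {1, 3}: \<open>u'\<close> vanishes on the
      last one, while \<open>w'\<close> lives there with opposite values.\<close>
    proof (rule UB[where l="\<lambda>j. if j = 3 then 1 else j"])
      show "u' i (4 * b + j) = u' i (4 * b + j')" if "i < m" "j < 4" "j' < 4" 
         "(if j = 3 then 1 else j) = (if j' = 3 then 1 else j')" for i b j j'
      proof -
        have "u' i (4*b+1) = u' i (4*b+3)" unfolding u'_def zz by simp
        then show ?thesis using that(4) by (cases "j = 3"; cases "j' = 3"; simp split: if_splits)
      qed
      show "(\<Sum>j<4. u' i (4 * b + j)) = 0" if "i < m" for i b
        unfolding sum_lessThan_4 by (simp add: u'_def zz)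
      show "(\<Sum>j<4. if (if j = 3 then 1 else j) = a then w' i (4 * b + j) else 0) = 0" if "i < m" for i b a
      proof -
        have "w' i (4*b) = 0" "w' i (4*b+1) + w' i (4*b+3) = 0" "w' i (4*b+2) = 0"
          unfolding w'_def zz by simp_all
        then show ?thesis unfolding sum_lessThan_4 by (cases "a = 1") auto
      qed
    qed
    have d4: "x div 4 ^ Suc i = x div 4 ^ i div 4" for x i :: nat by (simp only: power_Suc2 div_mult2_eq)
    have S1: "(\<Sum>i<m. u i (x div 4^i) + w i (x div 4^i)) = f x - A m 0" if "x < 4^m" for x
    proof -
      have "(\<Sum>i<m. u i (x div 4^i) + w i (x div 4^i)) = (\<Sum>i<m. A i (x div 4^i) - A (Suc i) (x div 4^Suc i))"
        unfolding w_def d4 by simp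
      also have "\<dots> = A 0 (x div 4^0) - A m (x div 4^m)"
        by (rule sum_lessThan_telescope')
      finally show ?thesis using that by (simp add: A_def)
    qed
    have S2: "u' i (x div 4^i) + w' i (x div 4^i) = u i (x div 4^i)" for i x
      using l4[of "x div 4^i mod 4"] by (auto simp: u'_def w'_def u_def haar_h_def)
    have S3: "(\<Sum>i<m. u' i (x div 4^i) - w' i (x div 4^i)) = dyadic_shift m f x" for x
      unfolding dyadic_shift_def
    proof (intro sum.cong refl)
      fix i
      show "u' i (x div 4^i) - w' i (x div 4^i) = haar_g (x div 4 ^ i mod 4) *\<^sub>R haar_coeff f i (x div 4 ^ Suc i)"
        using l4[of "x div 4^i mod 4"] unfolding d4 by (auto simp: u'_def w'_def haar_g_def c_def)
    qed
    have F1: "(\<Sum>x<4^m. norm (f x - A m 0) powr p) \<le> 2 powr (p - 1) * 2 * F"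
    proof -
      have "(\<Sum>x<4^m. norm (f x - A m 0) powr p) \<le> (\<Sum>x<4^m. 2 powr (p - 1) * (norm (f x) powr p + norm (A m 0) powr p))"
        using p by (intro sum_mono norm_diff_powr_le) simp
      also have "\<dots> = 2 powr (p - 1) * (F + 4 ^ m * norm (A m 0) powr p)"
        by (simp add: F_def sum.distrib flip: sum_distrib_left)
      also have "\<dots> \<le> 2 powr (p - 1) * (F + F)"
        using norm_block_avg_powr_le[of p m f] p unfolding A_def F_def by (intro mult_left_mono add_mono) auto
      finally show ?thesis by simp
    qed
    have "(\<Sum>x<4^m. norm (\<Sum>i<m. u i (x div 4^i)) powr p)
      \<le> (\<Sum>x<4^m. (1/2) powr p * (2 powr (p - 1) * (norm (\<Sum>i<m. u i (x div 4^i) + w i (x div 4^i)) powr p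
            + norm (\<Sum>i<m. u i (x div 4^i) - w i (x div 4^i)) powr p)))"
    proof (rule sum_mono)
      fix x
      define P where "P = (\<Sum>i<m. u i (x div 4^i) + w i (x div 4^i))"
      define Q where "Q = (\<Sum>i<m. u i (x div 4^i) - w i (x div 4^i))"
      have "(\<Sum>i<m. u i (x div 4^i)) = (1/2::real) *\<^sub>R (P + Q)"
        unfolding P_def Q_def by (simp add: sum.distrib sum_subtractf flip: scaleR_2)
      then have "norm (\<Sum>i<m. u i (x div 4^i)) powr p = (1/2) powr p * norm (P + Q) powr p"
        by (simp add: powr_mult[symmetric])
      also have "\<dots> \<le> (1/2) powr p * (2 powr (p - 1) * (norm P powr p + norm Q powr p))"
        using p by (intro mult_left_mono norm_add_powr_le) auto
      finally show "norm (\<Sum>i<m. u i (x div 4^i)) powr p \<le> (1/2) powr p * (2 powr (p - 1) * (norm P powr p + norm Q powr p))" .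
    qed
    also have "\<dots> = (1/2) powr p * (2 powr (p - 1) * ((\<Sum>x<4^m. norm (\<Sum>i<m. u i (x div 4^i) + w i (x div 4^i)) powr p)
            + (\<Sum>x<4^m. norm (\<Sum>i<m. u i (x div 4^i) - w i (x div 4^i)) powr p)))"
      by (simp add: sum.distrib flip: sum_distrib_left)
    also have "\<dots> \<le> (1/2) powr p * (2 powr (p - 1) * ((\<Sum>x<4^m. norm (\<Sum>i<m. u i (x div 4^i) + w i (x div 4^i)) powr p)
            + B * (\<Sum>x<4^m. norm (\<Sum>i<m. u i (x div 4^i) + w i (x div 4^i)) powr p)))"
      using first by (intro mult_left_mono add_left_mono) auto
    also have "\<dots> = (1/2) powr p * 2 powr (p - 1) * (B + 1) * (\<Sum>x<4^m. norm (f x - A m 0) powr p)"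
      by (simp add: S1 algebra_simps)
    also have "\<dots> \<le> (1/2) powr p * 2 powr (p - 1) * (B + 1) * (2 powr (p - 1) * 2 * F)"
      using B by (intro mult_left_mono F1) auto
    also have "\<dots> = D * F" by (simp add: D_def power2_eq_square)
    finally have uF: "(\<Sum>x<4^m. norm (\<Sum>i<m. u i (x div 4^i)) powr p) \<le> D * F" .
    have "(\<Sum>x<4^m. norm (dyadic_shift m f x) powr p) \<le> B * (\<Sum>x<4^m. norm (\<Sum>i<m. u i (x div 4^i)) powr p)"
      using second unfolding S2 S3 .
    also have "\<dots> \<le> B * (D * F)" using B uF by (intro mult_left_mono)
    finally show "(\<Sum>x<4^m. norm (dyadic_shift m f x) powr p) \<le> B * D * (\<Sum>x<4^m. norm (f x) powr p)"
      by (simp add: F_def)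
  qed (use B D in simp)
qed

section \<open>Averaging the dyadic shift over translations\<close>

text \<open>Multiplication by \<open>r\<close> followed by a translation permutes the residues
  modulo \<open>M\<close>. Translation averages use \<open>r = 1\<close>, dilations an odd
  \<open>r\<close> with \<open>M = 4 ^ m\<close>.\<close>

lemma sum_periodic_affine:
  fixes G :: "int \<Rightarrow> 'b::comm_monoid_add"
  assumes per: "\<And>z. G (z + int M) = G z" and r: "coprime r (int M)"
  shows "(\<Sum>z<M. G (r * int z + t)) = (\<Sum>z<M. G (int z))"
proof (cases "M = 0")
  case False
  then have M: "int M > 0" by simp
  have per': "G (z + int M * n) = G z" for z n
  proof -
    have pos: "G (z + int M * int n) = G z" for z n
    proof (induction n)
      case (Suc n)
      then show ?case using per[of "z + int M * int n"] by (simp add: algebra_simps)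
    qed simp
    show ?thesis
    proof (cases "n \<ge> 0")
      case True then show ?thesis using pos[of z "nat n"] by simp
    next
      case False then show ?thesis using pos[of "z + int M * n" "nat (- n)"] by simp
    qed
  qed
  have md: "G (z mod int M) = G z" for z
    using per'[of "z mod int M" "z div int M"] by (simp add: add.commute)
  define \<sigma> where "\<sigma> z = nat ((r * int z + t) mod int M)" for z
  have s: "int (\<sigma> z) = (r * int z + t) mod int M" for z
    using M by (simp add: \<sigma>_def)
  have inj: "inj_on \<sigma> {..<M}"
  proof (rule inj_onI)
    fix x y assume xy: "x \<in> {..<M}" "y \<in> {..<M}" "\<sigma> x = \<sigma> y"
    then have "(r * int x + t) mod int M = (r * int y + t) mod int M" by (metis s)
    then have "int M dvd (r * int x + t) - (r * int y + t)" by (simp add: mod_eq_dvd_iff)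
    then have "int M dvd r * (int x - int y)" by (simp add: algebra_simps)
    then have "int M dvd int x - int y" using r by (simp add: coprime_dvd_mult_right_iff coprime_commute)
    then have "int x mod int M = int y mod int M" by (simp add: mod_eq_dvd_iff)
    then show "x = y" using xy by simp
  qed
  have sub: "\<sigma> ` {..<M} \<subseteq> {..<M}"
    using M by (auto simp: \<sigma>_def nat_less_iff)
  have "\<sigma> ` {..<M} = {..<M}"
    by (rule endo_inj_surj[OF _ sub inj]) simp
  then have "(\<Sum>z<M. G (int z)) = (\<Sum>z<M. G (int (\<sigma> z)))"
    using sum.reindex[OF inj, of "\<lambda>z. G (int z)"] by simp
  also have "\<dots> = (\<Sum>z<M. G (r * int z + t))" by (simp add: s md)
  finally show ?thesis by simp
qed simp

text \<open>The mean of all translates of \<open>dyadic_shift\<close>, with the averaging already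
  carried out: of the translation only the offset \<open>s\<close> of \<open>z\<close> in its block
  remains. In \<open>16 ^ Suc i\<close> one factor \<open>4 ^ Suc i\<close> averages over
  \<open>s\<close>, the other belongs to \<open>haar_coeff\<close>.\<close>

definition shift_average :: "nat \<Rightarrow> (int \<Rightarrow> 'x::real_vector) \<Rightarrow> int \<Rightarrow> 'x" where
  "shift_average m f z = (\<Sum>i<m. (1 / 16 ^ Suc i) *\<^sub>R (\<Sum>s<4 ^ Suc i. \<Sum>s'<4 ^ Suc i.
     (haar_g (s div 4 ^ i) * haar_h (s' div 4 ^ i)) *\<^sub>R f (z + int s' - int s)))"

text \<open>The shift translated by \<theta>, evaluated at x, is a quantity \<open>W x z\<close>
  with z = x + \<theta> that depends on x only through its digits. The dyadic bound is summed over
  all \<theta>, the variable \<theta> is exchanged for z by periodicity, and Jensen's inequality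
  compares with the mean over x at fixed z, which is \<open>shift_average\<close>.\<close>

lemma shift_average_bounded:
  fixes sc :: "'k::real_normed_field \<Rightarrow> 'x::banach \<Rightarrow> 'x"
  assumes sc: "normed_scaling sc" and umd: "UMD sc" and p: "1 < p"
  obtains C where "0 \<le> C"
    "\<And>m (f :: int \<Rightarrow> 'x). (\<And>z. f (z + 4 ^ m) = f z) \<Longrightarrow>
       (\<Sum>z<4^m. norm (shift_average m f (int z)) powr p) \<le> C * (\<Sum>z<4^m. norm (f (int z)) powr p)"
proof -
  obtain C where C: "0 \<le> C" "\<And>m (f :: nat \<Rightarrow> 'x). (\<Sum>x<4^m. norm (dyadic_shift m f x) powr p) \<le> C * (\<Sum>x<4^m. norm (f x) powr p)"
    using dyadic_shift_bounded[OF assms] by blast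
  show thesis
  proof (rule that[OF C(1)])
    fix m and f :: "int \<Rightarrow> 'x" assume per: "\<And>z. f (z + 4 ^ m) = f z"
    define M :: nat where "M = 4 ^ m"
    have M: "0 < real M" by (simp add: M_def)
    define R where "R i s z = (haar_g (s div 4 ^ i) / 4 ^ Suc i) *\<^sub>R
       (\<Sum>s'<4 ^ Suc i. haar_h (s' div 4 ^ i) *\<^sub>R f (z + int s' - int s))" for i s :: nat and z
    define W where "W x z = (\<Sum>i<m. R i (x mod 4 ^ Suc i) z)" for x z
    have Wper: "W x (z + int M) = W x z" for x z
    proof -
      have "f (z + int M + int s' - int s) = f (z + int s' - int s)" for s s'
        using per[of "z + int s' - int s"] by (simp add: M_def algebra_simps)
      then show ?thesis by (simp add: W_def R_def)
    qed
    have dig: "x div 4 ^ i mod 4 = (x mod 4 ^ Suc i) div 4 ^ i" for x i :: nat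
      by (simp only: power_Suc2 mod_mult2_eq) simp
    have ds: "dyadic_shift m (\<lambda>y. f (int y + int \<theta>)) x = W x (int x + int \<theta>)" for \<theta> x
      unfolding dyadic_shift_def W_def
    proof (rule sum.cong[OF refl])
      fix i
      have x: "int x = 4 ^ Suc i * int (x div 4 ^ Suc i) + int (x mod 4 ^ Suc i)"
      proof -
        have "int x = int (4 ^ Suc i * (x div 4 ^ Suc i) + x mod 4 ^ Suc i)" by (simp only: mult_div_mod_eq)
        then show ?thesis by (simp only: of_nat_add of_nat_mult of_nat_power of_nat_numeral)
      qed
      have "f (int (4 ^ Suc i * (x div 4 ^ Suc i) + s) + int \<theta>) = f (int x + int \<theta> + int s - int (x mod 4 ^ Suc i))" for s
        by (rule arg_cong[where f=f]) (subst x, simp add: algebra_simps)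
      then show "haar_g (x div 4 ^ i mod 4) *\<^sub>R haar_coeff (\<lambda>y. f (int y + int \<theta>)) i (x div 4 ^ Suc i)
         = R i (x mod 4 ^ Suc i) (int x + int \<theta>)"
        unfolding haar_coeff_eq R_def dig by simp
    qed
    have "(\<Sum>\<theta><M. \<Sum>x<M. norm (W x (int x + int \<theta>)) powr p) \<le> (\<Sum>\<theta><M. C * (\<Sum>y<M. norm (f (int y + int \<theta>)) powr p))"
      unfolding ds[symmetric] M_def by (intro sum_mono C(2))
    also have "\<dots> = (\<Sum>\<theta><M. C * (\<Sum>y<M. norm (f (int y)) powr p))"
    proof (intro sum.cong refl)
      fix \<theta>
      show "C * (\<Sum>y<M. norm (f (int y + int \<theta>)) powr p) = C * (\<Sum>y<M. norm (f (int y)) powr p)"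
        using sum_periodic_affine[of "\<lambda>z. norm (f z) powr p" M 1 "int \<theta>"] per by (simp add: M_def)
    qed
    also have "\<dots> = real M * (C * (\<Sum>y<M. norm (f (int y)) powr p))" by simp
    finally have up: "(\<Sum>\<theta><M. \<Sum>x<M. norm (W x (int x + int \<theta>)) powr p) \<le> real M * (C * (\<Sum>y<M. norm (f (int y)) powr p))" .
    have "(\<Sum>\<theta><M. \<Sum>x<M. norm (W x (int x + int \<theta>)) powr p) = (\<Sum>x<M. \<Sum>\<theta><M. norm (W x (int x + int \<theta>)) powr p)"
      by (rule sum.swap)
    also have "\<dots> = (\<Sum>x<M. \<Sum>z<M. norm (W x (int z)) powr p)"
    proof (rule sum.cong[OF refl])
      fix x
      show "(\<Sum>\<theta><M. norm (W x (int x + int \<theta>)) powr p) = (\<Sum>z<M. norm (W x (int z)) powr p)"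
        using sum_periodic_affine[of "\<lambda>z. norm (W x z) powr p" M 1 "int x"] Wper by (simp add: add.commute)
    qed
    also have "\<dots> = (\<Sum>z<M. \<Sum>x<M. norm (W x (int z)) powr p)"
      by (rule sum.swap)
    also have "\<dots> \<ge> (\<Sum>z<M. real M * norm (shift_average m f (int z)) powr p)"
    proof (rule sum_mono)
      fix z :: nat
      have "shift_average m f (int z) = (\<Sum>x<M. (1 / real M) *\<^sub>R W x (int z))"
      proof -
        have "(\<Sum>x<M. W x (int z)) = (\<Sum>i<m. \<Sum>x<M. R i (x mod 4 ^ Suc i) (int z))"
          unfolding W_def by (rule sum.swap)
        also have "\<dots> = (\<Sum>i<m. real (4 ^ (m - Suc i)) *\<^sub>R (\<Sum>s<4 ^ Suc i. R i s (int z)))"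
        proof (rule sum.cong[OF refl])
          fix i assume "i \<in> {..<m}"
          then have e: "M = 4 ^ (m - Suc i) * 4 ^ Suc i"
            unfolding M_def by (metis Suc_leI le_add_diff_inverse2 lessThan_iff power_add)
          show "(\<Sum>x<M. R i (x mod 4 ^ Suc i) (int z)) = real (4 ^ (m - Suc i)) *\<^sub>R (\<Sum>s<4 ^ Suc i. R i s (int z))"
            unfolding e by (rule sum_block_mod) simp
        qed
        finally have "(\<Sum>x<M. (1 / real M) *\<^sub>R W x (int z)) = (\<Sum>i<m. (real (4 ^ (m - Suc i)) / real M) *\<^sub>R (\<Sum>s<4 ^ Suc i. R i s (int z)))"
          by (simp add: scaleR_sum_right[symmetric]) (simp add: scaleR_sum_right)
        also have "\<dots> = shift_average m f (int z)"
          unfolding shift_average_def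
        proof (rule sum.cong[OF refl])
          fix i assume "i \<in> {..<m}"
          then have e: "real M = 4 ^ (m - Suc i) * 4 ^ Suc i"
            unfolding M_def by (metis Suc_leI le_add_diff_inverse2 lessThan_iff power_add of_nat_numeral of_nat_power)
          have f16: "(16::real) ^ Suc i = 4 ^ Suc i * 4 ^ Suc i" by (simp flip: power_mult_distrib)
          have e': "real (4 ^ (m - Suc i)) / real M = 1 / 4 ^ Suc i" unfolding e by simp
          have "(\<Sum>s<4 ^ Suc i. R i s (int z)) = (1 / 4 ^ Suc i) *\<^sub>R (\<Sum>s<4 ^ Suc i. \<Sum>s'<4 ^ Suc i.
             (haar_g (s div 4 ^ i) * haar_h (s' div 4 ^ i)) *\<^sub>R f (int z + int s' - int s))"
            unfolding R_def scaleR_sum_right by (intro sum.cong) auto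
          then show "(real (4 ^ (m - Suc i)) / real M) *\<^sub>R (\<Sum>s<4 ^ Suc i. R i s (int z)) =
             (1 / 16 ^ Suc i) *\<^sub>R (\<Sum>s<4 ^ Suc i. \<Sum>s'<4 ^ Suc i.
             (haar_g (s div 4 ^ i) * haar_h (s' div 4 ^ i)) *\<^sub>R f (int z + int s' - int s))"
            unfolding e' f16 by simp
        qed
        finally show ?thesis by simp
      qed
      then have "norm (shift_average m f (int z)) powr p \<le> (\<Sum>x<M. 1 / real M) powr (p - 1) * (\<Sum>x<M. (1 / real M) * norm (W x (int z)) powr p)"
        using p by (simp only:) (rule norm_weighted_sum_powr_le, auto)
      also have "\<dots> = (1 / real M) * (\<Sum>x<M. norm (W x (int z)) powr p)"
        using M by (simp add: sum_divide_distrib)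
      finally show "real M * norm (shift_average m f (int z)) powr p \<le> (\<Sum>x<M. norm (W x (int z)) powr p)"
        using M by (simp add: field_simps)
    qed
    finally have "real M * (\<Sum>z<M. norm (shift_average m f (int z)) powr p) \<le> real M * (C * (\<Sum>y<M. norm (f (int y)) powr p))"
      using up by (simp add: sum_distrib_left)
    then show "(\<Sum>z<4^m. norm (shift_average m f (int z)) powr p) \<le> C * (\<Sum>z<4^m. norm (f (int z)) powr p)"
      using M by (simp add: M_def)
  qed
qed

section \<open>The symbol of the averaged shift\<close>

lemma sum_quarters_cis:
  "(\<Sum>s<4 * q. of_real (c (s div q)) * cis (w * real s))
     = (\<Sum>j<4. of_real (c j) * cis (w * real q) ^ j) * (\<Sum>s<q. cis (w * real s))"
proof -
  have "(\<Sum>s<4 * q. of_real (c (s div q)) * cis (w * real s))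
      = (\<Sum>j<4. sum (\<lambda>s. of_real (c (s div q)) * cis (w * real s)) {j * q..<j * q + q})"
    by (rule sum.nat_group[symmetric])
  also have "\<dots> = (\<Sum>j<4. of_real (c j) * cis (w * real q) ^ j * (\<Sum>s<q. cis (w * real s)))"
  proof (rule sum.cong[OF refl])
    fix j :: nat
    have "sum (\<lambda>s. of_real (c (s div q)) * cis (w * real s)) {j * q..<j * q + q}
       = (\<Sum>s<q. of_real (c ((s + j * q) div q)) * cis (w * real (s + j * q)))"
      using sum.shift_bounds_nat_ivl[of "\<lambda>s. of_real (c (s div q)) * cis (w * real s)" 0 "j * q" q]
      by (simp add: add.commute atLeast0LessThan)
    also have "\<dots> = (\<Sum>s<q. of_real (c j) * cis (w * real q) ^ j * cis (w * real s))"
      by (intro sum.cong refl) (auto simp: Complex.DeMoivre cis_mult algebra_simps)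
    finally show "sum (\<lambda>s. of_real (c (s div q)) * cis (w * real s)) {j * q..<j * q + q}
      = of_real (c j) * cis (w * real q) ^ j * (\<Sum>s<q. cis (w * real s))"
      by (simp add: sum_distrib_left)
  qed
  finally show ?thesis by (simp add: sum_distrib_right)
qed

text \<open>With E = \<open>cis (w * real q)\<close> the two Haar polynomials factor as (1 + E)^2 (1
  - E) and (1 - E)^2 (1 + E). Since E has modulus 1, the first times the conjugate of the second is
  minus the cube of E - cnj E, which is purely imaginary and odd in \<open>w\<close>. This is what
  makes the pair \<open>haar_h\<close>, \<open>haar_g\<close> suitable.\<close>

lemma haar_symbol:
  fixes w :: real and q :: nat
  defines "B \<equiv> (\<Sum>s<q. cis (w * real s))"
  shows "(\<Sum>s<4 * q. of_real (haar_h (s div q)) * cis (w * real s)) *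
     cnj (\<Sum>s<4 * q. of_real (haar_g (s div q)) * cis (w * real s))
     = \<i> * of_real (8 * (cmod B)\<^sup>2 * sin (w * real q) ^ 3)"
proof -
  define E where "E = cis (w * real q)"
  have EE: "E * cnj E = 1" by (simp add: E_def cis_cnj cis_mult)
  have H: "(\<Sum>s<4 * q. of_real (haar_h (s div q)) * cis (w * real s)) = (1 + E)\<^sup>2 * (1 - E) * B"
    unfolding sum_quarters_cis E_def[symmetric] B_def[symmetric] sum_lessThan_4
    by (simp add: haar_h_def algebra_simps power2_eq_square power3_eq_cube)
  have G: "(\<Sum>s<4 * q. of_real (haar_g (s div q)) * cis (w * real s)) = (1 - E)\<^sup>2 * (1 + E) * B"
    unfolding sum_quarters_cis E_def[symmetric] B_def[symmetric] sum_lessThan_4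
    by (simp add: haar_g_def algebra_simps power2_eq_square power3_eq_cube)
  have 1: "(1 + E) * (1 - cnj E) = E - cnj E" "(1 - E) * (1 + cnj E) = cnj E - E"
    using EE by (simp_all add: algebra_simps)
  have 2: "E - cnj E = 2 * \<i> * of_real (sin (w * real q))"
    by (simp add: E_def complex_eq_iff)
  have "(1 + E)\<^sup>2 * (1 - E) * B * cnj ((1 - E)\<^sup>2 * (1 + E) * B)
     = ((1 + E) * (1 - cnj E))\<^sup>2 * ((1 - E) * (1 + cnj E)) * (B * cnj B)"
    by (simp add: algebra_simps power2_eq_square)
  also have "\<dots> = - ((E - cnj E) ^ 3) * (B * cnj B)"
    unfolding 1 by (simp add: algebra_simps power2_eq_square power3_eq_cube)
  also have "\<dots> = \<i> * of_real (8 * (cmod B)\<^sup>2 * sin (w * real q) ^ 3)"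
    unfolding 2 complex_norm_square[symmetric] by (simp add: power_mult_distrib power3_eq_cube)
  finally show ?thesis unfolding H G .
qed

lemma norm_one_minus_cis: "(cmod (1 - cis x))\<^sup>2 = 4 * (sin (x / 2))\<^sup>2"
proof -
  have c: "cos x = 1 - 2 * (sin (x / 2))\<^sup>2"
    using cos_double_sin[of "x / 2"] by simp
  have "(cmod (1 - cis x))\<^sup>2 = (1 - cos x)\<^sup>2 + (sin x)\<^sup>2" by (simp add: cmod_power2)
  also have "\<dots> = 2 - 2 * cos x" using sin_cos_squared_add[of x] by (simp add: power2_eq_square algebra_simps)
  also have "\<dots> = 4 * (sin (x / 2))\<^sup>2" using c by simp
  finally show ?thesis .
qed

text \<open>The geometric sum in multiplied-out form, so that \<open>cis w = 1\<close> is
  included.\<close>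

lemma norm_sum_cis: "(cmod (\<Sum>s<q. cis (w * real s)))\<^sup>2 * (sin (w / 2))\<^sup>2 = (sin (w * real q / 2))\<^sup>2"
proof -
  have "(\<Sum>s<q. cis (w * real s)) * (1 - cis w) = 1 - cis (w * real q)"
  proof -
    have e: "cis (w * real s) = cis w ^ s" for s by (simp add: Complex.DeMoivre mult.commute)
    show ?thesis unfolding e using sum_gp_strict[of "cis w" q] by (cases "cis w = 1") auto
  qed
  then have "(cmod (\<Sum>s<q. cis (w * real s)))\<^sup>2 * (cmod (1 - cis w))\<^sup>2 = (cmod (1 - cis (w * real q)))\<^sup>2"
    by (metis norm_mult power_mult_distrib)
  then show ?thesis unfolding norm_one_minus_cis by simp
qed

text \<open>The Fourier multiplier of \<open>shift_average\<close> at frequency \<open>k\<close>, up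
  to a factor i: \<open>2 * pi * k / 4 ^ m\<close> is the angular frequency on the cyclic group and
  \<open>4 ^ i\<close> the scale. If \<open>4 ^ m\<close> divides \<open>k\<close>, the denominator
  is 0 and the quotient is 0, which is the correct value.\<close>

definition shift_symbol :: "nat \<Rightarrow> int \<Rightarrow> real" where
  "shift_symbol m k = (\<Sum>i<m. sin (2 * pi * k / 4 ^ m * 4 ^ i) ^ 3 * (sin (2 * pi * k / 4 ^ m * 4 ^ i / 2))\<^sup>2
      / (2 * (4 ^ i)\<^sup>2 * (sin (2 * pi * k / 4 ^ m / 2))\<^sup>2))"

text \<open>The double sum is the real part of \<open>cis (w * z + \<phi>)\<close> times the product
  evaluated in \<open>haar_symbol\<close>; the imaginary factor turns the cosine into minus the
  sine.\<close>

lemma haar_sum_cos: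
  fixes w z \<phi> :: real and i :: nat
  shows "(1 / 16 ^ Suc i) * (\<Sum>s<4 ^ Suc i. \<Sum>s'<4 ^ Suc i.
     haar_g (s div 4 ^ i) * haar_h (s' div 4 ^ i) * cos (w * (z + real s' - real s) + \<phi>))
   = - (sin (w * 4 ^ i) ^ 3 * (sin (w * 4 ^ i / 2))\<^sup>2 / (2 * (4 ^ i)\<^sup>2 * (sin (w / 2))\<^sup>2)) * sin (w * z + \<phi>)"
proof -
  define q :: nat where "q = 4 ^ i"
  have q: "real q = 4 ^ i" "real q > 0" by (simp_all add: q_def)
  define B where "B = (\<Sum>s<q. cis (w * real s))"
  define H where "H = (\<Sum>s<4 * q. of_real (haar_h (s div q)) * cis (w * real s))"
  define G where "G = (\<Sum>s<4 * q. of_real (haar_g (s div q)) * cis (w * real s))"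
  have "(\<Sum>s<4 * q. \<Sum>s'<4 * q. haar_g (s div q) * haar_h (s' div q) * cos (w * (z + real s' - real s) + \<phi>))
     = (\<Sum>s<4 * q. \<Sum>s'<4 * q. Re (cis (w * z + \<phi>) * ((of_real (haar_h (s' div q)) * cis (w * real s')) *
            cnj (of_real (haar_g (s div q)) * cis (w * real s)))))"
  proof (intro sum.cong refl)
    fix s s'
    have "cis (w * z + \<phi>) * ((of_real (haar_h (s' div q)) * cis (w * real s')) *
            cnj (of_real (haar_g (s div q)) * cis (w * real s)))
       = of_real (haar_g (s div q) * haar_h (s' div q)) * cis (w * (z + real s' - real s) + \<phi>)"
    proof -
      have "cis (w * z + \<phi>) * ((of_real (haar_h (s' div q)) * cis (w * real s')) *
            cnj (of_real (haar_g (s div q)) * cis (w * real s)))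
        = of_real (haar_g (s div q) * haar_h (s' div q)) * (cis (w * z + \<phi>) * cis (w * real s') * cis (- (w * real s)))"
        by (simp add: cis_cnj)
      also have "cis (w * z + \<phi>) * cis (w * real s') * cis (- (w * real s)) = cis (w * (z + real s' - real s) + \<phi>)"
        unfolding cis_mult by (rule arg_cong[where f=cis]) (simp add: algebra_simps)
      finally show ?thesis .
    qed
    have Re_c: "Re (of_real c * cis x) = c * cos x" for c x by simp
    from arg_cong[OF \<open>_ = of_real _ * cis _\<close>, of Re]
    show "haar_g (s div q) * haar_h (s' div q) * cos (w * (z + real s' - real s) + \<phi>) =
      Re (cis (w * z + \<phi>) * ((of_real (haar_h (s' div q)) * cis (w * real s')) *
            cnj (of_real (haar_g (s div q)) * cis (w * real s))))" by (simp only: Re_c)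
  qed
  also have "\<dots> = Re (\<Sum>s<4 * q. \<Sum>s'<4 * q. cis (w * z + \<phi>) * ((of_real (haar_h (s' div q)) * cis (w * real s')) *
            cnj (of_real (haar_g (s div q)) * cis (w * real s))))"
    by (simp only: Re_sum)
  also have "\<dots> = Re (cis (w * z + \<phi>) * (H * cnj G))"
    unfolding H_def G_def cnj_sum sum_product
    by (subst sum.swap) (simp only: sum_distrib_left)
  also have "H * cnj G = \<i> * of_real (8 * (cmod B)\<^sup>2 * sin (w * real q) ^ 3)"
    unfolding H_def G_def B_def by (rule haar_symbol)
  also have "Re (cis (w * z + \<phi>) * (\<i> * of_real (8 * (cmod B)\<^sup>2 * sin (w * real q) ^ 3)))
      = - (8 * (cmod B)\<^sup>2 * sin (w * real q) ^ 3) * sin (w * z + \<phi>)"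
    by simp
  finally have sum: "(\<Sum>s<4 * q. \<Sum>s'<4 * q. haar_g (s div q) * haar_h (s' div q) * cos (w * (z + real s' - real s) + \<phi>))
      = - (8 * (cmod B)\<^sup>2 * sin (w * real q) ^ 3) * sin (w * z + \<phi>)" .
  \<comment> \<open>If \<open>sin (w / 2) = 0\<close>, then w is a multiple of 2 * pi, so
    \<open>sin (w * real q)\<close> vanishes and both sides are 0.\<close>
  have BB: "(cmod B)\<^sup>2 * sin (w * real q) ^ 3 = sin (w * real q) ^ 3 * (sin (w * real q / 2))\<^sup>2 / (sin (w / 2))\<^sup>2"
  proof (cases "sin (w / 2) = 0")
    case True
    then obtain n :: int where "w / 2 = n * pi" by (auto simp: sin_zero_iff_int2)
    then have "w * real q = of_int (2 * n * int q) * pi" by (simp add: field_simps)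
    then have "sin (w * real q) = 0" by (metis sin_zero_iff_int2)
    then show ?thesis by simp
  next
    case False
    have "(sin (w * real q / 2))\<^sup>2 / (sin (w / 2))\<^sup>2 = (cmod B)\<^sup>2"
      using norm_sum_cis[of w q] False unfolding B_def by (simp add: field_simps)
    then show ?thesis by (simp add: mult.commute flip: times_divide_eq_right)
  qed
  have f16: "(16::real) ^ Suc i = 16 * (real q)\<^sup>2" by (simp add: q power_mult_distrib power2_eq_square flip: power_mult_distrib)
  have q4: "4 ^ Suc i = 4 * q" by (simp add: q_def)
  show ?thesis
    unfolding q4 q_def[symmetric] f16 sum q(1)[symmetric]
    using q(2) BB by (simp add: field_simps)
qed

text \<open>Free phases \<open>\<phi>\<close> let cosine sums represent all real trigonometric sums
  with vector coefficients, sines included, and let the same frequency occur several times in the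
  family.\<close>

lemma shift_average_cos:
  fixes a :: "'i \<Rightarrow> 'x::real_vector"
  shows "shift_average m (\<lambda>z. \<Sum>j\<in>S. cos (2 * pi * k j / 4 ^ m * z + \<phi> j) *\<^sub>R a j) z
    = - (\<Sum>j\<in>S. (shift_symbol m (k j) * sin (2 * pi * k j / 4 ^ m * z + \<phi> j)) *\<^sub>R a j)"
proof -
  have "(1 / 16 ^ Suc i) *\<^sub>R (\<Sum>s<4 ^ Suc i. \<Sum>s'<4 ^ Suc i.
     (haar_g (s div 4 ^ i) * haar_h (s' div 4 ^ i)) *\<^sub>R (\<Sum>j\<in>S. cos (2 * pi * k j / 4 ^ m * of_int (z + int s' - int s) + \<phi> j) *\<^sub>R a j))
   = (\<Sum>j\<in>S. ((1 / 16 ^ Suc i) * (\<Sum>s<4 ^ Suc i. \<Sum>s'<4 ^ Suc i.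
     haar_g (s div 4 ^ i) * haar_h (s' div 4 ^ i) * cos (2 * pi * k j / 4 ^ m * (of_int z + real s' - real s) + \<phi> j))) *\<^sub>R a j)" for i
  proof -
    have "(\<Sum>s<4 ^ Suc i. \<Sum>s'<4 ^ Suc i.
       (haar_g (s div 4 ^ i) * haar_h (s' div 4 ^ i)) *\<^sub>R (\<Sum>j\<in>S. cos (2 * pi * k j / 4 ^ m * of_int (z + int s' - int s) + \<phi> j) *\<^sub>R a j))
     = (\<Sum>s<4 ^ Suc i. \<Sum>s'<4 ^ Suc i. \<Sum>j\<in>S. 
       (haar_g (s div 4 ^ i) * haar_h (s' div 4 ^ i) * cos (2 * pi * k j / 4 ^ m * (of_int z + real s' - real s) + \<phi> j)) *\<^sub>R a j)"
      by (simp add: scaleR_sum_right)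
    also have "\<dots> = (\<Sum>j\<in>S. \<Sum>s<4 ^ Suc i. \<Sum>s'<4 ^ Suc i. 
       (haar_g (s div 4 ^ i) * haar_h (s' div 4 ^ i) * cos (2 * pi * k j / 4 ^ m * (of_int z + real s' - real s) + \<phi> j)) *\<^sub>R a j)"
      by (subst sum.swap[of _ S]) (subst sum.swap[of _ S], rule refl)
    finally show ?thesis by (simp only: scaleR_sum_left[symmetric]) (simp only: scaleR_sum_right scaleR_scaleR)
  qed
  note eq = this
  show ?thesis
    unfolding shift_average_def eq unfolding haar_sum_cos
    by (subst sum.swap)
      (simp add: shift_symbol_def scaleR_sum_left sum_distrib_right sum_negf flip: scaleR_sum_left)
qed

text \<open>Dilating a function of z into one of r * z multiplies its frequencies by r, so the shift
  acts with the symbol at r * k. Since r is odd, the dilation permutes the grid and leaves both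
  sides unchanged; the constant therefore depends neither on r nor on m.\<close>

lemma grid_multiplier_bounded:
  fixes sc :: "'k::real_normed_field \<Rightarrow> 'x::banach \<Rightarrow> 'x"
  assumes sc: "normed_scaling sc" and umd: "UMD sc" and p: "1 < p"
  obtains C where "0 \<le> C"
    "\<And>m r (S :: 'i set) k \<phi> (a :: 'i \<Rightarrow> 'x). odd r \<Longrightarrow>
       (\<Sum>z<(4::nat)^m. norm (\<Sum>j\<in>S. (shift_symbol m (r * k j) * sin (2 * pi * k j / 4 ^ m * z + \<phi> j)) *\<^sub>R a j) powr p)
       \<le> C * (\<Sum>z<(4::nat)^m. norm (\<Sum>j\<in>S. cos (2 * pi * k j / 4 ^ m * z + \<phi> j) *\<^sub>R a j) powr p)"
proof -
  obtain C where C: "0 \<le> C" "\<And>m (f :: int \<Rightarrow> 'x). (\<And>z. f (z + 4 ^ m) = f z) \<Longrightarrow>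
       (\<Sum>z<4^m. norm (shift_average m f (int z)) powr p) \<le> C * (\<Sum>z<4^m. norm (f (int z)) powr p)"
    using shift_average_bounded[OF assms] by blast
  show thesis
  proof (rule that[OF C(1)])
    fix m and r :: int and S :: "'i set" and k :: "'i \<Rightarrow> int" and \<phi> and a :: "'i \<Rightarrow> 'x"
    assume r: "odd r"
    define M :: nat where "M = 4 ^ m"
    have "coprime r (2 ^ (2 * m))" using r by (simp add: coprime_power_right_iff)
    then have cop: "coprime r (int M)" by (simp add: M_def power_mult)
    have per: "2 * pi * of_int l / 4 ^ m * of_int (z + 4 ^ m) + t = (2 * pi * of_int l / 4 ^ m * of_int z + t) + of_int l * (2 * pi)" for l z :: int and t
      by (simp add: field_simps)
    have cper: "cos (2 * pi * of_int l / 4 ^ m * of_int (z + 4 ^ m) + t) = cos (2 * pi * of_int l / 4 ^ m * of_int z + t)"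
      and sper: "sin (2 * pi * of_int l / 4 ^ m * of_int (z + 4 ^ m) + t) = sin (2 * pi * of_int l / 4 ^ m * of_int z + t)" for l z :: int and t
      unfolding per by (simp_all add: cos_add sin_add mult.commute[of _ "2 * pi"])
    define f where "f z = (\<Sum>j\<in>S. cos (2 * pi * of_int (r * k j) / 4 ^ m * of_int z + \<phi> j) *\<^sub>R a j)" for z :: int
    define g where "g z = (\<Sum>j\<in>S. cos (2 * pi * of_int (k j) / 4 ^ m * of_int z + \<phi> j) *\<^sub>R a j)" for z :: int
    define h where "h z = (\<Sum>j\<in>S. (shift_symbol m (r * k j) * sin (2 * pi * of_int (k j) / 4 ^ m * of_int z + \<phi> j)) *\<^sub>R a j)" for z :: int
    have fper: "f (z + 4 ^ m) = f z" "g (z + 4 ^ m) = g z" "h (z + 4 ^ m) = h z" for z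
      unfolding f_def g_def h_def cper sper by simp_all
    have fg: "f z = g (r * z)" for z unfolding f_def g_def by (simp add: mult_ac)
    have sh: "shift_average m f z = - h (r * z)" for z
      using shift_average_cos[where m=m and S=S and k="\<lambda>j. r * k j" and \<phi>=\<phi> and a=a and z=z] unfolding f_def h_def by (simp add: mult_ac)
    have "(\<Sum>z<M. norm (h (int z)) powr p) = (\<Sum>z<M. norm (h (r * int z + 0)) powr p)"
      by (rule sum_periodic_affine[symmetric, OF _ cop]) (simp add: M_def fper)
    also have "\<dots> = (\<Sum>z<M. norm (shift_average m f (int z)) powr p)" by (simp add: sh)
    also have "\<dots> \<le> C * (\<Sum>z<M. norm (f (int z)) powr p)" unfolding M_def by (rule C(2)) (rule fper)
    also have "(\<Sum>z<M. norm (f (int z)) powr p) = (\<Sum>z<M. norm (g (r * int z + 0)) powr p)" by (simp add: fg)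
    also have "\<dots> = (\<Sum>z<M. norm (g (int z)) powr p)"
      by (rule sum_periodic_affine[OF _ cop]) (simp add: M_def fper)
    finally show "(\<Sum>z<(4::nat)^m. norm (\<Sum>j\<in>S. (shift_symbol m (r * k j) * sin (2 * pi * k j / 4 ^ m * z + \<phi> j)) *\<^sub>R a j) powr p)
       \<le> C * (\<Sum>z<(4::nat)^m. norm (\<Sum>j\<in>S. cos (2 * pi * k j / 4 ^ m * z + \<phi> j) *\<^sub>R a j) powr p)"
      by (simp add: M_def g_def h_def)
  qed
qed

section \<open>Trigonometric polynomials and Fourier series\<close>

text \<open>The inductive form reduces closure under products to the product-to-sum formulas. That
  closure is what polynomials in the coordinates of the unit circle require.\<close>

inductive trig_poly :: "(real \<Rightarrow> real) \<Rightarrow> bool" where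
  cos: "trig_poly (\<lambda>x. cos (real k * x))"
| sin: "trig_poly (\<lambda>x. sin (real k * x))"
| cmult: "trig_poly f \<Longrightarrow> trig_poly (\<lambda>x. c * f x)"
| add: "trig_poly f \<Longrightarrow> trig_poly g \<Longrightarrow> trig_poly (\<lambda>x. f x + g x)"

lemma trig_poly_const: "trig_poly (\<lambda>x. c)"
  using trig_poly.cmult[OF trig_poly.cos[of 0], of c] by simp

lemma trig_poly_cos_int: "trig_poly (\<lambda>x. cos (of_int k * x))"
proof (cases "k \<ge> 0")
  case True
  then show ?thesis using trig_poly.cos[of "nat k"] by simp
next
  case False
  then show ?thesis using trig_poly.cos[of "nat (- k)"] by simp
qed

lemma trig_poly_sin_int: "trig_poly (\<lambda>x. sin (of_int k * x))"
proof (cases "k \<ge> 0")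
  case True
  then show ?thesis using trig_poly.sin[of "nat k"] by simp
next
  case False
  then show ?thesis using trig_poly.cmult[OF trig_poly.sin[of "nat (- k)"], of "-1"] by simp
qed

lemma trig_poly_lin2:
  "trig_poly f \<Longrightarrow> trig_poly g \<Longrightarrow> trig_poly (\<lambda>x. a * f x + b * g x)"
  by (intro trig_poly.add trig_poly.cmult)

lemma trig_product_to_sum:
  fixes a b :: real
  shows "cos a * cos b = (1/2) * cos (a - b) + (1/2) * cos (a + b)"
    and "cos a * sin b = (1/2) * sin (a + b) + (-1/2) * sin (a - b)"
    and "sin a * cos b = (1/2) * sin (a + b) + (1/2) * sin (a - b)"
    and "sin a * sin b = (1/2) * cos (a - b) + (-1/2) * cos (a + b)"
  by (simp_all add: cos_add cos_diff sin_add sin_diff field_simps)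

lemma trig_product_to_sum_nat:
  fixes x :: real and k n :: nat
  shows "cos (real k * x) * cos (real n * x) = (1/2) * cos (of_int (int k - int n) * x) + (1/2) * cos (of_int (int k + int n) * x)"
    and "cos (real k * x) * sin (real n * x) = (1/2) * sin (of_int (int k + int n) * x) + (-1/2) * sin (of_int (int k - int n) * x)"
    and "sin (real k * x) * cos (real n * x) = (1/2) * sin (of_int (int k + int n) * x) + (1/2) * sin (of_int (int k - int n) * x)"
    and "sin (real k * x) * sin (real n * x) = (1/2) * cos (of_int (int k - int n) * x) + (-1/2) * cos (of_int (int k + int n) * x)"
  by (simp_all only: trig_product_to_sum of_int_add of_int_diff of_int_of_nat_eq distrib_right left_diff_distrib)

lemma trig_poly_mult_cos: "trig_poly f \<Longrightarrow> trig_poly (\<lambda>x. cos (real k * x) * f x)"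
proof (induction rule: trig_poly.induct)
  case (cos n)
  show ?case unfolding trig_product_to_sum_nat(1) by (rule trig_poly_lin2[OF trig_poly_cos_int trig_poly_cos_int])
next
  case (sin n)
  show ?case unfolding trig_product_to_sum_nat(2) by (rule trig_poly_lin2[OF trig_poly_sin_int trig_poly_sin_int])
next
  case (cmult f c)
  then show ?case using trig_poly.cmult[of "\<lambda>x. cos (real k * x) * f x" c] by (simp add: mult_ac)
next
  case (add f g)
  then show ?case using trig_poly.add by (simp add: distrib_left)
qed

lemma trig_poly_mult_sin: "trig_poly f \<Longrightarrow> trig_poly (\<lambda>x. sin (real k * x) * f x)"
proof (induction rule: trig_poly.induct)
  case (cos n)
  show ?case unfolding trig_product_to_sum_nat(3) by (rule trig_poly_lin2[OF trig_poly_sin_int trig_poly_sin_int])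
next
  case (sin n)
  show ?case unfolding trig_product_to_sum_nat(4) by (rule trig_poly_lin2[OF trig_poly_cos_int trig_poly_cos_int])
next
  case (cmult f c)
  then show ?case using trig_poly.cmult[of "\<lambda>x. sin (real k * x) * f x" c] by (simp add: mult_ac)
next
  case (add f g)
  then show ?case using trig_poly.add by (simp add: distrib_left)
qed

lemma trig_poly_mult: "trig_poly f \<Longrightarrow> trig_poly g \<Longrightarrow> trig_poly (\<lambda>x. f x * g x)"
proof (induction rule: trig_poly.induct)
  case (cmult f c)
  then show ?case using trig_poly.cmult[of "\<lambda>x. f x * g x" c] by (simp add: mult_ac)
next
  case (add f h)
  then show ?case using trig_poly.add by (simp add: distrib_right)
qed (auto intro: trig_poly_mult_cos trig_poly_mult_sin)

lemma trig_poly_continuous: "trig_poly f \<Longrightarrow> continuous_on A f"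
  by (induction rule: trig_poly.induct) (auto intro!: continuous_intros)

lemma trig_poly_polynomial_cis:
  "real_polynomial_function (g :: complex \<Rightarrow> real) \<Longrightarrow> trig_poly (\<lambda>x. g (cis x))"
proof (induction rule: real_polynomial_function.induct)
  case (linear h)
  interpret bounded_linear h by fact
  have "h (cis x) = h 1 * cos (real 1 * x) + h \<i> * sin (real 1 * x)" for x
  proof -
    have "cis x = cos x *\<^sub>R 1 + sin x *\<^sub>R \<i>" by (simp add: complex_eq_iff)
    then show ?thesis by (simp add: add scaleR mult.commute)
  qed
  then show ?case using trig_poly_lin2[OF trig_poly.cos[of 1] trig_poly.sin[of 1]] by simp
qed (auto intro: trig_poly_const trig_poly.add trig_poly_mult)

text \<open>A function with equal end values lives on the unit circle, where Stone-Weierstrass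
  supplies a real polynomial; restricted to \<open>cis x\<close> it is a trigonometric
  polynomial.\<close>

lemma trig_poly_approx:
  fixes f :: "real \<Rightarrow> real"
  assumes f: "continuous_on {0..2*pi} f" and per: "f 0 = f (2*pi)" and e: "e > 0"
  obtains g where "trig_poly g" "\<And>x. x \<in> {0..2*pi} \<Longrightarrow> \<bar>f x - g x\<bar> < e"
proof -
  define F where "F z = f (Arg2pi z)" for z
  have cisx: "\<exists>x\<in>{0..2*pi}. z = cis x" if "cmod z = 1" for z
    using that Arg2pi_ge_0[of z] Arg2pi_lt_2pi[of z] Arg2pi_eq[of z]
    by (intro bexI[of _ "Arg2pi z"]) (auto simp: cis_conv_exp)
  have F: "F (cis x) = f x" if "x \<in> {0..2*pi}" for x
  proof (cases "x = 2*pi")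
    case True
    moreover have "Arg2pi 1 = 0" by (rule Arg2pi_unique[of 1]) auto
    ultimately show ?thesis using per by (simp add: F_def)
  next
    case False
    then have "Arg2pi (cis x) = x"
      using that by (intro Arg2pi_unique[of 1]) (auto simp: cis_conv_exp mult.commute)
    then show ?thesis by (simp add: F_def)
  qed
  \<comment> \<open>\<open>Arg2pi\<close> jumps at 1, so continuity is checked on preimages of
    closed sets: each is the \<open>cis\<close> image of a compact subset of the interval, hence
    compact.\<close>
  have "continuous_on (sphere 0 1) F"
    unfolding continuous_on_closed_invariant
  proof (intro allI impI)
    fix C :: "real set" assume C: "closed C"
    have "compact ({0..2*pi} \<inter> f -` C)"
      using continuous_closed_preimage[OF f _ C] by (simp add: compact_eq_bounded_closed bounded_Int)
    then have "compact (cis ` ({0..2*pi} \<inter> f -` C))"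
      by (rule compact_continuous_image[rotated]) (auto intro!: continuous_intros simp: cis_conv_exp)
    moreover have "cis ` ({0..2*pi} \<inter> f -` C) \<inter> sphere 0 1 = F -` C \<inter> sphere 0 1"
    proof (intro equalityI subsetI)
      fix z :: complex assume z: "z \<in> F -` C \<inter> sphere 0 1"
      then obtain x where "x \<in> {0..2*pi}" "z = cis x" using cisx[of z] by auto
      then show "z \<in> cis ` ({0..2*pi} \<inter> f -` C) \<inter> sphere 0 1" using z F by auto
    qed (use F in auto)
    ultimately show "\<exists>A. closed A \<and> A \<inter> sphere 0 1 = F -` C \<inter> sphere 0 1"
      using compact_imp_closed by blast
  qed
  then obtain g where g: "real_polynomial_function g" "\<And>z. z \<in> sphere 0 1 \<Longrightarrow> \<bar>F z - g z\<bar> < e"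
    using Stone_Weierstrass_real_polynomial_function[of "sphere 0 1" F e] e by auto
  show thesis
  proof (rule that[OF trig_poly_polynomial_cis[OF g(1)]])
    fix x assume x: "x \<in> {0..2*pi}"
    show "\<bar>f x - g (cis x)\<bar> < e" using g(2)[of "cis x"] F[OF x] by simp
  qed
qed

section \<open>Orthogonality relations and uniqueness of Fourier coefficients\<close>

lemma has_integral_cos_int:
  "((\<lambda>x. cos (of_int n * x)) has_integral (if n = 0 then 2 * pi else 0)) {0..2*pi}"
proof (cases "n = 0")
  case True
  then show ?thesis using has_integral_const_real[of "1::real" 0 "2*pi"] by simp
next
  case False
  have "((\<lambda>x. cos (of_int n * x)) has_integral (sin (of_int n * (2*pi)) / of_int n - sin (of_int n * 0) / of_int n)) {0..2*pi}"
    by (rule fundamental_theorem_of_calculus)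
       (use False in \<open>auto intro!: derivative_eq_intros simp: has_real_derivative_iff_has_vector_derivative[symmetric]\<close>)
  moreover have "sin (of_int n * (2*pi)) = 0" by (metis mult.commute mult.assoc sin_int_2pin mult.left_commute)
  ultimately show ?thesis using False by simp
qed

lemma has_integral_sin_int: "((\<lambda>x. sin (of_int n * x)) has_integral 0) {0..2*pi}"
proof (cases "n = 0")
  case False
  have "((\<lambda>x. sin (of_int n * x)) has_integral (- cos (of_int n * (2*pi)) / of_int n - (- cos (of_int n * 0) / of_int n))) {0..2*pi}"
    by (rule fundamental_theorem_of_calculus)
       (use False in \<open>auto intro!: derivative_eq_intros simp: has_real_derivative_iff_has_vector_derivative[symmetric]\<close>)
  moreover have "cos (of_int n * (2*pi)) = 1" by (metis mult.commute cos_int_2pin)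
  ultimately show ?thesis using False by simp
qed simp

lemma has_integral_sin_cos:
  "((\<lambda>x. sin (real m * x) * cos (real n * x)) has_integral 0) {0..2*pi}"
proof -
  show ?thesis unfolding trig_product_to_sum_nat
    using has_integral_add[OF has_integral_mult_right[OF has_integral_sin_int[of "int m + int n"], of "1/2"]
      has_integral_mult_right[OF has_integral_sin_int[of "int m - int n"], of "1/2"]] by (simp del: of_int_add of_int_diff)
qed

lemma has_integral_cos_cos:
  assumes "m > 0 \<or> n > 0"
  shows "((\<lambda>x. cos (real m * x) * cos (real n * x)) has_integral (if m = n then pi else 0)) {0..2*pi}"
proof -
  show ?thesis unfolding trig_product_to_sum_nat
    using has_integral_add[OF has_integral_mult_right[OF has_integral_cos_int[of "int m - int n"], of "1/2"]
      has_integral_mult_right[OF has_integral_cos_int[of "int m + int n"], of "1/2"]] assms by (auto simp del: of_int_add of_int_diff split: if_splits)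
qed

lemma has_integral_sin_sin:
  assumes "m > 0 \<or> n > 0"
  shows "((\<lambda>x. sin (real m * x) * sin (real n * x)) has_integral (if m = n then pi else 0)) {0..2*pi}"
proof -
  show ?thesis unfolding trig_product_to_sum_nat
    using has_integral_add[OF has_integral_mult_right[OF has_integral_cos_int[of "int m - int n"], of "1/2"]
      has_integral_mult_right[OF has_integral_cos_int[of "int m + int n"], of "-1/2"]] assms by (auto simp del: of_int_add of_int_diff split: if_splits)
qed

text \<open>\<open>f\<close> is orthogonal to every trigonometric polynomial g. If g is within e of
  \<open>f\<close>, the integral of f^2 equals that of f * (f - g), hence is at most e times the
  integral of the modulus of \<open>f\<close>. So it is 0, and continuity gives the pointwise
  claim.\<close>

lemma fourier_uniqueness:
  fixes f :: "real \<Rightarrow> real"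
  assumes f: "continuous_on {0..2*pi} f" and per: "f 0 = f (2*pi)"
    and c: "\<And>k. ((\<lambda>x. f x * cos (real k * x)) has_integral 0) {0..2*pi}"
    and s: "\<And>k. ((\<lambda>x. f x * sin (real k * x)) has_integral 0) {0..2*pi}"
    and x: "x \<in> {0..2*pi}"
  shows "f x = 0"
proof -
  have orth: "((\<lambda>x. f x * g x) has_integral 0) {0..2*pi}" if "trig_poly g" for g
    using that
  proof (induction rule: trig_poly.induct)
    case (cmult g a)
    then show ?case using has_integral_mult_right[of "\<lambda>x. f x * g x" 0 _ a] by (simp add: mult_ac)
  next
    case (add g h)
    then show ?case using has_integral_add[of "\<lambda>x. f x * g x" 0 _ "\<lambda>x. f x * h x" 0] by (simp add: distrib_left)
  qed (use c s in auto)
  define K where "K = integral {0..2*pi} (\<lambda>x. \<bar>f x\<bar>)"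
  define J where "J = integral {0..2*pi} (\<lambda>x. f x * f x)"
  have cf: "continuous_on {0..2*pi} (\<lambda>x. f x * f x)" by (intro continuous_intros f)
  have K: "K \<ge> 0" unfolding K_def by (rule integral_nonneg) (auto intro!: integrable_continuous_real continuous_intros f)
  have Je: "J \<le> e * K" if e: "e > 0" for e
  proof -
    obtain g where g: "trig_poly g" "\<And>x. x \<in> {0..2*pi} \<Longrightarrow> \<bar>f x - g x\<bar> < e"
      using trig_poly_approx[OF f per e] by blast
    note cg = trig_poly_continuous[OF g(1)]
    have "J = integral {0..2*pi} (\<lambda>x. f x * f x) - integral {0..2*pi} (\<lambda>x. f x * g x)"
      using orth[OF g(1)] by (simp add: J_def integral_unique)
    also have "\<dots> = integral {0..2*pi} (\<lambda>x. f x * f x - f x * g x)"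
      by (rule integral_diff[symmetric]) (auto intro!: integrable_continuous_real continuous_intros f cg)
    also have "\<dots> \<le> integral {0..2*pi} (\<lambda>x. e * \<bar>f x\<bar>)"
    proof (rule integral_le)
      fix x assume x: "x \<in> {0..2*pi}"
      have "f x * f x - f x * g x = f x * (f x - g x)" by (simp add: algebra_simps)
      also have "\<dots> \<le> \<bar>f x\<bar> * \<bar>f x - g x\<bar>" by (metis abs_ge_self abs_mult)
      also have "\<dots> \<le> \<bar>f x\<bar> * e" using g(2)[OF x] by (intro mult_left_mono) auto
      finally show "f x * f x - f x * g x \<le> e * \<bar>f x\<bar>" by (simp add: mult.commute)
    qed (auto intro!: integrable_continuous_real continuous_intros f cg)
    also have "\<dots> = e * K" by (simp add: K_def)
    finally show ?thesis .
  qed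
  have "J \<le> 0"
  proof (rule ccontr)
    assume "\<not> J \<le> 0"
    then have J: "J > 0" by simp
    have "J \<le> J / (2 * (K + 1)) * K" using J K by (intro Je) auto
    also have "\<dots> \<le> J / 2" using J K by (simp add: field_simps)
    finally show False using J by simp
  qed
  moreover have "J \<ge> 0" unfolding J_def by (rule integral_nonneg) (auto intro!: integrable_continuous_real cf)
  ultimately have "(\<lambda>x. f x * f x) integrable_on {0..2*pi}" "integral {0..2*pi} (\<lambda>x. f x * f x) = 0"
    by (auto simp: J_def intro!: integrable_continuous_real cf)
  then have "((\<lambda>x. f x * f x) has_integral 0) {0..2*pi}" by (metis integrable_integral)
  then have "((\<lambda>x. f x * f x) has_integral 0) (cbox 0 (2*pi))" by simp
  from has_integral_0_cbox_imp_0[OF _ _ this _] cf x have "f x * f x = 0"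
    using pi_gt_zero by (auto simp del: mult_eq_0_iff simp: not_le)
  then show ?thesis by simp
qed

section \<open>The Fourier series of a cubic polynomial\<close>

lemma summable_inverse_cubes: "summable (\<lambda>n. 1 / real n ^ 3)"
  using inverse_power_summable[of 3, where ?'a=real] by (simp add: inverse_eq_divide)

text \<open>Both sides have the same Fourier coefficients: the series by termwise integration, which
  uniform convergence permits, and the cubic by explicit antiderivatives. Uniqueness identifies
  them. The term at n = 0 is 0 through division by zero.\<close>

lemma sin_cubes_series:
  assumes x: "x \<in> {0..2*pi}"
  shows "(\<lambda>n. sin (real n * x) / real n ^ 3) sums (pi\<^sup>2 * x / 6 - pi * x\<^sup>2 / 4 + x ^ 3 / 12)"
proof -
  define P where "P x = pi\<^sup>2 * x / 6 - pi * x\<^sup>2 / 4 + x ^ 3 / 12" for x :: real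
  define S where "S x = (\<Sum>n. sin (real n * x) / real n ^ 3)" for x
  have ul: "uniform_limit {0..2*pi} (\<lambda>N x. \<Sum>n<N. sin (real n * x) / real n ^ 3) S sequentially"
    unfolding S_def
    by (rule Weierstrass_m_test[OF _ summable_inverse_cubes]) (auto intro!: divide_right_mono)
  have cS: "continuous_on {0..2*pi} S"
    by (rule uniform_limit_theorem[OF _ ul]) (auto simp: divide_inverse intro!: always_eventually continuous_intros)
  have intS: "((\<lambda>x. S x * t x) has_integral c) {0..2*pi}"
    if t: "continuous_on {0..2*pi} t" "\<And>x. \<bar>t x\<bar> \<le> 1"
      and I: "\<And>n. ((\<lambda>x. sin (real n * x) * t x) has_integral d n) {0..2*pi}"
      and d: "(\<lambda>N. \<Sum>n<N. d n / real n ^ 3) \<longlonglongrightarrow> c" for t d c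
  proof -
    have bt: "bounded (t ` {0..2*pi})" using t(2) by (auto simp: bounded_iff)
    have bS: "bounded (S ` {0..2*pi})" using compact_continuous_image[OF cS] compact_imp_bounded by blast
    have ul': "uniform_limit {0..2*pi} (\<lambda>N x. (\<Sum>n<N. sin (real n * x) / real n ^ 3) * t x) (\<lambda>x. S x * t x) sequentially"
      by (rule uniform_lim_mult[OF ul uniform_limit_const]) (use bt bS in auto)
    have I': "((\<lambda>x. (\<Sum>n<N. sin (real n * x) / real n ^ 3) * t x) has_integral (\<Sum>n<N. d n / real n ^ 3)) {0..2*pi}" for N
    proof -
      have "((\<lambda>x. \<Sum>n<N. (1 / real n ^ 3) * (sin (real n * x) * t x)) has_integral (\<Sum>n<N. (1 / real n ^ 3) * d n)) {0..2*pi}"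
        by (intro has_integral_sum has_integral_mult_right I) simp
      then show ?thesis by (simp add: sum_distrib_right)
    qed
    obtain J where J: "((\<lambda>x. S x * t x) has_integral J) {0..2*pi}" "(\<lambda>N. \<Sum>n<N. d n / real n ^ 3) \<longlonglongrightarrow> J"
    proof -
      have cont: "continuous_on {0..2*pi} (\<lambda>x. (\<Sum>n<N. sin (real n * x) / real n ^ 3) * t x)" for N
        using t(1) by (auto simp: divide_inverse intro!: continuous_intros)
      obtain I J where IJ: "\<And>N. ((\<lambda>x. (\<Sum>n<N. sin (real n * x) / real n ^ 3) * t x) has_integral I N) {0..2*pi}"
        "((\<lambda>x. S x * t x) has_integral J) {0..2*pi}" "(I \<longlongrightarrow> J) sequentially"
        by (rule uniform_limit_integral[OF ul' cont trivial_limit_sequentially]) blast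
      have "I = (\<lambda>N. \<Sum>n<N. d n / real n ^ 3)"
        by (rule ext) (rule has_integral_unique[OF IJ(1) I'])
      with IJ(3) have "(\<lambda>N. \<Sum>n<N. d n / real n ^ 3) \<longlonglongrightarrow> J" by simp
      then show thesis by (rule that[OF IJ(2)])
    qed
    then show ?thesis using LIMSEQ_unique[OF d J(2)] by simp
  qed
  have cP: "continuous_on A P" for A unfolding P_def by (intro continuous_intros) auto
  have two: "cos (real k * (2 * pi)) = 1" "sin (real k * (2 * pi)) = 0" for k
    by (metis mult.commute cos_2npi mult.assoc, metis mult.commute sin_2npi mult.assoc)
  have Psin: "((\<lambda>x. P x * sin (real k * x)) has_integral pi / real k ^ 3) {0..2*pi}" if "k > 0" for k
  proof -
    \<comment> \<open>Repeated integration by parts: the polynomial factors are P and its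
      derivatives, the last being the constant 1/2.\<close>
    define A where "A x = - P x * cos (real k * x) / k + (pi\<^sup>2 / 6 - pi * x / 2 + x\<^sup>2 / 4) * sin (real k * x) / k ^ 2
       + (x / 2 - pi / 2) * cos (real k * x) / k ^ 3 - sin (real k * x) / (2 * k ^ 4)" for x :: real
    have "((\<lambda>x. P x * sin (real k * x)) has_integral A (2*pi) - A 0) {0..2*pi}"
    proof (rule fundamental_theorem_of_calculus)
      fix x assume "x \<in> {0..2*pi}"
      have "(A has_real_derivative P x * sin (real k * x)) (at x within {0..2*pi})"
        unfolding A_def P_def using that
        by (auto intro!: derivative_eq_intros simp: field_simps power2_eq_square power3_eq_cube power4_eq_xxxx)
      then show "(A has_vector_derivative P x * sin (real k * x)) (at x within {0..2*pi})"
        by (simp add: has_real_derivative_iff_has_vector_derivative)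
    qed simp
    moreover have "A (2*pi) - A 0 = pi / real k ^ 3"
      unfolding A_def P_def two by (simp add: field_simps power2_eq_square power3_eq_cube)
    ultimately show ?thesis by simp
  qed
  have Pcos: "((\<lambda>x. P x * cos (real k * x)) has_integral 0) {0..2*pi}" for k
  proof (cases "k = 0")
    case True
    define A where "A x = pi\<^sup>2 * x\<^sup>2 / 12 - pi * x ^ 3 / 12 + x ^ 4 / 48" for x :: real
    have "(P has_integral A (2*pi) - A 0) {0..2*pi}"
    proof (rule fundamental_theorem_of_calculus)
      fix x assume "x \<in> {0..2*pi}"
      have "(A has_real_derivative P x) (at x within {0..2*pi})"
        unfolding A_def P_def
        by (auto intro!: derivative_eq_intros simp: field_simps power2_eq_square power3_eq_cube)
      then show "(A has_vector_derivative P x) (at x within {0..2*pi})"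
        by (simp add: has_real_derivative_iff_has_vector_derivative)
    qed simp
    moreover have "A (2*pi) - A 0 = 0"
      unfolding A_def by (simp add: field_simps power2_eq_square power3_eq_cube power4_eq_xxxx)
    ultimately show ?thesis using True by simp
  next
    case False
    define A where "A x = P x * sin (real k * x) / k + (pi\<^sup>2 / 6 - pi * x / 2 + x\<^sup>2 / 4) * cos (real k * x) / k ^ 2
       - (x / 2 - pi / 2) * sin (real k * x) / k ^ 3 - cos (real k * x) / (2 * k ^ 4)" for x :: real
    have "((\<lambda>x. P x * cos (real k * x)) has_integral A (2*pi) - A 0) {0..2*pi}"
    proof (rule fundamental_theorem_of_calculus)
      fix x assume "x \<in> {0..2*pi}"
      have "(A has_real_derivative P x * cos (real k * x)) (at x within {0..2*pi})"
        unfolding A_def P_def using False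
        by (auto intro!: derivative_eq_intros simp: field_simps power2_eq_square power3_eq_cube power4_eq_xxxx)
      then show "(A has_vector_derivative P x * cos (real k * x)) (at x within {0..2*pi})"
        by (simp add: has_real_derivative_iff_has_vector_derivative)
    qed simp
    moreover have "A (2*pi) - A 0 = 0"
      unfolding A_def P_def two by (simp add: field_simps power2_eq_square power3_eq_cube)
    ultimately show ?thesis by simp
  qed
  have Scos: "((\<lambda>x. S x * cos (real k * x)) has_integral 0) {0..2*pi}" for k
    by (rule intS[where d="\<lambda>_. 0"]) (auto intro!: continuous_intros has_integral_sin_cos)
  have Ssin: "((\<lambda>x. S x * sin (real k * x)) has_integral pi / real k ^ 3) {0..2*pi}" if "k > 0" for k
  proof (rule intS[where d="\<lambda>n. if n = k then pi else 0"])
    have "(\<Sum>n<N. (if n = k then pi else 0) / real n ^ 3) = (if k < N then pi / real k ^ 3 else 0)" for N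
      by (simp add: if_distrib[of "\<lambda>a. a / _"] sum.delta' cong: if_cong)
    then show "(\<lambda>N. \<Sum>n<N. (if n = k then pi else 0) / real n ^ 3) \<longlonglongrightarrow> pi / real k ^ 3"
      by (auto intro!: tendsto_eventually eventually_at_top_linorderI[of "Suc k"])
    show "((\<lambda>x. sin (real n * x) * sin (real k * x)) has_integral (if n = k then pi else 0)) {0..2*pi}" for n
      by (rule has_integral_sin_sin) (use that in simp)
  qed (auto intro!: continuous_intros)
  have "S x - P x = 0"
  proof (rule fourier_uniqueness[of "\<lambda>x. S x - P x", OF _ _ _ _ x])
    show "continuous_on {0..2*pi} (\<lambda>x. S x - P x)" by (intro continuous_intros cS cP)
    have "S 0 = 0" "S (2*pi) = 0" unfolding S_def two by simp_all
    moreover have "P 0 = 0" "P (2*pi) = 0"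
      by (simp_all add: P_def field_simps power2_eq_square power3_eq_cube)
    ultimately show "S 0 - P 0 = S (2*pi) - P (2*pi)" by simp
    show "((\<lambda>x. (S x - P x) * cos (real k * x)) has_integral 0) {0..2*pi}" for k
      using has_integral_diff[OF Scos[of k] Pcos[of k]] by (simp add: algebra_simps)
    show "((\<lambda>x. (S x - P x) * sin (real k * x)) has_integral 0) {0..2*pi}" for k
      using has_integral_diff[OF Ssin[of k] Psin[of k]] by (cases "k = 0") (auto simp: algebra_simps)
  qed
  moreover have "summable (\<lambda>n. sin (real n * x) / real n ^ 3)"
    by (rule summable_comparison_test'[OF summable_inverse_cubes, of 0]) (auto intro!: divide_right_mono)
  ultimately show ?thesis unfolding S_def P_def by (simp add: sums_iff)
qed

section \<open>Averaging the symbols over dilations\<close>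

text \<open>The limit of a single summand of \<open>shift_symbol\<close> as the grid is refined: s
  is the angle \<open>2 * pi * k / 4 ^ m * 4 ^ i\<close>, and 1 - cos s = 2 * sin^2 (s / 2) absorbs
  the remaining constants.\<close>

definition shift_profile :: "real \<Rightarrow> real" where
  "shift_profile s = sin s ^ 3 * (1 - cos s) / s\<^sup>2"

lemma shift_profile_minus: "shift_profile (- s) = - shift_profile s"
  by (simp add: shift_profile_def)

text \<open>Useful for small s: with angles decreasing like 4^(-l) it gives convergence over the
  scales.\<close>

lemma shift_profile_le_linear: "\<bar>shift_profile s\<bar> \<le> 2 * \<bar>s\<bar>"
proof (cases "s = 0")
  case False
  have "\<bar>sin s ^ 3 * (1 - cos s)\<bar> \<le> \<bar>s\<bar> ^ 3 * 2"
    unfolding abs_mult power_abs using cos_ge_minus_one[of s] abs_sin_x_le_abs_x[of s]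
    by (intro mult_mono power_mono) auto
  then have "\<bar>shift_profile s\<bar> \<le> \<bar>s\<bar> ^ 3 * 2 / s\<^sup>2"
    unfolding shift_profile_def abs_divide by (simp add: divide_right_mono)
  also have "\<bar>s\<bar> ^ 3 = \<bar>s\<bar> * s\<^sup>2" by (simp add: power3_eq_cube power2_eq_square)
  finally show ?thesis using False by simp
qed (simp add: shift_profile_def)

text \<open>Useful for large s: together with the weight 1 / r it gives terms of order r^(-3) over
  the dilations.\<close>

lemma shift_profile_le_inverse_square: "\<bar>shift_profile s\<bar> \<le> 2 / s\<^sup>2"
proof -
  have "\<bar>sin s ^ 3 * (1 - cos s)\<bar> \<le> 1 ^ 3 * 2"
    unfolding abs_mult power_abs using cos_ge_minus_one[of s]
    by (intro mult_mono power_mono) auto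
  then show ?thesis by (simp add: shift_profile_def abs_mult divide_right_mono)
qed

text \<open>The even terms of the full series at x are one eighth of the series at 2 * x, which must
  still lie in [0, 2 * pi]; in the difference the cubic terms cancel.\<close>

lemma odd_sin_cubes_series:
  assumes x: "x \<in> {0..pi}"
  shows "(\<lambda>j. sin (real (2 * j + 1) * x) / real (2 * j + 1) ^ 3) sums (pi\<^sup>2 * x / 8 - pi * x\<^sup>2 / 8)"
proof -
  define a where "a n = sin (real n * x) / real n ^ 3" for n
  define P where "P x = pi\<^sup>2 * x / 6 - pi * x\<^sup>2 / 4 + x ^ 3 / 12" for x :: real
  have "a sums P x" unfolding a_def P_def using x by (intro sin_cubes_series) auto
  then have "(\<lambda>n. sum a {n * 2..<n * 2 + 2}) sums P x" by (rule sums_group) simp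
  moreover have "sum a {n * 2..<n * 2 + 2} = a (2 * n) + a (2 * n + 1)" for n
  proof -
    have "{n * 2..<n * 2 + 2} = {2 * n, 2 * n + 1}" by auto
    then show ?thesis by simp
  qed
  ultimately have all: "(\<lambda>n. a (2 * n) + a (2 * n + 1)) sums P x" by simp
  have "(\<lambda>n. sin (real n * (2 * x)) / real n ^ 3) sums P (2 * x)"
    unfolding P_def using x by (intro sin_cubes_series) auto
  then have "(\<lambda>n. (1/8) * (sin (real n * (2 * x)) / real n ^ 3)) sums ((1/8) * P (2 * x))"
    by (rule sums_mult)
  moreover have "(1/8) * (sin (real n * (2 * x)) / real n ^ 3) = a (2 * n)" for n
    by (simp add: a_def power_mult_distrib mult_ac)
  ultimately have "(\<lambda>n. a (2 * n)) sums ((1/8) * P (2 * x))" by simp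
  from sums_diff[OF all this] have "(\<lambda>n. a (2 * n + 1)) sums (P x - (1/8) * P (2 * x))" by simp
  moreover have "P x - (1/8) * P (2 * x) = pi\<^sup>2 * x / 8 - pi * x\<^sup>2 / 8"
    by (simp add: P_def field_simps power2_eq_square power3_eq_cube)
  ultimately show ?thesis by (simp add: a_def)
qed

text \<open>The sum over odd dilations does not depend on \<open>t\<close>: this is where the dilation average of the
  dyadic operators turns into the Hilbert transform.\<close>

lemma shift_profile_series:
  assumes t: "0 < t" "t \<le> pi / 4"
  shows "(\<lambda>j. shift_profile (real (2 * j + 1) * t) / real (2 * j + 1)) sums (pi / 16)"
proof -
  define p where "p x = pi\<^sup>2 * x / 8 - pi * x\<^sup>2 / 8" for x :: real
  \<comment> \<open>The bound on \<open>t\<close> keeps t, 2 * t, 3 * t and 4 * t in [0, pi], where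
    the odd series is the quadratic \<open>p\<close>.\<close>
  have *: "(\<lambda>j. sin (real (2 * j + 1) * (c * t)) / real (2 * j + 1) ^ 3) sums p (c * t)" if "0 \<le> c" "c \<le> 4" for c
    unfolding p_def
  proof (rule odd_sin_cubes_series)
    have "c * t \<le> 4 * (pi / 4)" using that t by (intro mult_mono) auto
    then show "c * t \<in> {0..pi}" using that t by simp
  qed
  \<comment> \<open>The coefficients are those of sin^3 s * (1 - cos s) = (3/4) sin s - (1/4) sin 3s
    - (1/4) sin 2s + (1/8) sin 4s.\<close>
  have A: "(\<lambda>j. (1 / t\<^sup>2) * ((3/4) * (sin (real (2 * j + 1) * (1 * t)) / real (2 * j + 1) ^ 3)
      - (1/4) * (sin (real (2 * j + 1) * (3 * t)) / real (2 * j + 1) ^ 3)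
      - (1/4) * (sin (real (2 * j + 1) * (2 * t)) / real (2 * j + 1) ^ 3)
      + (1/8) * (sin (real (2 * j + 1) * (4 * t)) / real (2 * j + 1) ^ 3)))
     sums ((1 / t\<^sup>2) * ((3/4) * p (1 * t) - (1/4) * p (3 * t) - (1/4) * p (2 * t) + (1/8) * p (4 * t)))"
    by (intro sums_mult sums_add sums_diff *) auto
  \<comment> \<open>The linear terms cancel, as 3/4 - 3/4 - 2/4 + 4/8 = 0; the quadratic ones give
    3/4 - 9/4 - 1 + 2 = -1/2, and -1/2 times -pi/8 is pi/16.\<close>
  have V: "(1 / t\<^sup>2) * ((3/4) * p (1 * t) - (1/4) * p (3 * t) - (1/4) * p (2 * t) + (1/8) * p (4 * t)) = pi / 16"
    using t by (simp add: p_def field_simps power2_eq_square)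
  have ID: "(1 / t\<^sup>2) * ((3/4) * (sin (r * (1 * t)) / r ^ 3)
      - (1/4) * (sin (r * (3 * t)) / r ^ 3) - (1/4) * (sin (r * (2 * t)) / r ^ 3)
      + (1/8) * (sin (r * (4 * t)) / r ^ 3)) = shift_profile (r * t) / r" if r: "r > 0" for r :: real
  proof -
    define s where "s = r * t"
    have s4: "sin (4 * s) = 4 * sin s * cos s * (1 - 2 * sin s ^ 2)"
      using sin_double[of "2 * s"] sin_double[of s] cos_double_sin[of s] by simp
    have s3: "sin (3 * s) = 3 * sin s - 4 * sin s ^ 3"
    proof -
      have "sin (3 * s) = sin (s + 2 * s)" by (simp add: algebra_simps)
      also have "\<dots> = sin s * (1 - 2 * sin s ^ 2) + cos s * (2 * sin s * cos s)"
        by (simp only: sin_add cos_double_sin sin_double)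
      also have "cos s * (2 * sin s * cos s) = 2 * sin s * (1 - sin s ^ 2)"
        using cos_squared_eq[of s] by (simp add: power2_eq_square)
      finally show ?thesis by (simp add: algebra_simps power2_eq_square power3_eq_cube)
    qed
    have "(3/4) * sin s - (1/4) * sin (3 * s) - (1/4) * sin (2 * s) + (1/8) * sin (4 * s) = sin s ^ 3 * (1 - cos s)"
      unfolding s3 s4 sin_double by (simp add: algebra_simps power2_eq_square power3_eq_cube)
    note num = this
    have args: "r * (3 * t) = 3 * s" "r * (2 * t) = 2 * s" "r * (4 * t) = 4 * s" "r * (1 * t) = s"
      by (simp_all add: s_def)
    have "(1 / t\<^sup>2) * ((3/4) * (sin s / r ^ 3) - (1/4) * (sin (3 * s) / r ^ 3) - (1/4) * (sin (2 * s) / r ^ 3) + (1/8) * (sin (4 * s) / r ^ 3))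
       = (1 / t\<^sup>2) * (((3/4) * sin s - (1/4) * sin (3 * s) - (1/4) * sin (2 * s) + (1/8) * sin (4 * s)) / r ^ 3)"
      by (simp only: add_divide_distrib diff_divide_distrib times_divide_eq_right)
    also have "\<dots> = shift_profile s / r"
      unfolding num shift_profile_def using r t by (simp add: s_def power_mult_distrib power2_eq_square power3_eq_cube)
    finally show ?thesis unfolding args s_def[symmetric] .
  qed
  have pos: "real (2 * j + 1) > 0" for j by simp
  show ?thesis using A by (simp only: ID[OF pos] V)
qed

text \<open>Telescoping: 1 / (2y + 1)^3 is at most (1/16) * (1 / y^2 - 1 / (y + 1)^2), because 4y(y
  + 1) \<le> (2y + 1)^2.\<close>

lemma odd_cubes_tail:
  assumes R: "R > 0"
  shows "summable (\<lambda>j. 1 / real (2 * j + 1) ^ 3)"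
    and "(\<Sum>j. 1 / real (2 * (j + R) + 1) ^ 3) \<le> 1 / (16 * (real R)\<^sup>2)"
proof -
  have part: "(\<Sum>j<n. 1 / real (2 * (j + R) + 1) ^ 3) \<le> (1 / 16) * (1 / (real R)\<^sup>2 - 1 / (real (R + n))\<^sup>2)" for n
  proof (induction n)
    case (Suc n)
    define y where "y = real (n + R)"
    have y: "y > 0" using R by (simp add: y_def)
    have "16 * (y\<^sup>2 * (y + 1)\<^sup>2) \<le> (2 * y + 1) ^ 4"
    proof -
      have "0 \<le> 4 * y * (y + 1)" using y by simp
      then have "(4 * y * (y + 1))\<^sup>2 \<le> ((2 * y + 1)\<^sup>2)\<^sup>2"
        by (intro power_mono) (auto simp: power2_eq_square algebra_simps)
      then show ?thesis by (simp add: power_mult_distrib)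
    qed
    moreover have "(2 * y + 1) ^ 4 = (2 * y + 1) ^ 3 * (2 * y + 1)" by (simp add: power_numeral_reduce)
    ultimately have "1 / (2 * y + 1) ^ 3 \<le> (1 / 16) * ((2 * y + 1) / (y\<^sup>2 * (y + 1)\<^sup>2))"
      using y by (simp add: divide_simps mult_ac)
    also have "(2 * y + 1) / (y\<^sup>2 * (y + 1)\<^sup>2) = 1 / y\<^sup>2 - 1 / (y + 1)\<^sup>2"
      using y by (simp add: divide_simps) (simp add: power2_eq_square algebra_simps)
    finally have "1 / (2 * y + 1) ^ 3 \<le> (1 / 16) * (1 / y\<^sup>2 - 1 / (y + 1)\<^sup>2)" .
    then show ?case using Suc by (simp add: y_def add_ac algebra_simps)
  qed simp
  then have part': "(\<Sum>j<n. 1 / real (2 * (j + R) + 1) ^ 3) \<le> 1 / (16 * (real R)\<^sup>2)" for n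
    by (rule order_trans) (simp add: field_simps)
  have s: "summable (\<lambda>j. 1 / real (2 * (j + R) + 1) ^ 3)"
    by (rule bounded_imp_summable[of _ "1 / (16 * (real R)\<^sup>2)"])
       (use part'[of "Suc _"] in \<open>auto simp: lessThan_Suc_atMost\<close>)
  then show "summable (\<lambda>j. 1 / real (2 * j + 1) ^ 3)" by (subst (asm) summable_iff_shift)
  show "(\<Sum>j. 1 / real (2 * (j + R) + 1) ^ 3) \<le> 1 / (16 * (real R)\<^sup>2)"
    by (rule suminf_le_const[OF s part'])
qed

text \<open>The symbol on an infinitely fine grid. The scale is counted from the coarse end, l = m -
  1 - i, so that each term is independent of m.\<close>

definition profile_sum :: "real \<Rightarrow> real" where
  "profile_sum k = (\<Sum>l. shift_profile (2 * pi * k / 4 ^ Suc l))"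

lemma summable_profile: "summable (\<lambda>l. shift_profile (2 * pi * k / 4 ^ Suc l))"
proof (rule summable_comparison_test')
  show "summable (\<lambda>l. \<bar>pi * k\<bar> * (1/4) ^ l)" by (intro summable_mult summable_geometric) simp
  show "norm (shift_profile (2 * pi * k / 4 ^ Suc l)) \<le> \<bar>pi * k\<bar> * (1/4) ^ l" for l
  proof -
    have "\<bar>shift_profile (2 * pi * k / 4 ^ Suc l)\<bar> \<le> 2 * \<bar>2 * pi * k / 4 ^ Suc l\<bar>"
      by (rule shift_profile_le_linear)
    also have "2 * \<bar>2 * pi * k / 4 ^ Suc l\<bar> = \<bar>pi * k\<bar> * (1/4) ^ l"
      by (simp add: abs_mult power_one_over)
    finally show ?thesis by simp
  qed
qed

text \<open>The sum over odd r < 4^a and over all scales l is exchanged. For l < a the sum over r is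
  nearly complete, and its limit is pi/16 once l is large; for l \<ge> a the linear bound makes
  everything small. The double sum is therefore a * pi/16 up to an error independent of a, and
  division by a removes the error.\<close>

lemma profile_average_pos:
  fixes k :: real
  assumes k: "k \<ge> 1"
  shows "(\<lambda>a. (\<Sum>j<4 ^ a div 2. profile_sum (real (2 * j + 1) * k) / real (2 * j + 1)) / real a) \<longlonglongrightarrow> pi / 16"
proof -
  define t where "t l = 2 * pi * k / 4 ^ Suc l" for l
  have t: "t l > 0" for l using k by (simp add: t_def)
  define G where "G l j = shift_profile (real (2 * j + 1) * t l) / real (2 * j + 1)" for l j
  have Gle: "\<bar>G l j\<bar> \<le> (2 / (t l)\<^sup>2) * (1 / real (2 * j + 1) ^ 3)" for l j
  proof -
    have "\<bar>G l j\<bar> \<le> (2 / (real (2 * j + 1) * t l)\<^sup>2) / real (2 * j + 1)"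
      unfolding G_def abs_divide using shift_profile_le_inverse_square by (intro divide_right_mono frac_le) auto
    also have "\<dots> = (2 / (t l)\<^sup>2) * (1 / real (2 * j + 1) ^ 3)"
      by (simp add: power_mult_distrib power2_eq_square power3_eq_cube)
    finally show ?thesis .
  qed
  have Glin: "\<bar>G l j\<bar> \<le> 2 * t l" for l j
  proof -
    have "\<bar>G l j\<bar> \<le> (2 * \<bar>real (2 * j + 1) * t l\<bar>) / real (2 * j + 1)"
      unfolding G_def abs_divide using shift_profile_le_linear by (intro frac_le) auto
    also have "\<dots> = 2 * t l" using t[of l] by (simp add: abs_mult)
    finally show ?thesis .
  qed
  have sG: "summable (G l)" for l
    by (rule summable_comparison_test'[OF summable_mult[OF odd_cubes_tail(1)[OF zero_less_one], of "2 / (t l)\<^sup>2"], of 0])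
      (simp only: real_norm_def Gle)
  define s where "s l = (\<Sum>j. G l j)" for l
  obtain L where L: "\<And>l. l \<ge> L \<Longrightarrow> t l \<le> pi / 4"
  proof -
    have "t \<longlonglongrightarrow> 0"
    proof -
      have "(\<lambda>l. (2 * pi * k / 4) * (1/4) ^ l) \<longlonglongrightarrow> (2 * pi * k / 4) * 0"
        by (intro tendsto_mult tendsto_const LIMSEQ_realpow_zero) auto
      moreover have "t = (\<lambda>l. (2 * pi * k / 4) * (1/4) ^ l)"
        by (rule ext) (simp add: t_def power_one_over)
      ultimately show ?thesis by simp
    qed
    then have "\<forall>\<^sub>F l in sequentially. t l < pi / 4" by (rule order_tendstoD) simp
    then show thesis using that unfolding eventually_sequentially by (metis less_imp_le)
  qed
  have sL: "s l = pi / 16" if "l \<ge> L" for l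
    using shift_profile_series[OF t L[OF that]] unfolding s_def G_def by (simp add: sums_iff)
  define E where "E a l = (\<Sum>j<4 ^ a div 2. G l j)" for a l
  \<comment> \<open>The tail of the cubes is of order 16^(-a), and the inverse square bound
    contributes 16^l; the remaining factor is at most 1 because k \<ge> 1. These errors sum to at
    most 1 over l < a.\<close>
  have near: "\<bar>E a l - s l\<bar> \<le> 16 ^ l / 16 ^ a" if a: "a \<ge> 1" for a l
  proof -
    define R :: nat where "R = 4 ^ a div 2"
    have R2: "2 * R = 4 ^ a" using a unfolding R_def by (cases a) auto
    then have R: "R > 0" by (cases R) auto
    have "s l - E a l = (\<Sum>j. G l (j + R))"
      unfolding s_def E_def R_def[symmetric] by (simp add: suminf_minus_initial_segment[OF sG])
    also have "\<bar>\<dots>\<bar> \<le> (\<Sum>j. (2 / (t l)\<^sup>2) * (1 / real (2 * (j + R) + 1) ^ 3))"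
    proof -
      have sR: "summable (\<lambda>j. (2 / (t l)\<^sup>2) * (1 / real (2 * (j + R) + 1) ^ 3))"
        using odd_cubes_tail(1)[OF R] by (intro summable_mult) (subst summable_iff_shift)
      show ?thesis
        by (rule norm_suminf_le[OF _ sR, of "\<lambda>j. G l (j + R)", unfolded real_norm_def]) (rule Gle)
    qed
    also have "\<dots> = (2 / (t l)\<^sup>2) * (\<Sum>j. 1 / real (2 * (j + R) + 1) ^ 3)"
      using odd_cubes_tail(1)[OF R] by (intro suminf_mult) (subst summable_iff_shift)
    also have "\<dots> \<le> (2 / (t l)\<^sup>2) * (1 / (16 * (real R)\<^sup>2))"
      by (intro mult_left_mono odd_cubes_tail(2)[OF R]) auto
    also have "\<dots> \<le> 16 ^ l / 16 ^ a"
    proof -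
      have rR: "real R = 4 ^ a / 2" using R2 by (metis nonzero_mult_div_cancel_left of_nat_mult of_nat_numeral of_nat_power zero_neq_numeral)
      have f: "((4::real) ^ n)\<^sup>2 = 16 ^ n" for n by (simp add: power2_eq_square flip: power_mult_distrib)
      have "(2 / (t l)\<^sup>2) * (1 / (16 * (real R)\<^sup>2)) = (16 ^ l / 16 ^ a) * (2 / (pi\<^sup>2 * k\<^sup>2))"
        unfolding t_def rR power_divide power_mult_distrib f by (simp add: field_simps)
      also have "\<dots> \<le> (16 ^ l / 16 ^ a) * 1"
      proof (rule mult_left_mono)
        have "2 * 1 \<le> pi\<^sup>2 * k\<^sup>2"
        proof (rule mult_mono)
          show "2 \<le> pi\<^sup>2" using mult_mono[of 2 pi 1 pi] pi_ge_two by (simp add: power2_eq_square)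
          show "1 \<le> k\<^sup>2" using k by simp
        qed auto
        then show "2 / (pi\<^sup>2 * k\<^sup>2) \<le> 1" using k by simp
      qed simp
      finally show ?thesis by simp
    qed
    finally show ?thesis by (simp add: abs_minus_commute)
  qed
  \<comment> \<open>The three parts are the finitely many scales with another limit, the incomplete
    sums for l < a, and the scales l \<ge> a.\<close>
  define K where "K = (\<Sum>l<L. \<bar>s l - pi / 16\<bar>) + 1 + pi * k"
  have bound: "\<bar>(\<Sum>j<4 ^ a div 2. profile_sum (real (2 * j + 1) * k) / real (2 * j + 1)) - real a * (pi / 16)\<bar> \<le> K"
    if a: "a \<ge> 1" for a
  proof -
    define R :: nat where "R = 4 ^ a div 2"
    have ps: "(\<lambda>l. G l j) sums (profile_sum (real (2 * j + 1) * k) / real (2 * j + 1))" for j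
    proof -
      have "(\<lambda>l. shift_profile (2 * pi * (real (2 * j + 1) * k) / 4 ^ Suc l)) sums profile_sum (real (2 * j + 1) * k)"
        unfolding profile_sum_def by (rule summable_sums[OF summable_profile])
      then have "(\<lambda>l. shift_profile (2 * pi * (real (2 * j + 1) * k) / 4 ^ Suc l) / real (2 * j + 1)) sums (profile_sum (real (2 * j + 1) * k) / real (2 * j + 1))"
        by (rule sums_divide)
      moreover have "2 * pi * (real (2 * j + 1) * k) / 4 ^ Suc l = real (2 * j + 1) * t l" for l
        by (simp add: t_def)
      ultimately show ?thesis by (simp add: G_def)
    qed
    have E: "E a sums (\<Sum>j<R. profile_sum (real (2 * j + 1) * k) / real (2 * j + 1))"
      unfolding E_def R_def by (rule sums_sum) (rule ps)
    define V where "V = (\<Sum>j<R. profile_sum (real (2 * j + 1) * k) / real (2 * j + 1))"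
    have "V = (\<Sum>l<a. E a l) + (\<Sum>l. E a (l + a))"
      using suminf_split_initial_segment[OF sums_summable[OF E], of a] sums_unique[OF E] by (simp add: V_def)
    moreover have "\<bar>\<Sum>l. E a (l + a)\<bar> \<le> pi * k"
    proof -
      have le: "\<bar>E a (l + a)\<bar> \<le> (pi * k / 2) * (1/4) ^ l" for l
      proof -
        have "\<bar>E a (l + a)\<bar> \<le> (\<Sum>j<R. \<bar>G (l + a) j\<bar>)" unfolding E_def R_def by (rule sum_abs)
        also have "\<dots> \<le> (\<Sum>j<R. 2 * t (l + a))" by (intro sum_mono Glin)
        also have "\<dots> = real R * (2 * t (l + a))" by simp
        also have "\<dots> \<le> (4 ^ a / 2) * (2 * t (l + a))"
        proof (intro mult_right_mono)
          have "2 * R \<le> 4 ^ a" by (simp add: R_def)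
          then have "real (2 * R) \<le> real (4 ^ a)" by (rule of_nat_mono)
          then show "real R \<le> 4 ^ a / 2" by simp
        qed (use t[of "l + a"] in simp)
        also have "\<dots> = (pi * k / 2) * (1/4) ^ l"
          by (simp add: t_def power_add power_one_over field_simps)
        finally show ?thesis .
      qed
      have sg: "summable (\<lambda>l. (pi * k / 2) * (1/4 :: real) ^ l)" by (intro summable_mult summable_geometric) simp
      have "\<bar>\<Sum>l. E a (l + a)\<bar> \<le> (\<Sum>l. (pi * k / 2) * (1/4 :: real) ^ l)"
        using norm_suminf_le[OF _ sg, of "\<lambda>l. E a (l + a)"] le by simp
      also have "\<dots> = (pi * k / 2) * (4 / 3)"
        by (subst suminf_mult) (auto simp: suminf_geometric)
      also have "\<dots> \<le> pi * k" using k by simp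
      finally show ?thesis .
    qed
    moreover have "\<bar>(\<Sum>l<a. E a l) - (\<Sum>l<a. s l)\<bar> \<le> 1"
    proof -
      have "\<bar>(\<Sum>l<a. E a l) - (\<Sum>l<a. s l)\<bar> \<le> (\<Sum>l<a. \<bar>E a l - s l\<bar>)"
        by (simp add: sum_subtractf[symmetric] sum_abs)
      also have "\<dots> \<le> (\<Sum>l<a. 16 ^ l / 16 ^ a)" by (intro sum_mono near a)
      also have "\<dots> = ((\<Sum>l<a. 16 ^ l) / 16 ^ a)" by (simp add: sum_divide_distrib)
      also have "\<dots> \<le> 1"
      proof -
        have "(\<Sum>l<a. (16::real) ^ l) * 15 = 16 ^ a - 1" using geometric_sum[of "16::real" a] by simp
        moreover have "(0::real) \<le> 16 ^ a" by simp
        ultimately have "(\<Sum>l<a. (16::real) ^ l) \<le> 16 ^ a" by linarith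
        then show ?thesis by simp
      qed
      finally show ?thesis .
    qed
    moreover have "\<bar>(\<Sum>l<a. s l) - real a * (pi / 16)\<bar> \<le> (\<Sum>l<L. \<bar>s l - pi / 16\<bar>)"
    proof -
      have "(\<Sum>l<a. s l) - real a * (pi / 16) = (\<Sum>l<a. s l - pi / 16)" by (simp add: sum_subtractf)
      also have "\<bar>\<dots>\<bar> \<le> (\<Sum>l<a. \<bar>s l - pi / 16\<bar>)" by (rule sum_abs)
      also have "\<dots> = (\<Sum>l\<in>{..<a} \<inter> {..<L}. \<bar>s l - pi / 16\<bar>)"
      proof (rule sum.mono_neutral_right)
        show "\<forall>l\<in>{..<a} - {..<a} \<inter> {..<L}. \<bar>s l - pi / 16\<bar> = 0"
        proof
          fix l assume "l \<in> {..<a} - {..<a} \<inter> {..<L}"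
          then have "L \<le> l" by auto
          then show "\<bar>s l - pi / 16\<bar> = 0" by (simp add: sL)
        qed
      qed auto
      also have "\<dots> \<le> (\<Sum>l<L. \<bar>s l - pi / 16\<bar>)" by (rule sum_mono2) auto
      finally show ?thesis .
    qed
    ultimately show ?thesis unfolding K_def V_def R_def by linarith
  qed
  show ?thesis
  proof (rule Lim_null[THEN iffD2], rule Lim_null_comparison)
    show "(\<lambda>a. K / real a) \<longlonglongrightarrow> 0"
      by (rule lim_const_over_n)
    show "\<forall>\<^sub>F a in sequentially. norm ((\<Sum>j<4 ^ a div 2. profile_sum (real (2 * j + 1) * k) / real (2 * j + 1)) / real a - pi / 16) \<le> K / real a"
      using eventually_ge_at_top[of 1]
    proof eventually_elim
      case (elim a)
      then have "(\<Sum>j<4 ^ a div 2. profile_sum (real (2 * j + 1) * k) / real (2 * j + 1)) / real a - pi / 16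
         = ((\<Sum>j<4 ^ a div 2. profile_sum (real (2 * j + 1) * k) / real (2 * j + 1)) - real a * (pi / 16)) / real a"
        by (simp add: field_simps)
      then show ?case using bound[of a] elim by (simp add: abs_divide divide_right_mono)
    qed
  qed
qed

lemma profile_sum_minus: "profile_sum (- k) = - profile_sum k"
proof -
  have "profile_sum (- k) = (\<Sum>l. - shift_profile (2 * pi * k / 4 ^ Suc l))"
    unfolding profile_sum_def by (simp only: shift_profile_minus[symmetric] minus_divide_left mult_minus_right)
  also have "\<dots> = - profile_sum k" unfolding profile_sum_def by (rule suminf_minus[OF summable_profile])
  finally show ?thesis .
qed

lemma profile_average:
  fixes k :: int
  shows "(\<lambda>a. (\<Sum>j<4 ^ a div 2. profile_sum (real (2 * j + 1) * k) / real (2 * j + 1)) / real a) \<longlonglongrightarrow> pi / 16 * sgn k"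
proof -
  consider "k \<ge> 1" | "k = 0" | "- k \<ge> 1" by linarith
  then show ?thesis
  proof cases
    case 1 then show ?thesis using profile_average_pos[of "real_of_int k"] by (simp add: sgn_if)
  next
    case 2
    then show ?thesis by (simp add: profile_sum_def shift_profile_def)
  next
    case 3
    have e: "profile_sum (real (2 * j + 1) * real_of_int k) = - profile_sum (real (2 * j + 1) * real_of_int (- k))" for j
      using profile_sum_minus[of "real (2 * j + 1) * real_of_int k"] by simp
    show ?thesis unfolding e
      using tendsto_minus[OF profile_average_pos[of "real_of_int (- k)"]] 3
      by (simp add: sum_negf sgn_if)
  qed
qed

text \<open>With the scales counted from the coarse end, every summand is its profile times the same
  factor (y / sin y)^2, where y = pi * k / 4^m. The factor leaves the sum and tends to 1, so no
  interchange of limits is needed.\<close>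

lemma shift_symbol_limit: "(\<lambda>m. shift_symbol m k) \<longlonglongrightarrow> profile_sum k"
proof (cases "k = 0")
  case True
  then show ?thesis by (simp add: shift_symbol_def profile_sum_def shift_profile_def)
next
  case False
  define y where "y m = pi * real_of_int k / 4 ^ m" for m :: nat
  have y0: "y m \<noteq> 0" for m using False by (simp add: y_def)
  have eq: "shift_symbol m k = (y m / sin (y m))\<^sup>2 * (\<Sum>l<m. shift_profile (2 * pi * k / 4 ^ Suc l))" for m
  proof -
    have "shift_symbol m k = (\<Sum>l<m. sin (2 * pi * k / 4 ^ m * 4 ^ (m - Suc l)) ^ 3 * (sin (2 * pi * k / 4 ^ m * 4 ^ (m - Suc l) / 2))\<^sup>2
      / (2 * (4 ^ (m - Suc l))\<^sup>2 * (sin (2 * pi * k / 4 ^ m / 2))\<^sup>2))"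
      unfolding shift_symbol_def by (rule sum.nat_diff_reindex[symmetric])
    also have "\<dots> = (\<Sum>l<m. (y m / sin (y m))\<^sup>2 * shift_profile (2 * pi * k / 4 ^ Suc l))"
    proof (rule sum.cong[OF refl])
      fix l assume "l \<in> {..<m}"
      define q :: real where "q = 4 ^ (m - Suc l)"
      define \<theta> where "\<theta> = 2 * pi * k / 4 ^ Suc l"
      have q: "q > 0" by (simp add: q_def)
      have e: "(4::real) ^ m = q * 4 ^ Suc l"
        unfolding q_def using \<open>l \<in> {..<m}\<close> by (metis Suc_leI le_add_diff_inverse2 lessThan_iff power_add)
      have w: "2 * pi * k / 4 ^ m * q = \<theta>" "2 * pi * k / 4 ^ m / 2 = y m" "\<theta> = 2 * q * y m"
        unfolding \<theta>_def y_def e using q by (auto simp: field_simps)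
      have c: "1 - cos \<theta> = 2 * (sin (\<theta> / 2))\<^sup>2" using cos_double_sin[of "\<theta> / 2"] by simp
      show "sin (2 * pi * k / 4 ^ m * 4 ^ (m - Suc l)) ^ 3 * (sin (2 * pi * k / 4 ^ m * 4 ^ (m - Suc l) / 2))\<^sup>2
        / (2 * (4 ^ (m - Suc l))\<^sup>2 * (sin (2 * pi * k / 4 ^ m / 2))\<^sup>2) = (y m / sin (y m))\<^sup>2 * shift_profile (2 * pi * k / 4 ^ Suc l)"
        unfolding q_def[symmetric] \<theta>_def[symmetric] shift_profile_def c w(1,2)
        using q y0[of m] by (subst (4) w(3)) (simp add: field_simps power2_eq_square)
    qed
    finally show ?thesis by (simp add: sum_distrib_left)
  qed
  have ylim: "y \<longlonglongrightarrow> 0"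
  proof -
    have "(\<lambda>m. (pi * k) * (1/4) ^ m) \<longlonglongrightarrow> (pi * k) * 0"
      by (intro tendsto_mult tendsto_const LIMSEQ_realpow_zero) auto
    moreover have "y = (\<lambda>m. (pi * k) * (1/4) ^ m)" by (rule ext) (simp add: y_def power_one_over)
    ultimately show ?thesis by simp
  qed
  have "(\<lambda>m. sin (y m) / y m) \<longlonglongrightarrow> 1"
  proof -
    have "((\<lambda>x::real. sin x / x) \<longlongrightarrow> 1) (at 0)"
      using DERIV_sin[of 0] by (simp add: DERIV_def)
    then show ?thesis
      by (rule filterlim_compose) (use ylim y0 in \<open>auto simp: filterlim_at\<close>)
  qed
  then have "(\<lambda>m. inverse (sin (y m) / y m)) \<longlonglongrightarrow> inverse 1" by (rule tendsto_inverse) simp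
  then have "(\<lambda>m. y m / sin (y m)) \<longlonglongrightarrow> 1" by simp
  then have "(\<lambda>m. (y m / sin (y m))\<^sup>2 * (\<Sum>l<m. shift_profile (2 * pi * k / 4 ^ Suc l))) \<longlonglongrightarrow> 1\<^sup>2 * profile_sum k"
    unfolding profile_sum_def by (intro tendsto_mult tendsto_power summable_LIMSEQ summable_profile)
  then show ?thesis by (simp add: eq)
qed

text \<open>The order of choices matters: the number of dilations is fixed first, from K and e; only
  then is the grid refined, which is a limit of finitely many symbols.\<close>

lemma symbol_average_approx:
  fixes K :: "int set"
  assumes K: "finite K" and e: "e > 0"
  obtains a where "a \<ge> 1"
    "\<forall>\<^sub>F m in sequentially. \<forall>k\<in>K. \<bar>(\<Sum>j<4 ^ a div 2. shift_symbol m (int (2 * j + 1) * k) / real (2 * j + 1)) / real a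
       - pi / 16 * sgn k\<bar> < e"
proof -
  define V where "V a k = (\<Sum>j<4 ^ a div 2. profile_sum (real (2 * j + 1) * of_int k) / real (2 * j + 1)) / real a" for a and k :: int
  have "\<forall>\<^sub>F a in sequentially. \<forall>k\<in>K. dist (V a k) (pi / 16 * sgn k) < e / 2"
    using e unfolding V_def by (intro eventually_ball_finite[OF K] ballI tendstoD[OF profile_average]) simp
  then have "\<forall>\<^sub>F a in sequentially. a \<ge> 1 \<and> (\<forall>k\<in>K. dist (V a k) (pi / 16 * sgn k) < e / 2)"
    using eventually_ge_at_top[of 1] by eventually_elim auto
  then obtain a where a: "a \<ge> 1" "\<And>k. k \<in> K \<Longrightarrow> dist (V a k) (pi / 16 * sgn k) < e / 2"
    by (auto dest!: eventually_happens)
  have "\<forall>\<^sub>F m in sequentially. \<forall>k\<in>K. dist ((\<Sum>j<4 ^ a div 2. shift_symbol m (int (2 * j + 1) * k) / real (2 * j + 1)) / real a) (V a k) < e / 2"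
  proof (intro eventually_ball_finite[OF K] ballI tendstoD)
    fix k
    have "(\<lambda>m. shift_symbol m (int (2 * j + 1) * k)) \<longlonglongrightarrow> profile_sum (real (2 * j + 1) * of_int k)" for j
      using shift_symbol_limit[of "int (2 * j + 1) * k"] by simp
    then show "(\<lambda>m. (\<Sum>j<4 ^ a div 2. shift_symbol m (int (2 * j + 1) * k) / real (2 * j + 1)) / real a) \<longlonglongrightarrow> V a k"
      unfolding V_def using a(1) by (intro tendsto_divide tendsto_sum tendsto_const) auto
  qed (use e in simp)
  then have "\<forall>\<^sub>F m in sequentially. \<forall>k\<in>K. \<bar>(\<Sum>j<4 ^ a div 2. shift_symbol m (int (2 * j + 1) * k) / real (2 * j + 1)) / real a
       - pi / 16 * sgn k\<bar> < e"
  proof eventually_elim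
    case (elim m)
    show ?case
    proof
      fix k assume k: "k \<in> K"
      from elim k have "dist ((\<Sum>j<4 ^ a div 2. shift_symbol m (int (2 * j + 1) * k) / real (2 * j + 1)) / real a) (V a k) < e / 2" by blast
      from add_strict_mono[OF this a(2)[OF k]]
      have "dist ((\<Sum>j<4 ^ a div 2. shift_symbol m (int (2 * j + 1) * k) / real (2 * j + 1)) / real a) (pi / 16 * sgn k) < e / 2 + e / 2"
        by (rule le_less_trans[OF dist_triangle])
      then show "\<bar>(\<Sum>j<4 ^ a div 2. shift_symbol m (int (2 * j + 1) * k) / real (2 * j + 1)) / real a - pi / 16 * sgn k\<bar> < e"
        unfolding dist_real_def by simp
    qed
  qed
  with a(1) show thesis by (rule that)
qed

text \<open>Each step from one power of 4 to the next adds 6 * 4^b terms of size at most 1 / (4 *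
  4^b), hence at most 3/2. After division by a the dilation weights sum to at most 2.\<close>

lemma odd_harmonic_le: "(\<Sum>j<4 ^ a div 2. 1 / real (2 * j + 1)) \<le> 2 * real a"
proof (cases "a = 0")
  case False
  have "(\<Sum>j<2 * 4 ^ b. 1 / real (2 * j + 1)) \<le> 2 * real (Suc b)" for b
  proof (induction b)
    case 0
    have "{..<2::nat} = {0, 1}" by auto
    then show ?case by simp
  next
    case (Suc b)
    have "{..<(2::nat) * 4 ^ Suc b} = {..<2 * 4 ^ b} \<union> {2 * 4 ^ b..<2 * 4 ^ Suc b}" for b :: nat by auto
    then have "(\<Sum>j<2 * 4 ^ Suc b. 1 / real (2 * j + 1)) = (\<Sum>j<2 * 4 ^ b. 1 / real (2 * j + 1)) + (\<Sum>j=(2::nat) * 4 ^ b..<2 * 4 ^ Suc b. 1 / real (2 * j + 1))"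
      by (simp only:) (rule sum.union_disjoint, auto)
    also have "(\<Sum>j=(2::nat) * 4 ^ b..<2 * 4 ^ Suc b. 1 / real (2 * j + 1)) \<le> (\<Sum>j=(2::nat) * 4 ^ b..<2 * 4 ^ Suc b. 1 / (4 * 4 ^ b))"
    proof (rule sum_mono)
      fix j :: nat assume "j \<in> {2 * 4 ^ b..<2 * 4 ^ Suc b}"
      then have "real (4 * 4 ^ b) \<le> real (2 * j + 1)" by (intro of_nat_mono) auto
      then show "1 / real (2 * j + 1) \<le> 1 / (4 * 4 ^ b)" by (intro frac_le) auto
    qed
    also have "\<dots> = 3 / 2" by (simp add: of_nat_diff field_simps)
    finally show ?case using Suc by simp
  qed
  moreover obtain b where "a = Suc b" using False by (cases a) auto
  ultimately show ?thesis by (simp add: mult.commute)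
qed simp

section \<open>The periodic Hilbert transform\<close>

lemma riemann_sum_limit:
  fixes f :: "real \<Rightarrow> real"
  assumes f: "continuous_on {0..b} f" and b: "b > 0"
  shows "(\<lambda>N. (b / real N) * (\<Sum>z<N. f (b * real z / real N))) \<longlonglongrightarrow> integral {0..b} f"
proof (rule LIMSEQ_I)
  fix r :: real assume r: "r > 0"
  define e where "e = r / (2 * b)"
  have e: "e > 0" using r b by (simp add: e_def)
  have "uniformly_continuous_on {0..b} f" by (rule compact_uniformly_continuous[OF f]) simp
  then obtain d where d: "d > 0" "\<And>x y. x \<in> {0..b} \<Longrightarrow> y \<in> {0..b} \<Longrightarrow> dist y x < d \<Longrightarrow> dist (f y) (f x) < e"
    unfolding uniformly_continuous_on_def using e by metis
  obtain N0 :: nat where N0: "N0 > b / d" using reals_Archimedean2 by blast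
  show "\<exists>no. \<forall>n\<ge>no. norm ((b / real n) * (\<Sum>z<n. f (b * real z / real n)) - integral {0..b} f) < r"
  proof (intro exI[of _ "Suc N0"] allI impI)
    fix N assume N: "Suc N0 \<le> N"
    define h where "h = b / real N"
    have Np: "real N > 0" using N by simp
    have h: "h > 0" "real N * h = b" using Np b by (auto simp: h_def)
    have "b / d < real N" using N N0 by linarith
    then have hd: "h < d" unfolding h_def using Np d(1) by (simp add: field_simps)
    have inside: "real z * h \<le> b" if "z \<le> N" for z
    proof -
      have "real z * h \<le> real N * h" using that h by (intro mult_right_mono) auto
      then show ?thesis using h by simp
    qed
    have intf: "f integrable_on {real i * h..real j * h}" if "j \<le> N" for i j
    proof (rule integrable_continuous_real[OF continuous_on_subset[OF f]])
      show "{real i * h..real j * h} \<subseteq> {0..b}"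
        using inside[OF that] h(1) by (auto intro: order_trans[of 0 "real i * h"])
    qed
    have split: "integral {0..real n * h} f = (\<Sum>z<n. integral {real z * h..real (Suc z) * h} f)" if "n \<le> N" for n
      using that
    proof (induction n)
      case (Suc n)
      have "integral {0..real n * h} f + integral {real n * h..real (Suc n) * h} f = integral {0..real (Suc n) * h} f"
        using Suc.prems h(1) intf[of "Suc n" 0] by (intro Henstock_Kurzweil_Integration.integral_combine) (auto simp: mult_right_mono)
      then show ?case using Suc by simp
    qed simp
    have cell: "\<bar>h * f (real z * h) - integral {real z * h..real (Suc z) * h} f\<bar> \<le> e * h" if z: "z < N" for z
    proof -
      have len: "real (Suc z) * h - real z * h = h" by (simp add: algebra_simps)
      have le: "real z * h \<le> real (Suc z) * h" using h by (intro mult_right_mono) auto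
      have "h * f (real z * h) - integral {real z * h..real (Suc z) * h} f
         = integral {real z * h..real (Suc z) * h} (\<lambda>x. f (real z * h) - f x)"
        using intf[of "Suc z" z] z le len by (subst integral_diff) (auto simp: measure_lborel_Icc)
      also have "\<bar>\<dots>\<bar> \<le> e * (real (Suc z) * h - real z * h)"
      proof (rule integral_bound[OF le, where 'a=real, unfolded real_norm_def])
        have sub: "{real z * h..real (Suc z) * h} \<subseteq> {0..b}"
          using inside[of "Suc z"] z h(1) by (auto intro: order_trans[of 0 "real z * h"])
        show "continuous_on {real z * h..real (Suc z) * h} (\<lambda>x. f (real z * h) - f x)"
          by (intro continuous_intros continuous_on_subset[OF f sub])
        fix x assume x: "x \<in> {real z * h..real (Suc z) * h}"
        have "dist (real z * h) x < d"
          using x hd len by (auto simp: dist_real_def)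
        then have "dist (f (real z * h)) (f x) < e"
          using x sub le by (intro d(2)) auto
        then show "\<bar>f (real z * h) - f x\<bar> \<le> e" by (simp add: dist_real_def)
      qed
      finally show ?thesis unfolding len .
    qed
    have "(b / real N) * (\<Sum>z<N. f (b * real z / real N)) - integral {0..b} f
       = (\<Sum>z<N. h * f (real z * h)) - (\<Sum>z<N. integral {real z * h..real (Suc z) * h} f)"
      using split[of N] h(2) by (simp add: h_def sum_distrib_left mult_ac)
    also have "\<bar>\<dots>\<bar> \<le> (\<Sum>z<N. \<bar>h * f (real z * h) - integral {real z * h..real (Suc z) * h} f\<bar>)"
      unfolding sum_subtractf[symmetric] by (rule sum_abs)
    also have "\<dots> \<le> (\<Sum>z<N. e * h)" by (intro sum_mono cell) auto
    also have "\<dots> = e * b" using h(2) by (simp add: mult_ac)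
    also have "\<dots> < r" using r b by (simp add: e_def)
    finally show "norm ((b / real N) * (\<Sum>z<N. f (b * real z / real N)) - integral {0..b} f) < r" by simp
  qed
qed

lemma continuous_on_norm_powr:
  fixes f :: "'b::topological_space \<Rightarrow> 'x::real_normed_vector"
  assumes "continuous_on A f" "0 < p"
  shows "continuous_on A (\<lambda>x. norm (f x) powr p)"
  using assms by (intro continuous_on_powr' continuous_intros) auto

text \<open>On each grid the averaged multiplier is within e of (pi/16) * sgn at the finitely many
  frequencies present, and its bound depends neither on the grid nor on the number of dilations.
  Riemann sums carry the estimate to the circle, and then e tends to 0.\<close>

lemma hilbert_transform_bounded:
  fixes sc :: "'k::real_normed_field \<Rightarrow> 'x::banach \<Rightarrow> 'x"
  assumes sc: "normed_scaling sc" and umd: "UMD sc" and p: "1 < p"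
  obtains C where "0 \<le> C"
    "\<And>(S :: 'i set) k \<phi> (a :: 'i \<Rightarrow> 'x). finite S \<Longrightarrow>
       integral {0..2*pi} (\<lambda>x. norm (\<Sum>j\<in>S. (of_int (sgn (k j)) * sin (of_int (k j) * x + \<phi> j)) *\<^sub>R a j) powr p)
       \<le> C * integral {0..2*pi} (\<lambda>x. norm (\<Sum>j\<in>S. cos (of_int (k j) * x + \<phi> j) *\<^sub>R a j) powr p)"
proof -
  obtain C where C: "0 \<le> C" "\<And>m r (S :: 'i set) k \<phi> (a :: 'i \<Rightarrow> 'x). odd r \<Longrightarrow>
       (\<Sum>z<(4::nat)^m. norm (\<Sum>j\<in>S. (shift_symbol m (r * k j) * sin (2 * pi * k j / 4 ^ m * z + \<phi> j)) *\<^sub>R a j) powr p)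
       \<le> C * (\<Sum>z<(4::nat)^m. norm (\<Sum>j\<in>S. cos (2 * pi * k j / 4 ^ m * z + \<phi> j) *\<^sub>R a j) powr p)"
    using grid_multiplier_bounded[OF assms, where 'i='i] by blast
  define c where "c = pi / 16"
  have c: "c > 0" by (simp add: c_def)
  define D where "D = 2 powr (p - 1) * (2 powr p * C)"
  have D: "D \<ge> 0" using C(1) by (simp add: D_def)
  show thesis
  proof (rule that[of "D / c powr p"])
    show "0 \<le> D / c powr p" using D by simp
    fix S :: "'i set" and k :: "'i \<Rightarrow> int" and \<phi> and a :: "'i \<Rightarrow> 'x"
    assume S: "finite S"
    define f where "f x = (\<Sum>j\<in>S. cos (of_int (k j) * x + \<phi> j) *\<^sub>R a j)" for x :: real
    define H where "H x = (\<Sum>j\<in>S. (of_int (sgn (k j)) * sin (of_int (k j) * x + \<phi> j)) *\<^sub>R a j)" for x :: real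
    define A where "A = (\<Sum>j\<in>S. norm (a j))"
    have A: "A \<ge> 0" unfolding A_def by (intro sum_nonneg) auto
    have cont: "continuous_on {0..2*pi} (\<lambda>x. norm (f x) powr p)" "continuous_on {0..2*pi} (\<lambda>x. norm (H x) powr p)"
      unfolding f_def H_def using p by (intro continuous_on_norm_powr continuous_intros, simp)+
    define Rs where "Rs g m = (2 * pi / real (4 ^ m)) * (\<Sum>z<4 ^ m. norm (g (2 * pi * real z / real (4 ^ m)) :: 'x) powr p)" for g and m :: nat
    have sub: "filterlim (\<lambda>m. (4::nat) ^ m) sequentially sequentially"
    proof (rule filterlim_subseq)
      show "strict_mono (\<lambda>m. (4::nat) ^ m)" by (rule strict_monoI) simp
    qed
    have RsI: "Rs g \<longlonglongrightarrow> integral {0..2*pi} (\<lambda>x. norm (g x) powr p)"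
      if "continuous_on {0..2*pi} (\<lambda>x. norm (g x) powr p)" for g :: "real \<Rightarrow> 'x"
      unfolding Rs_def using filterlim_compose[OF riemann_sum_limit[OF that] sub] by simp
    have main: "c powr p * integral {0..2*pi} (\<lambda>x. norm (H x) powr p)
        \<le> D * integral {0..2*pi} (\<lambda>x. norm (f x) powr p) + 2 powr (p - 1) * (2 * pi * (e * A) powr p)"
      if e: "e > 0" for e
    proof -
      obtain n where n: "n \<ge> 1" and ev: "\<forall>\<^sub>F m in sequentially. \<forall>l\<in>k ` S. \<bar>(\<Sum>j<4 ^ n div 2. shift_symbol m (int (2 * j + 1) * l) / real (2 * j + 1)) / real n
       - pi / 16 * sgn l\<bar> < e"
        using symbol_average_approx[OF finite_imageI[OF S] e] by blast
      have "\<forall>\<^sub>F m in sequentially. c powr p * Rs H m \<le> D * Rs f m + 2 powr (p - 1) * (2 * pi * (e * A) powr p)"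
        using ev
      proof eventually_elim
        case (elim m)
        define \<sigma> where "\<sigma> l = (\<Sum>j<4 ^ n div 2. shift_symbol m (int (2 * j + 1) * l) / real (2 * j + 1)) / real n" for l
        \<comment> \<open>The weights of the dilation average; their total \<open>W \<le> 2\<close>
          enters through Jensen's inequality as \<open>2 powr p\<close>.\<close>
        define w where "w j = 1 / (real n * real (2 * j + 1))" for j
        define W where "W = (\<Sum>j<4 ^ n div 2. w j)"
        have W: "W \<le> 2" "W \<ge> 0"
        proof -
          have "W = (\<Sum>j<4 ^ n div 2. 1 / real (2 * j + 1)) / real n"
            unfolding W_def w_def by (simp add: sum_divide_distrib mult_ac)
          also have "\<dots> \<le> (2 * real n) / real n" by (intro divide_right_mono odd_harmonic_le) auto
          finally show "W \<le> 2" using n by simp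
          show "W \<ge> 0" unfolding W_def w_def by (intro sum_nonneg) auto
        qed
        define X where "X z = 2 * pi * real z / real (4 ^ m)" for z :: nat
        define y where "y j z = (\<Sum>i\<in>S. (shift_symbol m (int (2 * j + 1) * k i) * sin (of_int (k i) * X z + \<phi> i)) *\<^sub>R a i)" for j z
        define V where "V z = (\<Sum>i\<in>S. (\<sigma> (k i) * sin (of_int (k i) * X z + \<phi> i)) *\<^sub>R a i)" for z
        have Xk: "2 * pi * of_int l / 4 ^ m * real z = of_int l * X z" for l z
          by (simp add: X_def)
        have yb: "(\<Sum>z<4^m. norm (y j z) powr p) \<le> C * (\<Sum>z<4^m. norm (f (X z)) powr p)" for j
          using C(2)[where r="int (2 * j + 1)" and m=m and S=S and k=k and \<phi>=\<phi> and a=a] unfolding y_def f_def Xk by simp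
        have Vy: "V z = (\<Sum>j<4 ^ n div 2. w j *\<^sub>R y j z)" for z
        proof -
          have "(\<Sum>j<4 ^ n div 2. w j *\<^sub>R y j z) = (\<Sum>i\<in>S. \<Sum>j<4 ^ n div 2. (w j * (shift_symbol m (int (2 * j + 1) * k i) * sin (of_int (k i) * X z + \<phi> i))) *\<^sub>R a i)"
            unfolding y_def scaleR_sum_right by (subst sum.swap) simp
          also have "\<dots> = V z"
            unfolding V_def
          proof (rule sum.cong[OF refl])
            fix i
            have "(\<Sum>j<4 ^ n div 2. (w j * (shift_symbol m (int (2 * j + 1) * k i) * sin (of_int (k i) * X z + \<phi> i))))
               = \<sigma> (k i) * sin (of_int (k i) * X z + \<phi> i)"
              unfolding \<sigma>_def w_def sum_divide_distrib sum_distrib_right by (intro sum.cong refl) (simp add: mult_ac)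
            then show "(\<Sum>j<4 ^ n div 2. (w j * (shift_symbol m (int (2 * j + 1) * k i) * sin (of_int (k i) * X z + \<phi> i))) *\<^sub>R a i)
                = (\<sigma> (k i) * sin (of_int (k i) * X z + \<phi> i)) *\<^sub>R a i"
              by (simp only: scaleR_sum_left[symmetric])
          qed
          finally show ?thesis by simp
        qed
        define F where "F = (\<Sum>z<(4::nat)^m. norm (f (X z)) powr p)"
        have F0: "F \<ge> 0" unfolding F_def by (intro sum_nonneg) auto
        have Vb: "(\<Sum>z<4^m. norm (V z) powr p) \<le> 2 powr p * C * F"
        proof -
          have "(\<Sum>z<4^m. norm (V z) powr p) \<le> (\<Sum>z<4^m. W powr (p - 1) * (\<Sum>j<4 ^ n div 2. w j * norm (y j z) powr p))"
            unfolding Vy W_def using p by (intro sum_mono norm_weighted_sum_powr_le) (auto simp: w_def)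
          also have "\<dots> = W powr (p - 1) * (\<Sum>j<4 ^ n div 2. w j * (\<Sum>z<4^m. norm (y j z) powr p))"
            by (simp add: sum_distrib_left) (subst sum.swap, rule refl)
          also have "\<dots> \<le> W powr (p - 1) * (\<Sum>j<4 ^ n div 2. w j * (C * F))"
            using yb unfolding F_def by (intro mult_left_mono sum_mono) (auto simp: w_def)
          also have "\<dots> = W powr (p - 1) * W * (C * F)" by (simp add: W_def sum_distrib_right)
          also have "W powr (p - 1) * W = W powr p"
            using W(2) p by (cases "W = 0") (auto simp: powr_diff)
          also have "W powr p * (C * F) \<le> 2 powr p * (C * F)"
            using W p C(1) F0 by (intro mult_right_mono powr_mono2) auto
          finally show ?thesis by (simp add: mult_ac)
        qed
        \<comment> \<open>The averaged multiplier \<open>V\<close> misses \<open>c\<close> times the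
          Hilbert transform by at most e per coefficient, hence by \<open>e * A\<close> at every
          point.\<close>
        have pt: "c powr p * norm (H (X z)) powr p \<le> 2 powr (p - 1) * (norm (V z) powr p + (e * A) powr p)" for z
        proof -
          have "c *\<^sub>R H (X z) - V z = (\<Sum>i\<in>S. ((c * sgn (k i) - \<sigma> (k i)) * sin (of_int (k i) * X z + \<phi> i)) *\<^sub>R a i)"
            unfolding H_def V_def scaleR_sum_right sum_subtractf[symmetric]
            by (intro sum.cong refl) (simp add: left_diff_distrib scaleR_diff_left mult.assoc)
          also have "norm \<dots> \<le> (\<Sum>i\<in>S. e * norm (a i))"
          proof (rule order_trans[OF norm_sum], rule sum_mono)
            fix i assume "i \<in> S"
            then have "\<bar>\<sigma> (k i) - c * sgn (k i)\<bar> < e" using elim unfolding \<sigma>_def c_def by auto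
            then have "\<bar>c * sgn (k i) - \<sigma> (k i)\<bar> * \<bar>sin (of_int (k i) * X z + \<phi> i)\<bar> \<le> e * 1"
              by (intro mult_mono) (auto simp: abs_minus_commute)
            then show "norm (((c * sgn (k i) - \<sigma> (k i)) * sin (of_int (k i) * X z + \<phi> i)) *\<^sub>R a i) \<le> e * norm (a i)"
              by (simp add: abs_mult mult_right_mono)
          qed
          also have "\<dots> = e * A" by (simp add: A_def sum_distrib_left)
          finally have d: "norm (c *\<^sub>R H (X z) - V z) \<le> e * A" .
          have "c powr p * norm (H (X z)) powr p = norm (V z + (c *\<^sub>R H (X z) - V z)) powr p"
            using c by (simp add: powr_mult)
          also have "\<dots> \<le> 2 powr (p - 1) * (norm (V z) powr p + norm (c *\<^sub>R H (X z) - V z) powr p)"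
            using p by (intro norm_add_powr_le) simp
          also have "\<dots> \<le> 2 powr (p - 1) * (norm (V z) powr p + (e * A) powr p)"
            using d p by (intro mult_left_mono add_left_mono powr_mono2) auto
          finally show ?thesis .
        qed
        have "c powr p * (\<Sum>z<4^m. norm (H (X z)) powr p) \<le> (\<Sum>z<(4::nat)^m. 2 powr (p - 1) * (norm (V z) powr p + (e * A) powr p))"
          unfolding sum_distrib_left by (intro sum_mono pt)
        also have "\<dots> = 2 powr (p - 1) * ((\<Sum>z<4^m. norm (V z) powr p) + 4 ^ m * (e * A) powr p)"
          by (simp add: sum.distrib flip: sum_distrib_left)
        also have "\<dots> \<le> 2 powr (p - 1) * (2 powr p * C * F + 4 ^ m * (e * A) powr p)"
          using Vb by (intro mult_left_mono add_right_mono) auto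
        finally have "(2 * pi / 4 ^ m) * (c powr p * (\<Sum>z<4^m. norm (H (X z)) powr p))
            \<le> (2 * pi / 4 ^ m) * (2 powr (p - 1) * (2 powr p * C * F + 4 ^ m * (e * A) powr p))"
          by (intro mult_left_mono) auto
        also have "\<dots> = D * ((2 * pi / 4 ^ m) * F) + 2 powr (p - 1) * (2 * pi * (e * A) powr p)"
          by (simp add: D_def field_simps)
        finally show ?case by (simp add: Rs_def X_def F_def mult_ac)
      qed
      moreover have "(\<lambda>m. c powr p * Rs H m) \<longlonglongrightarrow> c powr p * integral {0..2*pi} (\<lambda>x. norm (H x) powr p)"
        by (intro tendsto_mult tendsto_const RsI cont)
      moreover have "(\<lambda>m. D * Rs f m + 2 powr (p - 1) * (2 * pi * (e * A) powr p)) \<longlonglongrightarrow>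
          D * integral {0..2*pi} (\<lambda>x. norm (f x) powr p) + 2 powr (p - 1) * (2 * pi * (e * A) powr p)"
        by (intro tendsto_add tendsto_mult tendsto_const RsI cont)
      ultimately show ?thesis by (intro tendsto_le[OF trivial_limit_sequentially])
    qed
    have "c powr p * integral {0..2*pi} (\<lambda>x. norm (H x) powr p) \<le> D * integral {0..2*pi} (\<lambda>x. norm (f x) powr p)"
    proof (rule tendsto_lowerbound)
      have "((\<lambda>e. (e * A) powr p) \<longlongrightarrow> (0 * A) powr p) (at_right 0)"
        using p A by (intro tendsto_powr2 tendsto_intros) (auto simp: eventually_at_filter)
      then have L: "((\<lambda>e. (e * A) powr p) \<longlongrightarrow> 0) (at_right 0)" using p by simp
      have "((\<lambda>e. D * integral {0..2*pi} (\<lambda>x. norm (f x) powr p) + 2 powr (p - 1) * (2 * pi * (e * A) powr p))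
         \<longlongrightarrow> D * integral {0..2*pi} (\<lambda>x. norm (f x) powr p) + 2 powr (p - 1) * (2 * pi * 0)) (at_right 0)"
        by (intro tendsto_add tendsto_mult tendsto_const L)
      then show "((\<lambda>e. D * integral {0..2*pi} (\<lambda>x. norm (f x) powr p) + 2 powr (p - 1) * (2 * pi * (e * A) powr p))
         \<longlongrightarrow> D * integral {0..2*pi} (\<lambda>x. norm (f x) powr p)) (at_right 0)" by simp
      show "\<forall>\<^sub>F e in at_right 0. c powr p * integral {0..2*pi} (\<lambda>x. norm (H x) powr p)
          \<le> D * integral {0..2*pi} (\<lambda>x. norm (f x) powr p) + 2 powr (p - 1) * (2 * pi * (e * A) powr p)"
        using main by (auto simp: eventually_at_filter)
    qed simp
    then show "integral {0..2*pi} (\<lambda>x. norm (\<Sum>j\<in>S. (of_int (sgn (k j)) * sin (of_int (k j) * x + \<phi> j)) *\<^sub>R a j) powr p)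
       \<le> D / c powr p * integral {0..2*pi} (\<lambda>x. norm (\<Sum>j\<in>S. cos (of_int (k j) * x + \<phi> j) *\<^sub>R a j) powr p)"
      using c unfolding f_def H_def by (simp add: field_simps)
  qed
qed

section \<open>Partial sums of trigonometric polynomials\<close>

text \<open>The p-th power of the norm. Working with it throughout avoids roots; the factor
  \<open>2 powr (p - 1)\<close> takes the place of the triangle inequality.\<close>

definition circle_modular :: "real \<Rightarrow> (real \<Rightarrow> 'x::real_normed_vector) \<Rightarrow> real" where
  "circle_modular p f = integral {0..2*pi} (\<lambda>x. norm (f x) powr p)"

lemma circle_modular_mono:
  assumes "continuous_on {0..2*pi} f" "continuous_on {0..2*pi} g" "0 < p"
    and "\<And>x. x \<in> {0..2*pi} \<Longrightarrow> norm (f x) \<le> norm (g x)"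
  shows "circle_modular p f \<le> circle_modular p g"
  unfolding circle_modular_def using assms
  by (intro integral_le integrable_continuous_real continuous_on_norm_powr powr_mono2) auto

lemma circle_modular_add:
  assumes "continuous_on {0..2*pi} f" "continuous_on {0..2*pi} g" "1 < p"
  shows "circle_modular p (\<lambda>x. f x + g x) \<le> 2 powr (p - 1) * (circle_modular p f + circle_modular p g)"
proof -
  have i: "(\<lambda>x. norm (f x) powr p) integrable_on {0..2*pi}" "(\<lambda>x. norm (g x) powr p) integrable_on {0..2*pi}"
    "(\<lambda>x. norm (f x + g x) powr p) integrable_on {0..2*pi}"
    using assms by (intro integrable_continuous_real continuous_on_norm_powr continuous_intros; simp)+
  have "circle_modular p (\<lambda>x. f x + g x) \<le> integral {0..2*pi} (\<lambda>x. 2 powr (p - 1) * (norm (f x) powr p + norm (g x) powr p))"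
    unfolding circle_modular_def
  proof (rule integral_le[OF i(3)])
    show "(\<lambda>x. 2 powr (p - 1) * (norm (f x) powr p + norm (g x) powr p)) integrable_on {0..2*pi}"
      by (rule integrable_on_mult_right[OF integrable_add[OF i(1,2)]])
    show "norm (f x + g x) powr p \<le> 2 powr (p - 1) * (norm (f x) powr p + norm (g x) powr p)" for x
      using assms(3) by (intro norm_add_powr_le) simp
  qed
  also have "\<dots> = 2 powr (p - 1) * (circle_modular p f + circle_modular p g)"
    unfolding circle_modular_def using integral_add[OF i(1,2)] by simp
  finally show ?thesis .
qed

lemma circle_modular_scaleR: "circle_modular p (\<lambda>x. c *\<^sub>R f x) = \<bar>c\<bar> powr p * circle_modular p f"
  unfolding circle_modular_def by (simp add: powr_mult)

lemma has_integral_reflect_2pi: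
  fixes G :: "real \<Rightarrow> real"
  assumes "(G has_integral i) {0..2*pi}"
  shows "((\<lambda>x. G (2 * pi - x)) has_integral i) {0..2*pi}"
proof -
  have im: "(\<lambda>x::real. 2 * pi - x) ` {0..2*pi} = {0..2*pi}"
    by (auto simp: image_iff intro!: bexI[of _ "2 * pi - _"])
  from assms have "(G has_integral i) (cbox 0 (2*pi))" by simp
  from has_integral_affinity[OF this, of "-1" "2*pi"] show ?thesis using im by simp
qed

lemma trig_reflect:
  "cos (real k * (2 * pi - x)) = cos (real k * x)" "sin (real k * (2 * pi - x)) = - sin (real k * x)"
proof -
  have e: "real k * (2 * pi - x) = - (real k * x) + 2 * real k * pi" by (simp add: algebra_simps)
  show "cos (real k * (2 * pi - x)) = cos (real k * x)" "sin (real k * (2 * pi - x)) = - sin (real k * x)"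
    unfolding e cos_add sin_add by simp_all
qed

lemma circle_modular_reflect:
  assumes "continuous_on {0..2*pi} f" "0 < p"
  shows "circle_modular p (\<lambda>x. f (2 * pi - x)) = circle_modular p f"
  unfolding circle_modular_def using assms
  by (intro integral_unique has_integral_reflect_2pi[OF integrable_integral]
      integrable_continuous_real continuous_on_norm_powr)

text \<open>Real form of conjugating the Hilbert transform by the characters of frequency m and -m
  and taking half the difference. Multiplying by cos (m x) or sin (m x) before and after the
  transform is harmless because both are bounded by 1.\<close>

lemma modulated_hilbert_bounded:
  fixes sc :: "'k::real_normed_field \<Rightarrow> 'x::banach \<Rightarrow> 'x"
  assumes sc: "normed_scaling sc" and umd: "UMD sc" and p: "1 < p"
  obtains C where "0 \<le> C"
    "\<And>(S :: 'i set) k \<phi> (a :: 'i \<Rightarrow> 'x) m. finite S \<Longrightarrow>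
       circle_modular p (\<lambda>x. \<Sum>j\<in>S. (of_int (sgn (k j + m) - sgn (k j - m)) / 2 * cos (of_int (k j) * x + \<phi> j)) *\<^sub>R a j)
       \<le> C * circle_modular p (\<lambda>x. \<Sum>j\<in>S. cos (of_int (k j) * x + \<phi> j) *\<^sub>R a j)"
proof -
  obtain C where C: "0 \<le> C"
    "\<And>(S :: ('i \<times> bool) set) k \<phi> (a :: 'i \<times> bool \<Rightarrow> 'x). finite S \<Longrightarrow>
       circle_modular p (\<lambda>x. \<Sum>j\<in>S. (of_int (sgn (k j)) * sin (of_int (k j) * x + \<phi> j)) *\<^sub>R a j)
       \<le> C * circle_modular p (\<lambda>x. \<Sum>j\<in>S. cos (of_int (k j) * x + \<phi> j) *\<^sub>R a j)"
    using hilbert_transform_bounded[OF assms, where 'i="'i \<times> bool"] unfolding circle_modular_def by blast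
  show thesis
  proof (rule that[of "2 powr (p - 1) * (2 * C)"])
    show "0 \<le> 2 powr (p - 1) * (2 * C)" using C(1) by simp
    fix S :: "'i set" and k :: "'i \<Rightarrow> int" and \<phi> and a :: "'i \<Rightarrow> 'x" and m :: int
    assume S: "finite S"
    define f where "f x = (\<Sum>j\<in>S. cos (of_int (k j) * x + \<phi> j) *\<^sub>R a j)" for x :: real
    define T where "T = S \<times> (UNIV :: bool set)"
    have T: "finite T" using S by (simp add: T_def)
    have sumT: "(\<Sum>i\<in>T. G i) = (\<Sum>j\<in>S. G (j, True) + G (j, False))" for G :: "'i \<times> bool \<Rightarrow> 'x"
    proof -
      have "(\<Sum>i\<in>T. G i) = (\<Sum>j\<in>S. \<Sum>b\<in>UNIV. G (j, b))"
        unfolding T_def by (simp add: sum.cartesian_product)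
      then show ?thesis by (simp add: UNIV_bool add.commute)
    qed
    \<comment> \<open>The product-to-sum formulas split each frequency into k + m and k - m; the
      boolean selects one of them. The phase shift in \<open>\<psi>\<close> writes sines as cosines,
      and the coefficients \<open>a1\<close>, \<open>a2\<close> carry the factors 1/2 and
      -1/2.\<close>
    define l where "l i = k (fst i) + (if snd i then m else - m)" for i :: "'i \<times> bool"
    define \<psi> where "\<psi> i = \<phi> (fst i) - pi / 2" for i :: "'i \<times> bool"
    define a1 where "a1 i = (1/2::real) *\<^sub>R a (fst i)" for i :: "'i \<times> bool"
    define a2 where "a2 i = (if snd i then 1/2 else -1/2::real) *\<^sub>R a (fst i)" for i :: "'i \<times> bool"
    define h1 where "h1 x = (\<Sum>i\<in>T. (of_int (sgn (l i)) * sin (of_int (l i) * x + \<phi> (fst i))) *\<^sub>R a1 i)" for x :: real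
    define h2 where "h2 x = (\<Sum>i\<in>T. (of_int (sgn (l i)) * sin (of_int (l i) * x + \<psi> i)) *\<^sub>R a2 i)" for x :: real
    have ang: "of_int (k j + m) * x + \<phi> j = (of_int (k j) * x + \<phi> j) + of_int m * x"
      "of_int (k j + - m) * x + \<phi> j = (of_int (k j) * x + \<phi> j) - of_int m * x"
      "of_int (k j - m) * x + \<phi> j = (of_int (k j) * x + \<phi> j) - of_int m * x"
      "of_int (k j + m) * x + (\<phi> j - pi / 2) = ((of_int (k j) * x + \<phi> j) + of_int m * x) - pi / 2"
      "of_int (k j + - m) * x + (\<phi> j - pi / 2) = ((of_int (k j) * x + \<phi> j) - of_int m * x) - pi / 2"
      "of_int (k j - m) * x + (\<phi> j - pi / 2) = ((of_int (k j) * x + \<phi> j) - of_int m * x) - pi / 2" for j x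
      by (simp_all add: algebra_simps)
    have shift: "cos (t - pi / 2) = sin t" "sin (t - pi / 2) = - cos t" for t :: real
      by (simp_all add: cos_diff sin_diff)
    have f1: "(\<Sum>i\<in>T. cos (of_int (l i) * x + \<phi> (fst i)) *\<^sub>R a1 i) = cos (of_int m * x) *\<^sub>R f x" for x
      unfolding sumT f_def scaleR_sum_right
      by (intro sum.cong refl) (simp only: l_def a1_def fst_conv snd_conv if_True if_False ang cos_add cos_diff scaleR_scaleR scaleR_add_left[symmetric], simp add: algebra_simps)
    have f2: "(\<Sum>i\<in>T. cos (of_int (l i) * x + \<psi> i) *\<^sub>R a2 i) = sin (of_int m * x) *\<^sub>R f x" for x
      unfolding sumT f_def scaleR_sum_right
      by (intro sum.cong refl) (simp only: l_def a2_def \<psi>_def fst_conv snd_conv if_True if_False ang shift sin_add sin_diff scaleR_scaleR scaleR_add_left[symmetric], simp add: algebra_simps)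
    have cf: "continuous_on {0..2*pi} f" "continuous_on {0..2*pi} h1" "continuous_on {0..2*pi} h2"
      unfolding f_def h1_def h2_def by (intro continuous_intros)+
    have b1: "circle_modular p h1 \<le> C * circle_modular p f"
    proof -
      have "circle_modular p h1 \<le> C * circle_modular p (\<lambda>x. cos (of_int m * x) *\<^sub>R f x)"
        using C(2)[OF T, of l "\<lambda>i. \<phi> (fst i)" a1] unfolding f1 h1_def .
      also have "circle_modular p (\<lambda>x. cos (of_int m * x) *\<^sub>R f x) \<le> circle_modular p f"
        using p cf by (intro circle_modular_mono continuous_intros) (auto simp: mult_left_le_one_le)
      finally show ?thesis using C(1) by (simp add: mult_left_mono)
    qed
    have b2: "circle_modular p h2 \<le> C * circle_modular p f"
    proof -
      have "circle_modular p h2 \<le> C * circle_modular p (\<lambda>x. sin (of_int m * x) *\<^sub>R f x)"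
        using C(2)[OF T, of l \<psi> a2] unfolding f2 h2_def .
      also have "circle_modular p (\<lambda>x. sin (of_int m * x) *\<^sub>R f x) \<le> circle_modular p f"
        using p cf by (intro circle_modular_mono continuous_intros) (auto simp: mult_left_le_one_le)
      finally show ?thesis using C(1) by (simp add: mult_left_mono)
    qed
    \<comment> \<open>Demodulation: the frequencies k + m and k - m recombine into k by the addition
      theorems, each keeping its own sign factor.\<close>
    have Q: "(\<Sum>j\<in>S. (of_int (sgn (k j + m) - sgn (k j - m)) / 2 * cos (of_int (k j) * x + \<phi> j)) *\<^sub>R a j)
       = sin (of_int m * x) *\<^sub>R h1 x + (- cos (of_int m * x)) *\<^sub>R h2 x" for x
      unfolding h1_def h2_def sumT scaleR_sum_right sum.distrib[symmetric]
    proof (rule sum.cong[OF refl])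
      fix j
      define t where "t = of_int (k j) * x + \<phi> j"
      define u where "u = of_int m * x"
      define sp sm :: real where "sp = of_int (sgn (k j + m))" and "sm = of_int (sgn (k j - m))"
      have key: "(sp - sm) / 2 * cos t = sin u * ((sp * sin (t + u)) * (1/2) + (sm * sin (t - u)) * (1/2))
         + (- cos u) * ((sp * (- cos (t + u))) * (1/2) + (sm * (- cos (t - u))) * (-1/2))"
      proof -
        have p: "sin u * sin (t + u) + cos u * cos (t + u) = cos t"
          using cos_diff[of "t + u" u] by (simp add: mult.commute add.commute)
        have q: "sin u * sin (t - u) - cos u * cos (t - u) = - cos t"
          using cos_add[of "t - u" u] by (simp add: mult.commute)
        have "sin u * ((sp * sin (t + u)) * (1/2) + (sm * sin (t - u)) * (1/2))
         + (- cos u) * ((sp * (- cos (t + u))) * (1/2) + (sm * (- cos (t - u))) * (-1/2))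
         = (1/2) * sp * (sin u * sin (t + u) + cos u * cos (t + u)) + (1/2) * sm * (sin u * sin (t - u) - cos u * cos (t - u))"
          by (simp add: algebra_simps)
        also have "\<dots> = (sp - sm) / 2 * cos t" unfolding p q by (simp add: algebra_simps)
        finally show ?thesis by simp
      qed
      have e: "k j + - m = k j - m" by simp
      have d: "of_int (sgn (k j + m) - sgn (k j - m)) = sp - sm" by (simp add: sp_def sm_def)
      show "(of_int (sgn (k j + m) - sgn (k j - m)) / 2 * cos (of_int (k j) * x + \<phi> j)) *\<^sub>R a j
        = sin (of_int m * x) *\<^sub>R ((of_int (sgn (l (j, True))) * sin (of_int (l (j, True)) * x + \<phi> (fst (j, True)))) *\<^sub>R a1 (j, True)
           + (of_int (sgn (l (j, False))) * sin (of_int (l (j, False)) * x + \<phi> (fst (j, False)))) *\<^sub>R a1 (j, False))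
         + (- cos (of_int m * x)) *\<^sub>R ((of_int (sgn (l (j, True))) * sin (of_int (l (j, True)) * x + \<psi> (j, True))) *\<^sub>R a2 (j, True)
           + (of_int (sgn (l (j, False))) * sin (of_int (l (j, False)) * x + \<psi> (j, False))) *\<^sub>R a2 (j, False))"
        by (simp only: l_def a1_def a2_def \<psi>_def fst_conv snd_conv if_True if_False ang shift scaleR_scaleR
             scaleR_add_left[symmetric] t_def[symmetric] u_def[symmetric] d e sp_def[symmetric] sm_def[symmetric] key)
    qed
    have "circle_modular p (\<lambda>x. sin (of_int m * x) *\<^sub>R h1 x + (- cos (of_int m * x)) *\<^sub>R h2 x)
      \<le> 2 powr (p - 1) * (circle_modular p (\<lambda>x. sin (of_int m * x) *\<^sub>R h1 x) + circle_modular p (\<lambda>x. (- cos (of_int m * x)) *\<^sub>R h2 x))"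
      using p cf by (intro circle_modular_add continuous_intros) auto
    also have "\<dots> \<le> 2 powr (p - 1) * (circle_modular p h1 + circle_modular p h2)"
      using p cf by (intro mult_left_mono add_mono circle_modular_mono continuous_intros) (auto simp: mult_left_le_one_le)
    also have "\<dots> \<le> 2 powr (p - 1) * (C * circle_modular p f + C * circle_modular p f)"
      by (intro mult_left_mono add_mono b1 b2) auto
    finally show "circle_modular p (\<lambda>x. \<Sum>j\<in>S. (of_int (sgn (k j + m) - sgn (k j - m)) / 2 * cos (of_int (k j) * x + \<phi> j)) *\<^sub>R a j)
       \<le> 2 powr (p - 1) * (2 * C) * circle_modular p (\<lambda>x. \<Sum>j\<in>S. cos (of_int (k j) * x + \<phi> j) *\<^sub>R a j)"
      unfolding Q f_def by (simp add: algebra_simps)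
  qed
qed

text \<open>The symbol \<open>q\<close> of the modulated Hilbert transform is \<open>1\<close>, \<open>1/2\<close>, \<open>0\<close> according to
  \<open>\<bar>k\<bar> < m\<close>, \<open>\<bar>k\<bar> = m\<close>, \<open>\<bar>k\<bar> > m\<close>; the polynomial \<open>2 q\<^sup>2 - q\<close> removes the value \<open>1/2\<close>.\<close>

lemma partial_sums_bounded:
  fixes sc :: "'k::real_normed_field \<Rightarrow> 'x::banach \<Rightarrow> 'x"
  assumes sc: "normed_scaling sc" and umd: "UMD sc" and p: "1 < p"
  obtains C where "0 \<le> C"
    "\<And>(S :: 'i set) k \<phi> (a :: 'i \<Rightarrow> 'x) n. finite S \<Longrightarrow>
       circle_modular p (\<lambda>x. \<Sum>j\<in>S. (if \<bar>k j\<bar> \<le> int n then cos (of_int (k j) * x + \<phi> j) else 0) *\<^sub>R a j)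
       \<le> C * circle_modular p (\<lambda>x. \<Sum>j\<in>S. cos (of_int (k j) * x + \<phi> j) *\<^sub>R a j)"
proof -
  obtain C where C: "0 \<le> C"
    "\<And>(S :: 'i set) k \<phi> (a :: 'i \<Rightarrow> 'x) m. finite S \<Longrightarrow>
       circle_modular p (\<lambda>x. \<Sum>j\<in>S. (of_int (sgn (k j + m) - sgn (k j - m)) / 2 * cos (of_int (k j) * x + \<phi> j)) *\<^sub>R a j)
       \<le> C * circle_modular p (\<lambda>x. \<Sum>j\<in>S. cos (of_int (k j) * x + \<phi> j) *\<^sub>R a j)"
    using modulated_hilbert_bounded[OF assms, where 'i='i] by blast
  show thesis
  proof (rule that[of "2 powr (p - 1) * (2 powr p * (C * C) + C)"])
    show "0 \<le> 2 powr (p - 1) * (2 powr p * (C * C) + C)" using C(1) by simp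
    fix S :: "'i set" and k :: "'i \<Rightarrow> int" and \<phi> and a :: "'i \<Rightarrow> 'x" and n :: nat
    assume S: "finite S"
    \<comment> \<open>Thus \<bar>k\<bar> \<le> n is \<bar>k\<bar> < m, and the frequencies n are on
      the side where the symbol is 1.\<close>
    define m where "m = int n + 1"
    define q :: "int \<Rightarrow> real" where "q i = of_int (sgn (i + m) - sgn (i - m)) / 2" for i
    define f where "f x = (\<Sum>j\<in>S. cos (of_int (k j) * x + \<phi> j) *\<^sub>R a j)" for x :: real
    define f1 where "f1 x = (\<Sum>j\<in>S. (q (k j) * cos (of_int (k j) * x + \<phi> j)) *\<^sub>R a j)" for x :: real
    \<comment> \<open>The multiplier applied twice: the bound is used again with the coefficients q
      * a.\<close>
    define f2 where "f2 x = (\<Sum>j\<in>S. (q (k j) * cos (of_int (k j) * x + \<phi> j)) *\<^sub>R (q (k j) *\<^sub>R a j))" for x :: real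
    have f1': "f1 x = (\<Sum>j\<in>S. cos (of_int (k j) * x + \<phi> j) *\<^sub>R (q (k j) *\<^sub>R a j))" for x
      unfolding f1_def by (simp add: mult.commute)
    have 1: "circle_modular p f1 \<le> C * circle_modular p f"
      using C(2)[OF S, where k=k and m=m and \<phi>=\<phi> and a=a] unfolding f1_def[abs_def] f_def[abs_def] q_def .
    have 2: "circle_modular p f2 \<le> C * circle_modular p f1"
      using C(2)[OF S, where k=k and m=m and \<phi>=\<phi> and a="\<lambda>j. q (k j) *\<^sub>R a j"] unfolding f1'[abs_def] f2_def[abs_def] q_def .
    have cf: "continuous_on {0..2*pi} f1" "continuous_on {0..2*pi} f2"
      unfolding f1_def f2_def by (intro continuous_intros)+
    have qq: "2 * (q i * q i) - q i = (if \<bar>i\<bar> \<le> int n then 1 else 0)" for i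
      by (auto simp: q_def m_def sgn_if)
    have "(\<Sum>j\<in>S. (if \<bar>k j\<bar> \<le> int n then cos (of_int (k j) * x + \<phi> j) else 0) *\<^sub>R a j) = 2 *\<^sub>R f2 x + (-1) *\<^sub>R f1 x" for x
    proof -
      have "(if \<bar>k j\<bar> \<le> int n then cos (of_int (k j) * x + \<phi> j) else 0) *\<^sub>R a j
         = ((2 * (q (k j) * q (k j)) - q (k j)) * cos (of_int (k j) * x + \<phi> j)) *\<^sub>R a j" for j
        unfolding qq by simp
      then show ?thesis unfolding f1_def f2_def scaleR_sum_right sum.distrib[symmetric]
        by (intro sum.cong refl) (simp only: scaleR_scaleR scaleR_add_left[symmetric], simp add: algebra_simps)
    qed
    then have "circle_modular p (\<lambda>x. \<Sum>j\<in>S. (if \<bar>k j\<bar> \<le> int n then cos (of_int (k j) * x + \<phi> j) else 0) *\<^sub>R a j)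
      = circle_modular p (\<lambda>x. 2 *\<^sub>R f2 x + (-1) *\<^sub>R f1 x)" by simp
    also have "\<dots> \<le> 2 powr (p - 1) * (circle_modular p (\<lambda>x. 2 *\<^sub>R f2 x) + circle_modular p (\<lambda>x. (-1) *\<^sub>R f1 x))"
      using p cf by (intro circle_modular_add continuous_intros) auto
    also have "\<dots> = 2 powr (p - 1) * (2 powr p * circle_modular p f2 + circle_modular p f1)"
      unfolding circle_modular_scaleR by simp
    also have "\<dots> \<le> 2 powr (p - 1) * (2 powr p * (C * (C * circle_modular p f)) + C * circle_modular p f)"
    proof -
      have "circle_modular p f2 \<le> C * (C * circle_modular p f)"
        by (rule order_trans[OF 2]) (rule mult_left_mono[OF 1 C(1)])
      then show ?thesis using 1 by (intro mult_left_mono add_mono) auto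
    qed
    also have "\<dots> = 2 powr (p - 1) * (2 powr p * (C * C) + C) * circle_modular p f"
      by (simp add: algebra_simps)
    finally show "circle_modular p (\<lambda>x. \<Sum>j\<in>S. (if \<bar>k j\<bar> \<le> int n then cos (of_int (k j) * x + \<phi> j) else 0) *\<^sub>R a j)
       \<le> 2 powr (p - 1) * (2 powr p * (C * C) + C) * circle_modular p (\<lambda>x. \<Sum>j\<in>S. cos (of_int (k j) * x + \<phi> j) *\<^sub>R a j)"
      unfolding f_def .
  qed
qed

text \<open>The reflection of x to 2 * pi - x fixes cosines and changes the sign of sines. Half the
  sum, respectively half the difference, of the partial sum and its reflection isolates one
  part.\<close>

lemma trig_partial_sums_bounded:
  fixes sc :: "'k::real_normed_field \<Rightarrow> 'x::banach \<Rightarrow> 'x"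
  assumes sc: "normed_scaling sc" and umd: "UMD sc" and p: "1 < p"
  obtains C where "0 \<le> C"
    "\<And>N (a :: nat \<Rightarrow> 'x) b n.
       circle_modular p (\<lambda>x. \<Sum>k\<le>N. (if k \<le> n then cos (real k * x) else 0) *\<^sub>R a k)
       \<le> C * circle_modular p (\<lambda>x. \<Sum>k\<le>N. cos (real k * x) *\<^sub>R a k + sin (real k * x) *\<^sub>R b k)"
    "\<And>N (a :: nat \<Rightarrow> 'x) b n.
       circle_modular p (\<lambda>x. \<Sum>k\<le>N. (if k \<le> n then sin (real k * x) else 0) *\<^sub>R b k)
       \<le> C * circle_modular p (\<lambda>x. \<Sum>k\<le>N. cos (real k * x) *\<^sub>R a k + sin (real k * x) *\<^sub>R b k)"
proof -
  obtain C where C: "0 \<le> C"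
    "\<And>(S :: (nat \<times> bool) set) k \<phi> (a :: nat \<times> bool \<Rightarrow> 'x) n. finite S \<Longrightarrow>
       circle_modular p (\<lambda>x. \<Sum>j\<in>S. (if \<bar>k j\<bar> \<le> int n then cos (of_int (k j) * x + \<phi> j) else 0) *\<^sub>R a j)
       \<le> C * circle_modular p (\<lambda>x. \<Sum>j\<in>S. cos (of_int (k j) * x + \<phi> j) *\<^sub>R a j)"
    using partial_sums_bounded[OF assms, where 'i="nat \<times> bool"] by blast
  have main: "circle_modular p (\<lambda>x. \<Sum>k\<le>N. (if k \<le> n then cos (real k * x) else 0) *\<^sub>R a k)
       \<le> C * circle_modular p (\<lambda>x. \<Sum>k\<le>N. cos (real k * x) *\<^sub>R a k + sin (real k * x) *\<^sub>R b k) \<and>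
     circle_modular p (\<lambda>x. \<Sum>k\<le>N. (if k \<le> n then sin (real k * x) else 0) *\<^sub>R b k)
       \<le> C * circle_modular p (\<lambda>x. \<Sum>k\<le>N. cos (real k * x) *\<^sub>R a k + sin (real k * x) *\<^sub>R b k)" for N n and a b :: "nat \<Rightarrow> 'x"
  proof -
    define f where "f x = (\<Sum>k\<le>N. cos (real k * x) *\<^sub>R a k + sin (real k * x) *\<^sub>R b k)" for x
    define u where "u x = (\<Sum>k\<le>N. (if k \<le> n then cos (real k * x) else 0) *\<^sub>R a k)" for x
    define w where "w x = (\<Sum>k\<le>N. (if k \<le> n then sin (real k * x) else 0) *\<^sub>R b k)" for x
    define g where "g x = u x + w x" for x
    define S where "S = {..N} \<times> (UNIV :: bool set)"
    have sumS: "(\<Sum>i\<in>S. G i) = (\<Sum>j\<le>N. G (j, True) + G (j, False))" for G :: "nat \<times> bool \<Rightarrow> 'x"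
    proof -
      have "(\<Sum>i\<in>S. G i) = (\<Sum>j\<le>N. \<Sum>b\<in>UNIV. G (j, b))"
        unfolding S_def by (simp add: sum.cartesian_product)
      then show ?thesis by (simp add: UNIV_bool add.commute)
    qed
    define k where "k i = int (fst i)" for i :: "nat \<times> bool"
    define \<phi> where "\<phi> i = (if snd i then 0 else - pi / 2)" for i :: "nat \<times> bool"
    define c where "c i = (if snd i then a (fst i) else b (fst i))" for i :: "nat \<times> bool"
    have shift: "cos (t + - pi / 2) = sin t" for t :: real
      using cos_diff[of t "pi / 2"] by simp
    have f': "(\<Sum>j\<in>S. cos (of_int (k j) * x + \<phi> j) *\<^sub>R c j) = f x" for x
      unfolding sumS f_def k_def \<phi>_def c_def by (simp only: fst_conv snd_conv if_True if_False shift of_int_of_nat_eq add_0_right)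
    have g': "(\<Sum>j\<in>S. (if \<bar>k j\<bar> \<le> int n then cos (of_int (k j) * x + \<phi> j) else 0) *\<^sub>R c j) = g x" for x
      unfolding sumS g_def u_def w_def sum.distrib[symmetric] k_def \<phi>_def c_def
      by (simp only: fst_conv snd_conv if_True if_False shift of_int_of_nat_eq add_0_right abs_of_nat of_nat_le_iff)
    have g: "circle_modular p g \<le> C * circle_modular p f"
      using C(2)[of S k n \<phi> c] unfolding f' g' by (simp add: S_def)
    have cg: "continuous_on A (\<lambda>x. (if P then cos (real k * x) else 0 :: real))" "continuous_on A (\<lambda>x. (if P then sin (real k * x) else 0 :: real))" for A P k
      by (cases P; simp; intro continuous_intros)+
    have cont: "continuous_on A g" for A
      unfolding g_def u_def w_def by (intro continuous_intros cg)
    have contr: "continuous_on {0..2*pi} (\<lambda>x. g (2 * pi - x))"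
      by (rule continuous_on_compose2[OF cont[of UNIV]]) (auto intro!: continuous_intros)
    have ue: "u (2 * pi - x) = u x" for x unfolding u_def trig_reflect ..
    have wo: "w (2 * pi - x) = - w x" for x unfolding w_def trig_reflect sum_negf[symmetric] by (intro sum.cong) auto
    \<comment> \<open>The factor from halving exactly offsets the one from the triangle inequality,
      so the splitting costs nothing.\<close>
    have half: "(1/2 :: real) powr p * (2 powr (p - 1) * (G + G)) = G" for G
      using p by (simp add: powr_diff powr_divide)
    have "circle_modular p u = circle_modular p (\<lambda>x. (1/2) *\<^sub>R (g x + g (2 * pi - x)))"
      by (rule arg_cong[where f="circle_modular p"]) (auto simp: g_def ue wo simp flip: scaleR_2)
    also have "\<dots> = (1/2) powr p * circle_modular p (\<lambda>x. g x + g (2 * pi - x))"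
      unfolding circle_modular_scaleR by simp
    also have "\<dots> \<le> (1/2) powr p * (2 powr (p - 1) * (circle_modular p g + circle_modular p (\<lambda>x. g (2 * pi - x))))"
      by (intro mult_left_mono circle_modular_add cont contr p) auto
    also have "\<dots> = circle_modular p g" unfolding circle_modular_reflect[OF cont less_trans[OF zero_less_one p]] half ..
    finally have uu: "circle_modular p u \<le> circle_modular p g" .
    have "circle_modular p w = circle_modular p (\<lambda>x. (1/2) *\<^sub>R (g x + (-1) *\<^sub>R g (2 * pi - x)))"
      by (rule arg_cong[where f="circle_modular p"]) (auto simp: g_def ue wo simp flip: scaleR_2)
    also have "\<dots> = (1/2) powr p * circle_modular p (\<lambda>x. g x + (-1) *\<^sub>R g (2 * pi - x))"
      unfolding circle_modular_scaleR by simp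
    also have "\<dots> \<le> (1/2) powr p * (2 powr (p - 1) * (circle_modular p g + circle_modular p (\<lambda>x. (-1) *\<^sub>R g (2 * pi - x))))"
      by (intro mult_left_mono circle_modular_add cont contr p continuous_intros) auto
    also have "\<dots> = (1/2) powr p * (2 powr (p - 1) * (circle_modular p g + circle_modular p g))"
      unfolding circle_modular_scaleR circle_modular_reflect[OF cont less_trans[OF zero_less_one p]] by simp
    also have "\<dots> = circle_modular p g" by (rule half)
    finally have ww: "circle_modular p w \<le> circle_modular p g" .
    show ?thesis using uu ww g unfolding f_def u_def w_def by linarith
  qed
  show thesis by (rule that[OF C(1)]) (use main in blast)+
qed

section \<open>Bochner spaces\<close>

definition Lp_modular :: "'m measure \<Rightarrow> real \<Rightarrow> ('m \<Rightarrow> 'x::real_normed_vector) \<Rightarrow> real" where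
  "Lp_modular M p f = (\<integral>x. norm (f x) powr p \<partial>M)"

lemma Lp_norm_modular: "Lp_norm M p f = Lp_modular M p f powr (1 / p)"
  by (simp add: Lp_norm_def Lp_modular_def)

lemma Lp_modular_nonneg: "0 \<le> Lp_modular M p f"
  unfolding Lp_modular_def by (rule Bochner_Integration.integral_nonneg) simp

lemma Lp_modular_norm: "0 < p \<Longrightarrow> Lp_modular M p f = Lp_norm M p f powr p"
  using Lp_modular_nonneg[of M p f] by (simp add: Lp_norm_modular powr_powr)

lemma strongly_measurable_norm_powr:
  "strongly_measurable M f \<Longrightarrow> (\<lambda>x. norm (f x) powr p) \<in> borel_measurable M"
  using strongly_measurable_norm by measurable

lemma Lp_spaceD:
  assumes "f \<in> Lp_space M p"
  shows "strongly_measurable M f" "integrable M (\<lambda>x. norm (f x) powr p)"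
  using assms by (auto simp: Lp_space_def)

lemma Lp_space_dominated:
  assumes f: "strongly_measurable M f" and g: "integrable M g"
    and le: "\<And>x. x \<in> space M \<Longrightarrow> norm (f x) powr p \<le> g x"
  shows "f \<in> Lp_space M p" "Lp_modular M p f \<le> (\<integral>x. g x \<partial>M)"
proof -
  have i: "integrable M (\<lambda>x. norm (f x) powr p)"
    by (rule Bochner_Integration.integrable_bound[OF g strongly_measurable_norm_powr[OF f]])
       (use le in \<open>auto intro!: AE_I2 order_trans[OF le abs_ge_self]\<close>)
  then show "f \<in> Lp_space M p" using f by (simp add: Lp_space_def)
  show "Lp_modular M p f \<le> (\<integral>x. g x \<partial>M)"
    unfolding Lp_modular_def by (rule integral_mono[OF i g le])
qed

lemma Lp_add:
  assumes f: "f \<in> Lp_space M p" and g: "g \<in> Lp_space M p" and p: "1 < p"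
  shows "(\<lambda>x. f x + g x) \<in> Lp_space M p"
    "Lp_modular M p (\<lambda>x. f x + g x) \<le> 2 powr (p - 1) * (Lp_modular M p f + Lp_modular M p g)"
proof -
  note sm = strongly_measurable_add[OF Lp_spaceD(1)[OF f] Lp_spaceD(1)[OF g]]
  have i: "integrable M (\<lambda>x. 2 powr (p - 1) * (norm (f x) powr p + norm (g x) powr p))"
    using Lp_spaceD(2)[OF f] Lp_spaceD(2)[OF g] by simp
  have le: "norm (f x + g x) powr p \<le> 2 powr (p - 1) * (norm (f x) powr p + norm (g x) powr p)" for x
    using p by (intro norm_add_powr_le) simp
  show "(\<lambda>x. f x + g x) \<in> Lp_space M p" by (rule Lp_space_dominated(1)[OF sm i le])
  have "Lp_modular M p (\<lambda>x. f x + g x) \<le> (\<integral>x. 2 powr (p - 1) * (norm (f x) powr p + norm (g x) powr p) \<partial>M)"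
    by (rule Lp_space_dominated(2)[OF sm i le])
  also have "\<dots> = 2 powr (p - 1) * (Lp_modular M p f + Lp_modular M p g)"
    unfolding Lp_modular_def using Lp_spaceD(2)[OF f] Lp_spaceD(2)[OF g] by simp
  finally show "Lp_modular M p (\<lambda>x. f x + g x) \<le> 2 powr (p - 1) * (Lp_modular M p f + Lp_modular M p g)" .
qed

lemma Lp_scaleR:
  assumes f: "f \<in> Lp_space M p" and p: "1 < p" and g: "g \<in> borel_measurable M"
    and B: "0 \<le> B" "\<And>x. x \<in> space M \<Longrightarrow> \<bar>g x\<bar> \<le> B"
  shows "(\<lambda>x. g x *\<^sub>R f x) \<in> Lp_space M p"
    "Lp_modular M p (\<lambda>x. g x *\<^sub>R f x) \<le> B powr p * Lp_modular M p f"
proof -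
  note sm = strongly_measurable_scaleR[OF g Lp_spaceD(1)[OF f]]
  have i: "integrable M (\<lambda>x. B powr p * norm (f x) powr p)"
    using Lp_spaceD(2)[OF f] by simp
  have le: "norm (g x *\<^sub>R f x) powr p \<le> B powr p * norm (f x) powr p" if "x \<in> space M" for x
  proof -
    have "norm (g x *\<^sub>R f x) powr p = \<bar>g x\<bar> powr p * norm (f x) powr p" by (simp add: powr_mult)
    also have "\<dots> \<le> B powr p * norm (f x) powr p"
      using B(2)[OF that] p by (intro mult_right_mono powr_mono2) auto
    finally show ?thesis .
  qed
  show "(\<lambda>x. g x *\<^sub>R f x) \<in> Lp_space M p" by (rule Lp_space_dominated(1)[OF sm i le])
  show "Lp_modular M p (\<lambda>x. g x *\<^sub>R f x) \<le> B powr p * Lp_modular M p f"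
    using Lp_space_dominated(2)[OF sm i le] by (simp add: Lp_modular_def)
qed

lemma Lp_diff:
  assumes "f \<in> Lp_space M p" "g \<in> Lp_space M p" "1 < p"
  shows "(\<lambda>x. f x - g x) \<in> Lp_space M p"
    "Lp_modular M p (\<lambda>x. f x - g x) \<le> 2 powr (p - 1) * (Lp_modular M p f + Lp_modular M p g)"
proof -
  have n: "(\<lambda>x. (-1) *\<^sub>R g x) \<in> Lp_space M p" "Lp_modular M p (\<lambda>x. (-1) *\<^sub>R g x) = Lp_modular M p g"
    using Lp_scaleR(1)[OF assms(2,3), of "\<lambda>_. -1" 1] by (simp_all add: Lp_modular_def)
  from Lp_add[OF assms(1) n(1) assms(3)] n(2)
  show "(\<lambda>x. f x - g x) \<in> Lp_space M p"
    "Lp_modular M p (\<lambda>x. f x - g x) \<le> 2 powr (p - 1) * (Lp_modular M p f + Lp_modular M p g)"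
    by simp_all
qed

lemma Lp_zero: "1 < p \<Longrightarrow> (\<lambda>x. 0) \<in> Lp_space M p"
  by (simp add: Lp_space_def strongly_measurable_const)

lemma Lp_sum:
  assumes "1 < p" "\<And>i. i \<in> S \<Longrightarrow> f i \<in> Lp_space M p"
  shows "(\<lambda>x. \<Sum>i\<in>S. f i x) \<in> Lp_space M p"
  using assms(2)
  by (induction S rule: infinite_finite_induct) (auto intro: Lp_zero Lp_add assms(1))

section \<open>Integrability and approximation over a finite measure\<close>

context finite_measure
begin

lemma Lp_space_bounded:
  assumes f: "strongly_measurable M f" and B: "\<And>x. x \<in> space M \<Longrightarrow> norm (f x) \<le> B" and p: "1 < p"
  shows "f \<in> Lp_space M p" "Lp_modular M p f \<le> B powr p * measure M (space M)"
proof -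
  have le: "norm (f x) powr p \<le> B powr p" if "x \<in> space M" for x
    using B[OF that] p by (intro powr_mono2) auto
  show "f \<in> Lp_space M p" by (rule Lp_space_dominated(1)[OF f _ le]) auto
  show "Lp_modular M p f \<le> B powr p * measure M (space M)"
    using Lp_space_dominated(2)[OF f _ le] by (simp add: mult.commute)
qed

text \<open>Hoelder's inequality against the constant function, with a non-optimal constant: compare
  \<open>a\<close> with \<open>r + a powr p * r powr (1 - p)\<close> and take for \<open>r\<close> the \<open>Lp\<close> norm.\<close>

lemma Lp_integrable_norm:
  assumes f: "f \<in> Lp_space M p" and p: "1 < p"
  shows "integrable M (\<lambda>x. norm (f x))"
    "(\<integral>x. norm (f x) \<partial>M) \<le> (measure M (space M) + 1) * Lp_norm M p f"
proof -
  note fD = Lp_spaceD[OF f]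
  note [measurable] = strongly_measurable_norm[OF fD(1)]
  have young: "a \<le> r + r powr (1 - p) * a powr p" if "0 \<le> a" "0 < r" for a r :: real
  proof (cases "a \<le> r")
    case True then show ?thesis using that by (simp add: add_increasing2)
  next
    case False
    then have ar: "a > r" "a > 0" using that by auto
    have "1 = a powr (1 - p) * a powr (p - 1)" using ar by (simp flip: powr_add)
    also have "\<dots> \<le> r powr (1 - p) * a powr (p - 1)"
      using ar that p by (intro mult_right_mono powr_mono2') auto
    finally have "a * 1 \<le> a * (r powr (1 - p) * a powr (p - 1))" using ar by (intro mult_left_mono) auto
    also have "\<dots> = r powr (1 - p) * a powr p" using ar by (simp add: powr_diff)
    finally show ?thesis using that by simp
  qed
  have i: "integrable M (\<lambda>x. r + r powr (1 - p) * norm (f x) powr p)" for r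
    using fD(2) by simp
  show int: "integrable M (\<lambda>x. norm (f x))"
    by (rule Bochner_Integration.integrable_bound[OF i[of 1]]) (use young[of _ 1] in auto)
  have le: "(\<integral>x. norm (f x) \<partial>M) \<le> r * measure M (space M) + r powr (1 - p) * Lp_modular M p f" if r: "r > 0" for r
  proof -
    have "(\<integral>x. norm (f x) \<partial>M) \<le> (\<integral>x. r + r powr (1 - p) * norm (f x) powr p \<partial>M)"
      by (rule integral_mono[OF int i]) (use young r in auto)
    then show ?thesis using fD(2) by (simp add: Lp_modular_def mult.commute)
  qed
  show "(\<integral>x. norm (f x) \<partial>M) \<le> (measure M (space M) + 1) * Lp_norm M p f"
  proof (cases "Lp_modular M p f = 0")
    case True
    have "(\<integral>x. norm (f x) \<partial>M) \<le> 0 + e" if "e > 0" for e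
    proof -
      have "(\<integral>x. norm (f x) \<partial>M) \<le> (e / (measure M (space M) + 1)) * measure M (space M)"
        using le[of "e / (measure M (space M) + 1)"] that True by (simp add: add_nonneg_pos)
      also have "\<dots> \<le> e" using that by (simp add: divide_le_eq add_nonneg_pos)
      finally show ?thesis by simp
    qed
    then have "(\<integral>x. norm (f x) \<partial>M) \<le> 0" by (rule field_le_epsilon)
    then show ?thesis by (simp add: Lp_norm_modular True)
  next
    case False
    then have m: "Lp_modular M p f > 0" using Lp_modular_nonneg[of M p f] by simp
    define r where "r = Lp_norm M p f"
    have r: "r > 0" using m by (simp add: r_def Lp_norm_modular)
    have "Lp_modular M p f = r powr p" using p unfolding r_def by (intro Lp_modular_norm) simp
    then have "r powr (1 - p) * Lp_modular M p f = r" using r by (simp flip: powr_add)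
    with le[OF r] show ?thesis by (simp add: r_def algebra_simps)
  qed
qed

lemma Lp_modular_simple_approx:
  assumes f: "f \<in> Lp_space M p" and p: "1 < p" and e: "0 < e"
  obtains s where "simple_function M s" "s \<in> Lp_space M p" "Lp_modular M p (\<lambda>x. f x - s x) < e"
proof -
  note fD = Lp_spaceD[OF f]
  obtain s where s: "\<And>i::nat. simple_function M (s i)" "\<And>x. x \<in> space M \<Longrightarrow> (\<lambda>i. s i x) \<longlonglongrightarrow> f x"
    "\<And>i x. norm (s i x) \<le> 2 * norm (f x)"
    using strongly_measurable_approx[OF fD(1)] by blast
  have sLp: "s i \<in> Lp_space M p" for i
  proof (rule Lp_space_dominated(1)[OF strongly_measurable_simple[OF s(1)]])
    show "integrable M (\<lambda>x. 2 powr p * norm (f x) powr p)" using fD(2) by simp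
    have "norm (s i x) powr p \<le> (2 * norm (f x)) powr p" for x using s(3) p by (intro powr_mono2) auto
    then show "norm (s i x) powr p \<le> 2 powr p * norm (f x) powr p" for x by (simp add: powr_mult)
  qed
  have "(\<lambda>i. Lp_modular M p (\<lambda>x. f x - s i x)) \<longlonglongrightarrow> (\<integral>x. 0 \<partial>M)"
    unfolding Lp_modular_def
  proof (rule integral_dominated_convergence)
    show "integrable M (\<lambda>x. 3 powr p * norm (f x) powr p)" using fD(2) by simp
    show "(\<lambda>x. norm (f x - s i x) powr p) \<in> borel_measurable M" for i
      by (intro strongly_measurable_norm_powr strongly_measurable_diff fD strongly_measurable_simple s(1))
    show "AE x in M. (\<lambda>i. norm (f x - s i x) powr p) \<longlonglongrightarrow> 0"
    proof (rule AE_I2)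
      fix x assume "x \<in> space M"
      have "(\<lambda>i. norm (f x - s i x)) \<longlonglongrightarrow> norm (f x - f x)"
        by (intro tendsto_norm tendsto_diff tendsto_const s(2)) fact
      then have "(\<lambda>i. norm (f x - s i x) powr p) \<longlonglongrightarrow> 0 powr p"
        using p by (intro tendsto_powr2) auto
      then show "(\<lambda>i. norm (f x - s i x) powr p) \<longlonglongrightarrow> 0" using p by simp
    qed
    show "AE x in M. norm (norm (f x - s i x) powr p) \<le> 3 powr p * norm (f x) powr p" for i
    proof (rule AE_I2)
      fix x
      have "norm (f x - s i x) \<le> 3 * norm (f x)"
        using norm_triangle_ineq4[of "f x" "s i x"] s(3)[of i x] by linarith
      then have "norm (f x - s i x) powr p \<le> (3 * norm (f x)) powr p" using p by (intro powr_mono2) auto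
      then show "norm (norm (f x - s i x) powr p) \<le> 3 powr p * norm (f x) powr p" by (simp add: powr_mult)
    qed
  qed simp
  then have "\<forall>\<^sub>F i in sequentially. Lp_modular M p (\<lambda>x. f x - s i x) < e"
    using e by (intro order_tendstoD(2)) auto
  then obtain i where "Lp_modular M p (\<lambda>x. f x - s i x) < e" by (auto dest!: eventually_happens)
  then show thesis using that s(1) sLp by blast
qed

text \<open>A simple function is a finite sum of indicators times vectors, so approximating
  indicators by scalar functions from \<open>V\<close> suffices. The lemma serves both the
  trigonometric span and the span of the perturbed system.\<close>

lemma Lp_tensor_dense:
  fixes f :: "'a \<Rightarrow> 'x::real_normed_vector" and V :: "('a \<Rightarrow> real) set" and W :: "('a \<Rightarrow> 'x) set"
  assumes f: "f \<in> Lp_space M p" and p: "1 < p" and e: "0 < e"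
    and V: "\<And>A d. A \<in> sets M \<Longrightarrow> 0 < d \<Longrightarrow> \<exists>g\<in>V. Lp_modular M p (\<lambda>x. indicator A x - g x) < d"
    and VL: "V \<subseteq> Lp_space M p"
    and W0: "(\<lambda>x. 0) \<in> W" and W1: "\<And>g z. g \<in> V \<Longrightarrow> (\<lambda>x. g x *\<^sub>R z) \<in> W"
    and W2: "\<And>g h. g \<in> W \<Longrightarrow> h \<in> W \<Longrightarrow> (\<lambda>x. g x + h x) \<in> W"
  obtains g where "g \<in> W" "g \<in> Lp_space M p" "Lp_modular M p (\<lambda>x. f x - g x) < e"
proof -
  have VW: "(\<lambda>x. g x *\<^sub>R z) \<in> Lp_space M p" if "g \<in> V" for g and z :: 'x
  proof -
    have g: "strongly_measurable M g" "integrable M (\<lambda>x. \<bar>g x\<bar> powr p)"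
      using Lp_spaceD[of g] VL that by auto
    show ?thesis
    proof (rule Lp_space_dominated(1))
      show "strongly_measurable M (\<lambda>x. g x *\<^sub>R z)"
        by (rule strongly_measurable_bounded_linear[OF bounded_linear_scaleR_left g(1)])
      show "integrable M (\<lambda>x. \<bar>g x\<bar> powr p * norm z powr p)" using g(2) by simp
    qed (simp add: powr_mult)
  qed
  define e' where "e' = e / (2 * 2 powr (p - 1))"
  have e': "e' > 0" using e by (simp add: e'_def)
  obtain s where s: "simple_function M s" "s \<in> Lp_space M p" "Lp_modular M p (\<lambda>x. f x - s x) < e'"
    using Lp_modular_simple_approx[OF f p e'] by blast
  define Y where "Y = s ` space M"
  have Y: "finite Y" using s(1) by (simp add: Y_def simple_function_def)
  define A where "A y = s -` {y} \<inter> space M" for y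
  have A: "A y \<in> sets M" for y unfolding A_def by (rule simple_functionD(2)[OF s(1)])
  \<comment> \<open>The denominator is the factor lost in adding up the finitely many values of
    \<open>s\<close>; the 1 keeps it positive.\<close>
  define d where "d = e' / (real (card Y) powr (p - 1) * (\<Sum>y\<in>Y. norm y powr p) + 1)"
  have nn: "0 \<le> real (card Y) powr (p - 1) * (\<Sum>y\<in>Y. norm y powr p)" by (intro mult_nonneg_nonneg sum_nonneg) auto
  then have d: "d > 0" unfolding d_def using e' by (intro divide_pos_pos) auto
  obtain t where t: "\<And>y. t y \<in> V" "\<And>y. Lp_modular M p (\<lambda>x. indicator (A y) x - t y x) < d"
    using V[OF A d] by metis
  define g where "g x = (\<Sum>y\<in>Y. t y x *\<^sub>R y)" for x
  have gW: "g \<in> W"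
  proof -
    have "(\<lambda>x. \<Sum>y\<in>Z. t y x *\<^sub>R y) \<in> W" if "finite Z" for Z
      using that
    proof induction
      case (insert y Z)
      then show ?case using W2[OF W1[OF t(1), of y y] insert.IH] by simp
    qed (simp add: W0)
    from this[OF Y] show ?thesis unfolding g_def .
  qed
  have gL: "g \<in> Lp_space M p" unfolding g_def by (intro Lp_sum p VW t(1))
  have ind: "integrable M (\<lambda>x. \<bar>indicator (A y) x - t y x\<bar> powr p)" for y
  proof -
    have "(indicator (A y) :: 'a \<Rightarrow> real) \<in> Lp_space M p"
      by (rule Lp_space_bounded(1)[OF strongly_measurable_borel _ p, of _ 1])
         (use A in \<open>auto split: split_indicator\<close>)
    moreover have "t y \<in> Lp_space M p" using t(1) VL by blast
    ultimately show ?thesis using Lp_spaceD(2)[OF Lp_diff(1)[OF _ _ p]] by fastforce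
  qed
  have "Lp_modular M p (\<lambda>x. s x - g x) \<le> (\<integral>x. real (card Y) powr (p - 1) * (\<Sum>y\<in>Y. \<bar>indicator (A y) x - t y x\<bar> powr p * norm y powr p) \<partial>M)"
  proof (rule Lp_space_dominated(2))
    show "strongly_measurable M (\<lambda>x. s x - g x)" by (intro strongly_measurable_diff Lp_spaceD(1)[OF s(2)] Lp_spaceD(1)[OF gL])
    show "integrable M (\<lambda>x. real (card Y) powr (p - 1) * (\<Sum>y\<in>Y. \<bar>indicator (A y) x - t y x\<bar> powr p * norm y powr p))"
      using ind by simp
    fix x assume x: "x \<in> space M"
    have "s x = (\<Sum>y\<in>Y. indicator (A y) x *\<^sub>R y)"
    proof -
      have "(\<Sum>y\<in>Y. indicator (A y) x *\<^sub>R y) = (\<Sum>y\<in>Y. if y = s x then y else 0)"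
        by (intro sum.cong refl) (auto simp: A_def x split: split_indicator)
      also have "\<dots> = s x" using Y x by (simp add: sum.delta Y_def)
      finally show ?thesis by simp
    qed
    then have "s x - g x = (\<Sum>y\<in>Y. (indicator (A y) x - t y x) *\<^sub>R y)"
      by (simp add: g_def sum_subtractf scaleR_diff_left)
    then have "norm (s x - g x) powr p \<le> real (card Y) powr (p - 1) * (\<Sum>y\<in>Y. norm ((indicator (A y) x - t y x) *\<^sub>R y) powr p)"
      using norm_sum_powr_le[OF Y, of p "\<lambda>y. (indicator (A y) x - t y x) *\<^sub>R y"] p by simp
    then show "norm (s x - g x) powr p \<le> real (card Y) powr (p - 1) * (\<Sum>y\<in>Y. \<bar>indicator (A y) x - t y x\<bar> powr p * norm y powr p)"
      by (simp add: powr_mult)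
  qed
  also have "\<dots> = real (card Y) powr (p - 1) * (\<Sum>y\<in>Y. Lp_modular M p (\<lambda>x. indicator (A y) x - t y x) * norm y powr p)"
    using ind by (simp add: Lp_modular_def)
  also have "\<dots> \<le> real (card Y) powr (p - 1) * (\<Sum>y\<in>Y. d * norm y powr p)"
    using t(2) by (intro mult_left_mono sum_mono mult_right_mono) (auto intro: less_imp_le)
  also have "\<dots> = d * (real (card Y) powr (p - 1) * (\<Sum>y\<in>Y. norm y powr p))"
    by (simp add: mult_ac flip: sum_distrib_left)
  also have "\<dots> \<le> e'"
  proof -
    define K where "K = real (card Y) powr (p - 1) * (\<Sum>y\<in>Y. norm y powr p)"
    have K: "0 \<le> K" using nn by (simp add: K_def)
    have "d * (K + 1) = e'" using K by (simp add: d_def K_def[symmetric])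
    then show ?thesis using K d unfolding K_def[symmetric] by (simp add: algebra_simps)
  qed
  finally have sg: "Lp_modular M p (\<lambda>x. s x - g x) \<le> e'" .
  have "Lp_modular M p (\<lambda>x. (f x - s x) + (s x - g x)) \<le> 2 powr (p - 1) * (Lp_modular M p (\<lambda>x. f x - s x) + Lp_modular M p (\<lambda>x. s x - g x))"
    by (rule Lp_add(2)[OF Lp_diff(1)[OF f s(2) p] Lp_diff(1)[OF s(2) gL p] p])
  also have "\<dots> < 2 powr (p - 1) * (e' + e')"
    using s(3) sg by (intro mult_strict_left_mono add_less_le_mono) auto
  also have "\<dots> = e" by (simp add: e'_def)
  finally have "Lp_modular M p (\<lambda>x. f x - g x) < e" by simp
  then show thesis by (rule that[OF gW gL])
qed

end

section \<open>Integrals over the interval and approximation of indicators\<close>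

lemma measure_I_measure: "measure I_measure (space I_measure) = 2 * pi"
  by (simp add: measure_restrict_space)

lemma finite_measure_I: "finite_measure I_measure"
  by (rule finite_measureI) (simp add: emeasure_restrict_space)

interpretation I: finite_measure I_measure
  by (rule finite_measure_I)

lemma continuous_borel_I:
  fixes h :: "real \<Rightarrow> real"
  assumes "continuous_on {0..2*pi} h"
  shows "h \<in> borel_measurable I_measure"
  by (rule continuous_imp_measurable_on_sets_lebesgue) (auto intro: continuous_on_subset[OF assms])

lemma integral_I_measure:
  fixes h :: "real \<Rightarrow> real"
  assumes h: "continuous_on {0..2*pi} h"
  shows "integrable I_measure h" "(\<integral>x. h x \<partial>I_measure) = integral {0..2*pi} h"
proof -
  have "bounded (h ` {0..2*pi})" by (rule compact_imp_bounded[OF compact_continuous_image[OF h]]) simp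
  then obtain B where B: "\<And>x. x \<in> {0..2*pi} \<Longrightarrow> \<bar>h x\<bar> \<le> B"
    unfolding bounded_iff real_norm_def by blast
  show i: "integrable I_measure h"
    by (rule I.integrable_const_bound[of _ B]) (use B continuous_borel_I[OF h] in auto)
  have "(\<integral>x. h x \<partial>I_measure) = integral {0<..<2*pi} h"
    by (rule lebesgue_integral_eq_integral[OF i]) simp
  then show "(\<integral>x. h x \<partial>I_measure) = integral {0..2*pi} h"
    by (simp add: integral_open_interval_real)
qed

text \<open>A measurable function is almost everywhere a limit of continuous ones; clipping them to
  [0, 1] makes dominated convergence applicable. The zeros at the end points give periodicity, also
  after multiplication by 2 * pi - x.\<close>

lemma indicator_continuous_approx:
  assumes A: "A \<in> sets I_measure" and d: "0 < d"
  obtains h :: "real \<Rightarrow> real" where "continuous_on UNIV h" "h 0 = 0" "h (2*pi) = 0" "\<And>x. 0 \<le> h x" "\<And>x. h x \<le> 1"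
    "(\<integral>x. \<bar>indicator A x - h x\<bar> \<partial>I_measure) < d"
proof -
  have A': "A \<in> sets lebesgue" "A \<subseteq> {0<..<2*pi}"
    using A by (auto simp: sets_restrict_space)
  have "(indicator A :: real \<Rightarrow> real) measurable_on UNIV"
    by (rule lebesgue_measurable_imp_measurable_on) (use A' in auto)
  then obtain N g where N: "negligible N" and g: "\<And>n. continuous_on UNIV (g n)"
    "\<And>x. x \<notin> N \<Longrightarrow> (\<lambda>n::nat. g n x) \<longlonglongrightarrow> (indicator A x :: real)"
    unfolding measurable_on_def by auto
  \<comment> \<open>A trapezoidal cutoff that vanishes at both end points and is eventually 1 at
    every interior point.\<close>
  define c where "c n x = min 1 (max 0 (min (real n * x) (real n * (2*pi - x))))" for n :: nat and x
  define h where "h n x = c n x * min 1 (max 0 (g n x))" for n x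
  have ch: "continuous_on UNIV (h n)" for n
    unfolding h_def c_def by (intro continuous_intros g)
  have h01: "0 \<le> h n x" "h n x \<le> 1" for n x
    unfolding h_def c_def by (auto intro!: mult_le_one)
  have h0: "h n 0 = 0" "h n (2*pi) = 0" for n by (auto simp: h_def c_def)
  have clim: "(\<lambda>n. c n x) \<longlonglongrightarrow> 1" if x: "x \<in> {0<..<2*pi}" for x
  proof -
    define y where "y = min x (2*pi - x)"
    have y: "y > 0" using x by (simp add: y_def)
    obtain n0 :: nat where n0: "n0 > 1 / y" using reals_Archimedean2 by blast
    have "c n x = 1" if "n \<ge> n0" for n
    proof -
      have "1 / y \<le> real n" using n0 that by linarith
      then have "1 \<le> real n * y" using y by (simp add: divide_le_eq)
      moreover have "real n * y \<le> real n * x" "real n * y \<le> real n * (2*pi - x)"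
        by (auto simp: y_def intro!: mult_left_mono)
      ultimately show ?thesis unfolding c_def by simp
    qed
    then show ?thesis by (intro tendsto_eventually eventually_sequentiallyI[of n0])
  qed
  have "(\<lambda>n. \<integral>x. \<bar>indicator A x - h n x\<bar> \<partial>I_measure) \<longlonglongrightarrow> (\<integral>x. 0 \<partial>I_measure)"
  proof (rule integral_dominated_convergence)
    show "integrable I_measure (\<lambda>x. 1 :: real)" by simp
    have [measurable]: "h n \<in> borel_measurable I_measure" for n
      by (rule continuous_borel_I) (rule continuous_on_subset[OF ch], simp)
    have [measurable]: "A \<in> sets I_measure" by fact
    show "(\<lambda>x. \<bar>indicator A x - h n x\<bar>) \<in> borel_measurable I_measure" for n by measurable
    have "AE x in I_measure. x \<notin> N"
    proof -
      have "N \<in> null_sets lebesgue" using N by (simp add: negligible_iff_null_sets)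
      then have "AE x in lebesgue. x \<notin> N" by (rule AE_not_in)
      then show ?thesis by (subst AE_restrict_space_iff) auto
    qed
    then show "AE x in I_measure. (\<lambda>n. \<bar>indicator A x - h n x\<bar>) \<longlonglongrightarrow> 0"
      using AE_space
    proof eventually_elim
      case (elim x)
      have "(\<lambda>n. h n x) \<longlonglongrightarrow> 1 * min 1 (max 0 (indicator A x))"
        unfolding h_def using elim by (intro tendsto_mult clim tendsto_min tendsto_max tendsto_const g(2)) auto
      moreover have "1 * min 1 (max 0 (indicator A x)) = (indicator A x :: real)" by (auto split: split_indicator)
      ultimately have "(\<lambda>n. \<bar>indicator A x - h n x\<bar>) \<longlonglongrightarrow> \<bar>indicator A x - indicator A x\<bar>"
        by (intro tendsto_rabs tendsto_diff tendsto_const) simp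
      then show ?case by simp
    qed
    show "AE x in I_measure. norm \<bar>indicator A x - h n x\<bar> \<le> 1" for n
      using h01[of n] by (intro AE_I2) (auto split: split_indicator)
  qed simp
  then have "\<forall>\<^sub>F n in sequentially. (\<integral>x. \<bar>indicator A x - h n x\<bar> \<partial>I_measure) < d"
    using d by (intro order_tendstoD(2)) auto
  then obtain n where "(\<integral>x. \<bar>indicator A x - h n x\<bar> \<partial>I_measure) < d" by (auto dest!: eventually_happens)
  then show thesis by (rule that[OF ch h0 h01])
qed

text \<open>The difference of the indicator and its continuous approximant is at most 1, so its p-th
  power is dominated by the difference itself and L1 closeness is enough.\<close>

lemma indicator_Lp_approx:
  fixes V :: "(real \<Rightarrow> real) set"
  assumes A: "A \<in> sets I_measure" and d: "0 < d" and p: "1 < p"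
    and V: "\<And>h e. continuous_on {0..2*pi} h \<Longrightarrow> h 0 = 0 \<Longrightarrow> h (2*pi) = 0 \<Longrightarrow> 0 < e \<Longrightarrow>
        \<exists>g\<in>V. \<forall>x\<in>{0..2*pi}. \<bar>h x - g x\<bar> \<le> e"
    and Vc: "\<And>g. g \<in> V \<Longrightarrow> continuous_on {0..2*pi} g"
  shows "\<exists>g\<in>V. Lp_modular I_measure p (\<lambda>x. indicator A x - g x) < d"
proof -
  define d' where "d' = d / (2 powr (p - 1) * 2)"
  have d': "d' > 0" using d by (simp add: d'_def)
  obtain h where h: "continuous_on UNIV h" "h 0 = 0" "h (2*pi) = 0" "\<And>x. 0 \<le> h x" "\<And>x. h x \<le> 1"
    "(\<integral>x. \<bar>indicator A x - h x\<bar> \<partial>I_measure) < d'"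
    using indicator_continuous_approx[OF A d'] by blast
  have ch: "continuous_on {0..2*pi} h" by (rule continuous_on_subset[OF h(1)]) simp
  \<comment> \<open>Uniform closeness e on a set of measure 2 * pi gives at most e^p * 2 * pi, which
    is below \<open>d'\<close>.\<close>
  define e where "e = (d' / (2 * pi + 1)) powr (1 / p)"
  have pos: "2 * pi + 1 > 0" using pi_gt_zero by linarith
  have e: "e > 0" using d' pos by (simp add: e_def)
  obtain g where g: "g \<in> V" "\<And>x. x \<in> {0..2*pi} \<Longrightarrow> \<bar>h x - g x\<bar> \<le> e"
    using V[OF ch h(2,3) e] by blast
  note [measurable] = continuous_borel_I[OF ch] continuous_borel_I[OF Vc[OF g(1)]] A
  have sA: "strongly_measurable I_measure (\<lambda>x. indicator A x - h x)"
    by (rule strongly_measurable_borel) measurable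
  have iA: "integrable I_measure (\<lambda>x. \<bar>indicator A x - h x\<bar>)"
    by (rule I.integrable_const_bound[of _ 1]) (use h(4,5) in \<open>auto split: split_indicator\<close>)
  have leA: "norm (indicator A x - h x) powr p \<le> \<bar>indicator A x - h x\<bar>" for x
  proof -
    have "\<bar>indicator A x - h x\<bar> \<le> 1" using h(4,5)[of x] by (auto split: split_indicator)
    then have "\<bar>indicator A x - h x\<bar> powr p \<le> \<bar>indicator A x - h x\<bar> powr 1" using p by (intro powr_mono') auto
    then show ?thesis by simp
  qed
  have 1: "(\<lambda>x. indicator A x - h x) \<in> Lp_space I_measure p" "Lp_modular I_measure p (\<lambda>x. indicator A x - h x) < d'"
    using Lp_space_dominated[OF sA iA leA] h(6) by auto
  have sg: "strongly_measurable I_measure (\<lambda>x. h x - g x)"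
    by (rule strongly_measurable_borel) measurable
  have "Lp_modular I_measure p (\<lambda>x. h x - g x) \<le> e powr p * measure I_measure (space I_measure)"
    by (rule I.Lp_space_bounded(2)[OF sg _ p]) (use g(2) in auto)
  also have "\<dots> = (d' / (2 * pi + 1)) * (2 * pi)"
    unfolding measure_I_measure e_def using p d' pos by (simp add: powr_powr)
  also have "\<dots> \<le> d'" using d' pos by (simp add: field_simps)
  finally have 2: "Lp_modular I_measure p (\<lambda>x. h x - g x) \<le> d'" .
  have 3: "(\<lambda>x. h x - g x) \<in> Lp_space I_measure p"
    by (rule I.Lp_space_bounded(1)[OF sg _ p, of e]) (use g(2) in auto)
  have "Lp_modular I_measure p (\<lambda>x. (indicator A x - h x) + (h x - g x))
     \<le> 2 powr (p - 1) * (Lp_modular I_measure p (\<lambda>x. indicator A x - h x) + Lp_modular I_measure p (\<lambda>x. h x - g x))"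
    by (rule Lp_add(2)[OF 1(1) 3 p])
  also have "\<dots> < 2 powr (p - 1) * (d' + d')"
    using 1(2) 2 by (intro mult_strict_left_mono add_less_le_mono) auto
  also have "\<dots> = d" by (simp add: d'_def)
  finally have "Lp_modular I_measure p (\<lambda>x. indicator A x - g x) < d" by simp
  with g(1) show ?thesis by blast
qed

section \<open>Dense subspaces and biorthonormality\<close>

text \<open>The coefficients are explicit because the partial-sum bounds are formulated through
  them.\<close>

definition trig_span :: "(real \<Rightarrow> 'x::real_vector) set" where
  "trig_span = {f. \<exists>N a b. \<forall>x. f x = (\<Sum>k\<le>N. cos (real k * x) *\<^sub>R a k + sin (real k * x) *\<^sub>R b k)}"

lemma trig_spanI:
  "(\<And>x. f x = (\<Sum>k\<le>N. cos (real k * x) *\<^sub>R a k + sin (real k * x) *\<^sub>R b k)) \<Longrightarrow> f \<in> trig_span"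
  unfolding trig_span_def by (rule CollectI) (intro exI allI)

lemma trig_span_zero: "(\<lambda>x. 0) \<in> trig_span"
  unfolding trig_span_def by (auto intro!: exI[of _ 0] exI[of _ "\<lambda>_. 0"])

lemma trig_span_add:
  assumes "f \<in> trig_span" "g \<in> trig_span"
  shows "(\<lambda>x. f x + g x) \<in> trig_span"
proof -
  obtain N a b where f: "\<And>x. f x = (\<Sum>k\<le>N. cos (real k * x) *\<^sub>R a k + sin (real k * x) *\<^sub>R b k)"
    using assms(1) unfolding trig_span_def by blast
  obtain N' a' b' where g: "\<And>x. g x = (\<Sum>k\<le>N'. cos (real k * x) *\<^sub>R a' k + sin (real k * x) *\<^sub>R b' k)"
    using assms(2) unfolding trig_span_def by blast
  have pad: "(\<Sum>k\<le>m. cos (real k * x) *\<^sub>R a k + sin (real k * x) *\<^sub>R b k)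
      = (\<Sum>k\<le>m + n. cos (real k * x) *\<^sub>R (if k \<le> m then a k else 0) + sin (real k * x) *\<^sub>R (if k \<le> m then b k else 0))"
    for m n x and a b :: "nat \<Rightarrow> 'a"
    by (rule sum.mono_neutral_cong_left) auto
  have F: "f x = (\<Sum>k\<le>N + N'. cos (real k * x) *\<^sub>R (if k \<le> N then a k else 0) + sin (real k * x) *\<^sub>R (if k \<le> N then b k else 0))" for x
    unfolding f by (rule pad)
  have G: "g x = (\<Sum>k\<le>N + N'. cos (real k * x) *\<^sub>R (if k \<le> N' then a' k else 0) + sin (real k * x) *\<^sub>R (if k \<le> N' then b' k else 0))" for x
    unfolding g by (subst add.commute[of N N']) (rule pad)
  have "f x + g x = (\<Sum>k\<le>N + N'. cos (real k * x) *\<^sub>R ((if k \<le> N then a k else 0) + (if k \<le> N' then a' k else 0))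
      + sin (real k * x) *\<^sub>R ((if k \<le> N then b k else 0) + (if k \<le> N' then b' k else 0)))" for x
    unfolding F G by (simp only: scaleR_add_right sum.distrib add_ac)
  then show ?thesis by (rule trig_spanI)
qed

lemma trig_span_trig_poly: "trig_poly g \<Longrightarrow> (\<lambda>x. g x *\<^sub>R z) \<in> trig_span"
proof (induction arbitrary: z rule: trig_poly.induct)
  case (cos k)
  have "cos (real k * x) *\<^sub>R z = (\<Sum>i\<le>k. cos (real i * x) *\<^sub>R (if i = k then z else 0) + sin (real i * x) *\<^sub>R 0)" for x
    by (simp add: sum.delta if_distrib[of "\<lambda>a. _ *\<^sub>R a"] cong: if_cong)
  then show ?case by (rule trig_spanI)
next
  case (sin k)
  have "sin (real k * x) *\<^sub>R z = (\<Sum>i\<le>k. cos (real i * x) *\<^sub>R 0 + sin (real i * x) *\<^sub>R (if i = k then z else 0))" for x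
    by (simp add: sum.delta if_distrib[of "\<lambda>a. _ *\<^sub>R a"] cong: if_cong)
  then show ?case by (rule trig_spanI)
next
  case (cmult f c)
  have "(\<lambda>x. (c * f x) *\<^sub>R z) = (\<lambda>x. f x *\<^sub>R (c *\<^sub>R z))" by (simp add: mult.commute)
  then show ?case by (simp only: cmult.IH)
next
  case (add f g)
  then show ?case using trig_span_add[OF add.IH(1)[of z] add.IH(2)[of z]] by (simp add: scaleR_add_left)
qed

lemma continuous_Lp_I:
  fixes g :: "real \<Rightarrow> real"
  assumes g: "continuous_on {0..2*pi} g" and p: "1 < p"
  shows "g \<in> Lp_space I_measure p"
proof -
  have "continuous_on {0..2*pi} (\<lambda>x. \<bar>g x\<bar> powr p)"
    using continuous_on_norm_powr[OF g, of p] p by simp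
  then show ?thesis
    using strongly_measurable_borel[OF continuous_borel_I[OF g]] integral_I_measure(1) by (simp add: Lp_space_def)
qed

lemma Lp_modular_eq_circle_modular:
  assumes "continuous_on {0..2*pi} f" "1 < p"
  shows "Lp_modular I_measure p f = circle_modular p f"
  unfolding Lp_modular_def circle_modular_def
  using assms by (intro integral_I_measure(2) continuous_on_norm_powr) auto

lemma trig_span_dense:
  fixes f :: "real \<Rightarrow> 'x::real_normed_vector"
  assumes f: "f \<in> Lp_space I_measure p" and p: "1 < p" and e: "0 < e"
  obtains g where "g \<in> trig_span" "g \<in> Lp_space I_measure p" "Lp_modular I_measure p (\<lambda>x. f x - g x) < e"
proof (rule I.Lp_tensor_dense[OF f p e, of "Collect trig_poly" trig_span])
  fix A :: "real set" and d :: real assume A: "A \<in> sets I_measure" and d: "0 < d"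
  show "\<exists>g\<in>Collect trig_poly. Lp_modular I_measure p (\<lambda>x. indicator A x - g x) < d"
  proof (rule indicator_Lp_approx[OF A d p])
    fix h :: "real \<Rightarrow> real" and e :: real assume "continuous_on {0..2*pi} h" "h 0 = 0" "h (2*pi) = 0" "0 < e"
    then show "\<exists>g\<in>Collect trig_poly. \<forall>x\<in>{0..2*pi}. \<bar>h x - g x\<bar> \<le> e"
      by (metis trig_poly_approx less_imp_le mem_Collect_eq)
  qed (simp add: trig_poly_continuous)
next
  show "Collect trig_poly \<subseteq> Lp_space I_measure p"
    using continuous_Lp_I[OF trig_poly_continuous p] by auto
qed (use that in \<open>auto intro: trig_span_zero trig_span_add trig_span_trig_poly\<close>)

section \<open>The span of the perturbed system and its density\<close>

definition phi_span :: "(real \<Rightarrow> 'x::real_vector) set" where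
  "phi_span = {f. \<exists>F z. finite F \<and> F \<subseteq> trig_indices \<and> (\<forall>x. f x = (\<Sum>k\<in>F. phi_real k x *\<^sub>R z k))}"

lemma phi_span_zero: "(\<lambda>x. 0) \<in> phi_span"
  unfolding phi_span_def by (auto intro!: exI[of _ "{}"])

lemma phi_span_add:
  assumes "f \<in> phi_span" "g \<in> phi_span"
  shows "(\<lambda>x. f x + g x) \<in> phi_span"
proof -
  obtain F z where f: "finite F" "F \<subseteq> trig_indices" "\<And>x. f x = (\<Sum>k\<in>F. phi_real k x *\<^sub>R z k)"
    using assms(1) unfolding phi_span_def by blast
  obtain G w where g: "finite G" "G \<subseteq> trig_indices" "\<And>x. g x = (\<Sum>k\<in>G. phi_real k x *\<^sub>R w k)"
    using assms(2) unfolding phi_span_def by blast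
  have "f x = (\<Sum>k\<in>F \<union> G. phi_real k x *\<^sub>R (if k \<in> F then z k else 0))" for x
    unfolding f(3) by (rule sum.mono_neutral_cong_left) (use f g in auto)
  moreover have "g x = (\<Sum>k\<in>F \<union> G. phi_real k x *\<^sub>R (if k \<in> G then w k else 0))" for x
    unfolding g(3) by (rule sum.mono_neutral_cong_left) (use f g in auto)
  ultimately have "f x + g x = (\<Sum>k\<in>F \<union> G. phi_real k x *\<^sub>R ((if k \<in> F then z k else 0) + (if k \<in> G then w k else 0)))" for x
    by (simp only: scaleR_add_right sum.distrib)
  then show ?thesis unfolding phi_span_def using f(1,2) g(1,2)
    by (intro CollectI exI[of _ "F \<union> G"] exI conjI allI) auto
qed

lemma phi_span_tensor:
  fixes g :: "real \<Rightarrow> real"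
  assumes "g \<in> phi_span"
  shows "(\<lambda>x. g x *\<^sub>R z) \<in> phi_span"
proof -
  obtain F c where "finite F" "F \<subseteq> trig_indices" "\<And>x. g x = (\<Sum>k\<in>F. phi_real k x *\<^sub>R c k)"
    using assms unfolding phi_span_def by blast
  then show ?thesis unfolding phi_span_def
    by (intro CollectI exI[of _ F] exI[of _ "\<lambda>k. c k *\<^sub>R z"]) (auto simp: scaleR_sum_left)
qed

lemma phi_span_cmult: "g \<in> phi_span \<Longrightarrow> (\<lambda>x. c * g x :: real) \<in> phi_span"
  using phi_span_tensor[of g c] by (simp add: mult.commute)

lemma phi_span_phi: "k \<in> trig_indices \<Longrightarrow> phi_real k \<in> phi_span"
  unfolding phi_span_def by (intro CollectI exI[of _ "{k}"] exI[of _ "\<lambda>_. 1"]) auto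

lemma continuous_phi_real: "continuous_on A (phi_real k)"
proof (cases k)
  case (CosIx n)
  then have "phi_real k = (\<lambda>x. cos (real n * x))" by auto
  then show ?thesis by (simp add: continuous_intros)
next
  case (SinIx n)
  then have "phi_real k = (\<lambda>x. (- 1 / (2 * real n)) * x * sin (real n * x))" by auto
  then show ?thesis by (simp only:) (intro continuous_intros)
qed

lemma continuous_v_real: "continuous_on A (v_real k)"
proof (cases k)
  case (CosIx n)
  then have "v_real k = (\<lambda>x. (if n = 0 then 1 / (2 * pi\<^sup>2) else 1 / pi\<^sup>2) * (2 * pi - x) * cos (real n * x))" by auto
  then show ?thesis by (simp only:) (intro continuous_intros)
next
  case (SinIx n)
  then have "v_real k = (\<lambda>x. (- (2 * real n / pi\<^sup>2)) * sin (real n * x))" by auto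
  then show ?thesis by (simp only:) (intro continuous_intros)
qed

lemma phi_span_continuous:
  fixes g :: "real \<Rightarrow> 'x::real_normed_vector"
  assumes "g \<in> phi_span" shows "continuous_on A g"
proof -
  obtain F z where "\<And>x. g x = (\<Sum>k\<in>F. phi_real k x *\<^sub>R z k)"
    using assms unfolding phi_span_def by blast
  then have "g = (\<lambda>x. \<Sum>k\<in>F. phi_real k x *\<^sub>R z k)" by auto
  then show ?thesis by (simp only:) (intro continuous_intros continuous_phi_real)
qed

text \<open>About the midpoint pi, the even part of a trigonometric polynomial has cosines only and
  the odd part sines only; multiplying the latter by x produces the functions with index
  \<open>SinIx\<close>.\<close>

lemma phi_span_even_odd:
  assumes "trig_poly g"
  shows "(\<lambda>x. g x + g (2 * pi - x)) \<in> phi_span" "(\<lambda>x. x * (g x - g (2 * pi - x))) \<in> phi_span"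
proof -
  have "(\<lambda>x. g x + g (2 * pi - x)) \<in> phi_span \<and> (\<lambda>x. x * (g x - g (2 * pi - x))) \<in> phi_span"
    using assms
  proof (induction rule: trig_poly.induct)
    case (cos k)
    have "(\<lambda>x. 2 * phi_real (CosIx k) x) \<in> phi_span"
      by (intro phi_span_cmult phi_span_phi) (auto simp: trig_indices_def)
    moreover have "(\<lambda>x. 2 * phi_real (CosIx k) x) = (\<lambda>x. 2 * cos (real k * x))" by auto
    ultimately show ?case unfolding trig_reflect by (simp add: phi_span_zero)
  next
    case (sin k)
    have "(\<lambda>x. x * (2 * sin (real k * x))) \<in> phi_span"
    proof (cases "k = 0")
      case True then show ?thesis by (simp add: phi_span_zero)
    next
      case False
      have "(\<lambda>x. (- 4 * real k) * phi_real (SinIx k) x) \<in> phi_span"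
        using False by (intro phi_span_cmult phi_span_phi) (auto simp: trig_indices_def)
      moreover have "(\<lambda>x. (- 4 * real k) * phi_real (SinIx k) x) = (\<lambda>x. x * (2 * sin (real k * x)))" using False by auto
      ultimately show ?thesis by simp
    qed
    then show ?case unfolding trig_reflect by (simp add: phi_span_zero)
  next
    case (cmult f c)
    have "(\<lambda>x. c * f x + c * f (2 * pi - x)) = (\<lambda>x. c * (f x + f (2 * pi - x)))"
      "(\<lambda>x. x * (c * f x - c * f (2 * pi - x))) = (\<lambda>x. c * (x * (f x - f (2 * pi - x))))"
      by (auto simp: algebra_simps)
    then show ?case using cmult.IH phi_span_cmult by simp
  next
    case (add f g)
    have "(\<lambda>x. f x + g x + (f (2 * pi - x) + g (2 * pi - x))) = (\<lambda>x. (f x + f (2 * pi - x)) + (g x + g (2 * pi - x)))"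
      "(\<lambda>x. x * (f x + g x - (f (2 * pi - x) + g (2 * pi - x)))) = (\<lambda>x. x * (f x - f (2 * pi - x)) + x * (g x - g (2 * pi - x)))"
      by (auto simp: algebra_simps)
    moreover have "(\<lambda>x. (f x + f (2 * pi - x)) + (g x + g (2 * pi - x))) \<in> phi_span"
      using add.IH by (auto intro: phi_span_add[of "\<lambda>x. f x + f (2 * pi - x)"] phi_span_add[of "\<lambda>x. x * (f x - f (2 * pi - x))"])
    moreover have "(\<lambda>x. x * (f x - f (2 * pi - x)) + x * (g x - g (2 * pi - x))) \<in> phi_span"
      using add.IH by (auto intro: phi_span_add[of "\<lambda>x. f x + f (2 * pi - x)"] phi_span_add[of "\<lambda>x. x * (f x - f (2 * pi - x))"])
    ultimately show ?case by simp
  qed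
  then show "(\<lambda>x. g x + g (2 * pi - x)) \<in> phi_span" "(\<lambda>x. x * (g x - g (2 * pi - x))) \<in> phi_span" by auto
qed

text \<open>With \<open>e\<close> and \<open>o\<close> denoting the even and odd parts with respect to \<open>pi\<close>, a function \<open>h\<close> is
  \<open>(1 / pi) * (e ((2 * pi - x) * h) + x * o h)\<close>.\<close>

lemma phi_span_uniform_approx:
  fixes h :: "real \<Rightarrow> real"
  assumes h: "continuous_on {0..2*pi} h" and h0: "h 0 = 0" "h (2*pi) = 0" and e: "0 < e"
  shows "\<exists>g\<in>phi_span. \<forall>x\<in>{0..2*pi}. \<bar>h x - g x\<bar> \<le> e"
proof -
  have "continuous_on {0..2*pi} (\<lambda>x. (2 * pi - x) * h x)" by (intro continuous_intros h)
  then obtain p where p: "trig_poly p" "\<And>x. x \<in> {0..2*pi} \<Longrightarrow> \<bar>(2 * pi - x) * h x - p x\<bar> < e / 3"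
    using trig_poly_approx[of "\<lambda>x. (2 * pi - x) * h x" "e / 3"] h0 e by auto
  obtain q where q: "trig_poly q" "\<And>x. x \<in> {0..2*pi} \<Longrightarrow> \<bar>h x - q x\<bar> < e / 3"
    using trig_poly_approx[OF h, of "e / 3"] h0 e by auto
  \<comment> \<open>With (2 * pi - x) * h for \<open>p\<close> and h for \<open>q\<close> the
    formula returns h exactly. The zeros of h at the end points allow periodic approximation of
    both.\<close>
  define g where "g x = (1 / (2 * pi)) * ((p x + p (2 * pi - x)) + x * (q x - q (2 * pi - x)))" for x
  have "g \<in> phi_span" unfolding g_def
    by (intro phi_span_cmult phi_span_add phi_span_even_odd p q)
  moreover have "\<bar>h x - g x\<bar> \<le> e" if x: "x \<in> {0..2*pi}" for x
  proof -
    have x': "2 * pi - x \<in> {0..2*pi}" using x by auto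
    define P where "P y = (2 * pi - y) * h y - p y" for y
    define Q where "Q y = h y - q y" for y
    have P: "\<bar>P x\<bar> \<le> e / 3" "\<bar>P (2 * pi - x)\<bar> \<le> e / 3" using p(2)[OF x] p(2)[OF x'] by (auto simp: P_def)
    have Q: "\<bar>Q x - Q (2 * pi - x)\<bar> \<le> 2 * (e / 3)" using q(2)[OF x] q(2)[OF x'] unfolding Q_def by linarith
    have "2 * pi * (h x - g x) = P x + P (2 * pi - x) + x * (Q x - Q (2 * pi - x))"
      by (simp add: P_def Q_def g_def algebra_simps)
    also have "\<bar>\<dots>\<bar> \<le> \<bar>P x\<bar> + \<bar>P (2 * pi - x)\<bar> + \<bar>x\<bar> * \<bar>Q x - Q (2 * pi - x)\<bar>"
      unfolding abs_mult[symmetric] by linarith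
    also have "\<dots> \<le> e / 3 + e / 3 + (2 * pi) * (2 * (e / 3))"
      using x by (intro add_mono mult_mono P Q) auto
    also have "\<dots> \<le> pi * (e / 3) + pi * (e / 3) + (2 * pi) * (2 * (e / 3))"
    proof -
      have "1 * (e / 3) \<le> pi * (e / 3)" using pi_ge_two e by (intro mult_right_mono) auto
      then show ?thesis by simp
    qed
    also have "\<dots> = 2 * pi * e" by simp
    finally show ?thesis by (simp add: abs_mult)
  qed
  ultimately show ?thesis by blast
qed

lemma phi_span_dense:
  fixes f :: "real \<Rightarrow> 'x::real_normed_vector"
  assumes f: "f \<in> Lp_space I_measure p" and p: "1 < p" and e: "0 < e"
  obtains g where "g \<in> phi_span" "g \<in> Lp_space I_measure p" "Lp_modular I_measure p (\<lambda>x. f x - g x) < e"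
proof (rule I.Lp_tensor_dense[OF f p e, of "phi_span :: (real \<Rightarrow> real) set" phi_span])
  fix A :: "real set" and d :: real assume A: "A \<in> sets I_measure" and d: "0 < d"
  show "\<exists>g\<in>phi_span. Lp_modular I_measure p (\<lambda>x. indicator A x - g x :: real) < d"
  proof (rule indicator_Lp_approx[OF A d p])
    fix h :: "real \<Rightarrow> real" and e :: real assume "continuous_on {0..2*pi} h" "h 0 = 0" "h (2*pi) = 0" "0 < e"
    then show "\<exists>g\<in>phi_span. \<forall>x\<in>{0..2*pi}. \<bar>h x - g x\<bar> \<le> e" by (rule phi_span_uniform_approx)
  qed (rule phi_span_continuous)
next
  show "(phi_span :: (real \<Rightarrow> real) set) \<subseteq> Lp_space I_measure p"
    using continuous_Lp_I[OF phi_span_continuous p] by auto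
qed (use that in \<open>auto intro: phi_span_zero phi_span_add phi_span_tensor\<close>)

text \<open>Adding the integrand to its reflection about pi cancels the factors x and 2 * pi - x or
  combines them into the constant 2 * pi. What remains is ordinary trigonometric orthogonality; the
  factors n in \<open>v_real\<close> and 1 / n in \<open>phi_real\<close> match on the
  diagonal.\<close>

lemma biorthonormal_integral:
  assumes n: "n \<in> trig_indices" and k: "k \<in> trig_indices"
  shows "integral {0..2*pi} (\<lambda>x. v_real n x * phi_real k x) = (if n = k then 1 else 0)"
proof -
  have sym: "integral {0..2*pi} G = i / 2"
    if c: "continuous_on {0..2*pi} G" and i: "((\<lambda>x. G x + G (2 * pi - x)) has_integral i) {0..2*pi}" for G :: "real \<Rightarrow> real" and i
  proof -
    have G: "(G has_integral integral {0..2*pi} G) {0..2*pi}"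
      by (rule integrable_integral[OF integrable_continuous_real[OF c]])
    have "((\<lambda>x. G x + G (2 * pi - x)) has_integral integral {0..2*pi} G + integral {0..2*pi} G) {0..2*pi}"
      by (rule has_integral_add[OF G has_integral_reflect_2pi[OF G]])
    then show ?thesis using has_integral_unique[OF i] by simp
  qed
  have cont: "continuous_on {0..2*pi} (\<lambda>x. v_real n x * phi_real k x)"
    by (intro continuous_intros continuous_v_real continuous_phi_real)
  show ?thesis
  proof (cases n)
    case n: (CosIx a)
    define c where "c = (if a = 0 then 1 / (2 * pi\<^sup>2) else 1 / pi\<^sup>2)"
    have v: "v_real n x = c * (2 * pi - x) * cos (real a * x)" for x unfolding n c_def by simp
    show ?thesis
    proof (cases k)
      case k: (CosIx b)
      have e: "v_real n x * phi_real k x + v_real n (2 * pi - x) * phi_real k (2 * pi - x) = (2 * pi * c) * (cos (real a * x) * cos (real b * x))" for x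
      proof -
        have ph: "phi_real k x = cos (real b * x)" for x unfolding k by simp
        show ?thesis unfolding v ph trig_reflect by (simp add: algebra_simps)
      qed
      define j where "j = (if a = b then if a = 0 then 2 * pi else pi else 0)"
      have "((\<lambda>x. cos (real a * x) * cos (real b * x)) has_integral j) {0..2*pi}"
      proof (cases "a > 0 \<or> b > 0")
        case True then show ?thesis using has_integral_cos_cos[OF True] by (auto simp: j_def)
      next
        case False then show ?thesis using has_integral_cos_int[of 0] by (simp add: j_def)
      qed
      from sym[OF cont, unfolded e, OF has_integral_mult_right[OF this]]
      show ?thesis by (auto simp: n k j_def c_def power2_eq_square)
    next
      case k: (SinIx b)
      have "b \<ge> 1" using assms(2) by (auto simp: k trig_indices_def)
      then have e: "v_real n x * phi_real k x + v_real n (2 * pi - x) * phi_real k (2 * pi - x) = 0" for x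
      proof -
        have ph: "phi_real k x = - (x / (2 * real b)) * sin (real b * x)" for x unfolding k by simp
        show ?thesis unfolding v ph trig_reflect using \<open>b \<ge> 1\<close> by (simp add: field_simps)
      qed
      from sym[OF cont, unfolded e, of 0] show ?thesis by (simp add: n k)
    qed
  next
    case n: (SinIx a)
    have a: "a \<ge> 1" using assms(1) by (auto simp: n trig_indices_def)
    have v: "v_real n x = - (2 * real a / pi\<^sup>2) * sin (real a * x)" for x unfolding n by simp
    show ?thesis
    proof (cases k)
      case k: (CosIx b)
      have ph: "phi_real k x = cos (real b * x)" for x unfolding k by simp
      have "((\<lambda>x. - (2 * real a / pi\<^sup>2) * (sin (real a * x) * cos (real b * x))) has_integral - (2 * real a / pi\<^sup>2) * 0) {0..2*pi}"
        by (intro has_integral_mult_right has_integral_sin_cos)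
      then have "integral {0..2*pi} (\<lambda>x. v_real n x * phi_real k x) = 0"
        unfolding v ph mult.assoc by (simp only: integral_unique mult_zero_right)
      then show ?thesis by (simp add: n k)
    next
      case k: (SinIx b)
      have b: "b \<ge> 1" using assms(2) by (auto simp: k trig_indices_def)
      have e: "v_real n x * phi_real k x + v_real n (2 * pi - x) * phi_real k (2 * pi - x) = (2 * real a / (real b * pi)) * (sin (real a * x) * sin (real b * x))" for x
      proof -
        have ph: "phi_real k x = - (x / (2 * real b)) * sin (real b * x)" for x unfolding k by simp
        show ?thesis unfolding v ph trig_reflect using b by (simp add: field_simps power2_eq_square)
      qed
      have "((\<lambda>x. sin (real a * x) * sin (real b * x)) has_integral (if a = b then pi else 0)) {0..2*pi}"
        by (rule has_integral_sin_sin) (use a in simp)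
      from sym[OF cont, unfolded e, OF has_integral_mult_right[OF this]]
      show ?thesis using a b by (auto simp: n k)
    qed
  qed
qed

section \<open>Fourier coefficients and partial sums on the Bochner space\<close>

definition weighted_integral :: "(real \<Rightarrow> real) \<Rightarrow> (real \<Rightarrow> 'x::real_normed_vector) \<Rightarrow> 'x" where
  "weighted_integral w f = strong_integral I_measure (\<lambda>x. w x *\<^sub>R f x)"

lemma continuous_bounded_2pi:
  fixes w :: "real \<Rightarrow> real"
  assumes "continuous_on {0..2*pi} w"
  obtains B where "0 \<le> B" "\<And>x. x \<in> {0..2*pi} \<Longrightarrow> \<bar>w x\<bar> \<le> B"
proof -
  have "bounded (w ` {0..2*pi})" by (rule compact_imp_bounded[OF compact_continuous_image[OF assms]]) simp
  then obtain B where B: "\<And>x. x \<in> {0..2*pi} \<Longrightarrow> \<bar>w x\<bar> \<le> B"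
    unfolding bounded_iff real_norm_def by blast
  moreover have "0 \<le> B" using B[of 0] by simp
  ultimately show thesis using that by blast
qed

lemma Lp_I_scaleR:
  assumes f: "f \<in> Lp_space I_measure p" and p: "1 < p" and w: "continuous_on {0..2*pi} w"
    and B: "0 \<le> B" "\<And>x. x \<in> {0..2*pi} \<Longrightarrow> \<bar>w x\<bar> \<le> B"
  shows "(\<lambda>x. w x *\<^sub>R f x) \<in> Lp_space I_measure p"
    "Lp_modular I_measure p (\<lambda>x. w x *\<^sub>R f x) \<le> B powr p * Lp_modular I_measure p f"
  using Lp_scaleR[OF f p continuous_borel_I[OF w] B(1)] B(2) by auto

lemma has_weighted_integral:
  fixes f :: "real \<Rightarrow> 'x::banach"
  assumes f: "f \<in> Lp_space I_measure p" and p: "1 < p" and w: "continuous_on {0..2*pi} w"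
  shows "has_strong_integral I_measure (\<lambda>x. w x *\<^sub>R f x) (weighted_integral w f)"
proof -
  obtain B where B: "0 \<le> B" "\<And>x. x \<in> {0..2*pi} \<Longrightarrow> \<bar>w x\<bar> \<le> B"
    using continuous_bounded_2pi[OF w] by blast
  note wf = Lp_I_scaleR(1)[OF f p w B]
  show ?thesis unfolding weighted_integral_def
    by (rule has_strong_integral_strong_integral[OF Lp_spaceD(1)[OF wf] I.Lp_integrable_norm(1)[OF wf p]])
qed

lemma weighted_integral_bounded:
  assumes p: "1 < p" and w: "continuous_on {0..2*pi} w"
  obtains K where "0 \<le> K"
    "\<And>f :: real \<Rightarrow> 'x::banach. f \<in> Lp_space I_measure p \<Longrightarrow> norm (weighted_integral w f) \<le> K * Lp_norm I_measure p f"
proof -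
  obtain B where B: "0 \<le> B" "\<And>x. x \<in> {0..2*pi} \<Longrightarrow> \<bar>w x\<bar> \<le> B"
    using continuous_bounded_2pi[OF w] by blast
  show thesis
  proof (rule that[of "(2 * pi + 1) * B"])
    show "0 \<le> (2 * pi + 1) * B" using B(1) by simp
    fix f :: "real \<Rightarrow> 'x" assume f: "f \<in> Lp_space I_measure p"
    note wf = Lp_I_scaleR[OF f p w B]
    have "norm (weighted_integral w f) \<le> (\<integral>x. norm (w x *\<^sub>R f x) \<partial>I_measure)"
      unfolding weighted_integral_def
      by (rule norm_strong_integral_le[OF Lp_spaceD(1)[OF wf(1)] I.Lp_integrable_norm(1)[OF wf(1) p]])
    also have "\<dots> \<le> (2 * pi + 1) * Lp_norm I_measure p (\<lambda>x. w x *\<^sub>R f x)"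
      using I.Lp_integrable_norm(2)[OF wf(1) p] unfolding measure_I_measure .
    also have "Lp_norm I_measure p (\<lambda>x. w x *\<^sub>R f x) \<le> B * Lp_norm I_measure p f"
    proof -
      have "Lp_norm I_measure p (\<lambda>x. w x *\<^sub>R f x) \<le> (B powr p * Lp_modular I_measure p f) powr (1 / p)"
        unfolding Lp_norm_modular using p by (intro powr_mono2 wf(2) Lp_modular_nonneg) auto
      also have "\<dots> = B * Lp_norm I_measure p f"
        using p B(1) by (simp add: powr_mult powr_powr Lp_norm_modular Lp_modular_nonneg)
      finally show ?thesis .
    qed
    finally show "norm (weighted_integral w f) \<le> (2 * pi + 1) * B * Lp_norm I_measure p f"
      by (simp add: mult.assoc mult_left_mono)
  qed
qed

lemma weighted_integral_add:
  fixes f g :: "real \<Rightarrow> 'x::banach"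
  assumes "f \<in> Lp_space I_measure p" "g \<in> Lp_space I_measure p" "1 < p" "continuous_on {0..2*pi} w"
  shows "weighted_integral w (\<lambda>x. f x + g x) = weighted_integral w f + weighted_integral w g"
proof -
  have "has_strong_integral I_measure (\<lambda>x. w x *\<^sub>R f x + w x *\<^sub>R g x) (weighted_integral w f + weighted_integral w g)"
    by (rule has_strong_integral_add[OF has_weighted_integral[OF assms(1,3,4)] has_weighted_integral[OF assms(2,3,4)]])
  then have "has_strong_integral I_measure (\<lambda>x. w x *\<^sub>R (f x + g x)) (weighted_integral w f + weighted_integral w g)"
    by (simp only: scaleR_add_right)
  then show ?thesis unfolding weighted_integral_def by (rule strong_integral_eq)
qed

lemma weighted_integral_bounded_linear:
  fixes f :: "real \<Rightarrow> 'x::banach" and L :: "'x \<Rightarrow> 'y::banach"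
  assumes "f \<in> Lp_space I_measure p" "1 < p" "continuous_on {0..2*pi} w" and L: "bounded_linear L"
  shows "weighted_integral w (\<lambda>x. L (f x)) = L (weighted_integral w f)"
proof -
  have "has_strong_integral I_measure (\<lambda>x. L (w x *\<^sub>R f x)) (L (weighted_integral w f))"
    by (rule has_strong_integral_bounded_linear[OF L has_weighted_integral[OF assms(1-3)]])
  then have "has_strong_integral I_measure (\<lambda>x. w x *\<^sub>R L (f x)) (L (weighted_integral w f))"
    by (simp only: linear_scale[OF bounded_linear.linear[OF L]])
  then show ?thesis unfolding weighted_integral_def by (rule strong_integral_eq)
qed

lemma weighted_integral_cmult:
  fixes f :: "real \<Rightarrow> 'x::banach"
  assumes "f \<in> Lp_space I_measure p" "1 < p" "continuous_on {0..2*pi} w"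
  shows "weighted_integral (\<lambda>x. c * w x) f = c *\<^sub>R weighted_integral w f"
  using weighted_integral_bounded_linear[OF assms bounded_linear_scaleR_right[of c]]
  by (simp add: weighted_integral_def mult.commute)

lemma weighted_integral_tensor:
  fixes z :: "'x::banach"
  assumes "continuous_on {0..2*pi} (\<lambda>x. w x * g x)"
  shows "weighted_integral w (\<lambda>x. g x *\<^sub>R z) = integral {0..2*pi} (\<lambda>x. w x * g x) *\<^sub>R z"
  using strong_integral_eq[OF has_strong_integral_scaleR_left[OF integral_I_measure(1)[OF assms], of z]]
  by (simp add: weighted_integral_def integral_I_measure(2)[OF assms])

text \<open>The integral operator whose kernel is the sum over i of u_i(x) * w_i(y). Cosine and sine
  partial sums both have this form, so the extension from trigonometric sums is argued once.\<close>

definition finite_rank_op ::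
  "'i set \<Rightarrow> ('i \<Rightarrow> real \<Rightarrow> real) \<Rightarrow> ('i \<Rightarrow> real \<Rightarrow> real) \<Rightarrow> (real \<Rightarrow> 'x::real_normed_vector) \<Rightarrow> real \<Rightarrow> 'x" where
  "finite_rank_op S u w f x = (\<Sum>i\<in>S. u i x *\<^sub>R weighted_integral (w i) f)"

lemma finite_rank_op_Lp:
  fixes f :: "real \<Rightarrow> 'x::banach"
  assumes p: "1 < p" and u: "\<And>i. continuous_on {0..2*pi} (u i)"
  shows "finite_rank_op S u w f \<in> Lp_space I_measure p"
proof -
  have "(\<lambda>x. u i x *\<^sub>R z) \<in> Lp_space I_measure p" for i and z :: 'x
  proof -
    obtain B where B: "0 \<le> B" "\<And>x. x \<in> {0..2*pi} \<Longrightarrow> \<bar>u i x\<bar> \<le> B"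
      using continuous_bounded_2pi[OF u] by blast
    show ?thesis
      by (rule I.Lp_space_bounded(1)[OF strongly_measurable_scaleR[OF continuous_borel_I[OF u] strongly_measurable_const] _ p, of _ _ "B * norm z"])
         (use B in \<open>auto intro!: mult_right_mono\<close>)
  qed
  then show ?thesis unfolding finite_rank_op_def[abs_def] by (intro Lp_sum p)
qed

lemma finite_rank_op_bounded:
  assumes p: "1 < p" and S: "finite S" and u: "\<And>i. continuous_on {0..2*pi} (u i)" and w: "\<And>i. continuous_on {0..2*pi} (w i)"
    and u1: "\<And>i x. \<bar>u i x\<bar> \<le> 1"
  obtains K where "0 \<le> K"
    "\<And>f :: real \<Rightarrow> 'x::banach. f \<in> Lp_space I_measure p \<Longrightarrow>
       Lp_modular I_measure p (finite_rank_op S u w f) \<le> K * Lp_modular I_measure p f"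
proof -
  have "\<exists>K\<ge>0. \<forall>f :: real \<Rightarrow> 'x. f \<in> Lp_space I_measure p \<longrightarrow> norm (weighted_integral (w i) f) \<le> K * Lp_norm I_measure p f" for i
    using weighted_integral_bounded[OF p w, of i] by metis
  then obtain k where k: "\<And>i. 0 \<le> k i"
    "\<And>i f. f \<in> Lp_space I_measure p \<Longrightarrow> norm (weighted_integral (w i) f :: 'x) \<le> k i * Lp_norm I_measure p f"
    by metis
  define K where "K = (\<Sum>i\<in>S. k i)"
  have K: "0 \<le> K" unfolding K_def by (intro sum_nonneg k)
  show thesis
  proof (rule that[of "K powr p * (2 * pi)"])
    show "0 \<le> K powr p * (2 * pi)" by simp
    fix f :: "real \<Rightarrow> 'x" assume f: "f \<in> Lp_space I_measure p"
    have "norm (finite_rank_op S u w f x) \<le> K * Lp_norm I_measure p f" for x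
    proof -
      have "norm (finite_rank_op S u w f x) \<le> (\<Sum>i\<in>S. k i * Lp_norm I_measure p f)"
        unfolding finite_rank_op_def
      proof (rule order_trans[OF norm_sum], rule sum_mono)
        fix i
        have "norm (u i x *\<^sub>R weighted_integral (w i) f) \<le> 1 * (k i * Lp_norm I_measure p f)"
          unfolding norm_scaleR using u1 k(2)[OF f] by (intro mult_mono) auto
        then show "norm (u i x *\<^sub>R weighted_integral (w i) f) \<le> k i * Lp_norm I_measure p f" by simp
      qed
      then show ?thesis by (simp add: K_def sum_distrib_right)
    qed
    note bnd = this
    have fr: "finite_rank_op S u w f \<in> Lp_space I_measure p" by (rule finite_rank_op_Lp[OF p u])
    have "Lp_modular I_measure p (finite_rank_op S u w f) \<le> (K * Lp_norm I_measure p f) powr p * measure I_measure (space I_measure)"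
      by (rule I.Lp_space_bounded(2)[OF Lp_spaceD(1)[OF fr] bnd p])
    then have "Lp_modular I_measure p (finite_rank_op S u w f) \<le> (K * Lp_norm I_measure p f) powr p * (2 * pi)"
      unfolding measure_I_measure .
    also have "(K * Lp_norm I_measure p f) powr p = K powr p * Lp_modular I_measure p f"
      using p by (simp add: powr_mult Lp_modular_norm)
    finally show "Lp_modular I_measure p (finite_rank_op S u w f) \<le> K powr p * (2 * pi) * Lp_modular I_measure p f"
      by (simp add: mult_ac)
  qed
qed

lemma finite_rank_op_add:
  fixes f g :: "real \<Rightarrow> 'x::banach"
  assumes "f \<in> Lp_space I_measure p" "g \<in> Lp_space I_measure p" "1 < p" "\<And>i. continuous_on {0..2*pi} (w i)"
  shows "finite_rank_op S u w (\<lambda>x. f x + g x) x = finite_rank_op S u w f x + finite_rank_op S u w g x"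
  unfolding finite_rank_op_def weighted_integral_add[OF assms] by (simp add: scaleR_add_right sum.distrib)

text \<open>The bound \<open>K\<close> of \<open>finite_rank_op_bounded\<close> depends on the rank; by density only the bound on
  trigonometric polynomials matters.\<close>

lemma finite_rank_op_extension:
  fixes f :: "real \<Rightarrow> 'x::banach"
  assumes p: "1 < p" and S: "finite S" and u: "\<And>i. continuous_on {0..2*pi} (u i)" and w: "\<And>i. continuous_on {0..2*pi} (w i)"
    and u1: "\<And>i x. \<bar>u i x\<bar> \<le> 1" and C: "0 \<le> C"
    and trig: "\<And>g :: real \<Rightarrow> 'x. g \<in> trig_span \<Longrightarrow> g \<in> Lp_space I_measure p \<Longrightarrow>
         Lp_modular I_measure p (finite_rank_op S u w g) \<le> C * Lp_modular I_measure p g"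
    and f: "f \<in> Lp_space I_measure p"
  shows "Lp_modular I_measure p (finite_rank_op S u w f) \<le> 4 powr (p - 1) * C * Lp_modular I_measure p f"
proof (rule field_le_epsilon)
  fix e :: real assume e: "0 < e"
  obtain K where K: "0 \<le> K"
    "\<And>f :: real \<Rightarrow> 'x. f \<in> Lp_space I_measure p \<Longrightarrow>
       Lp_modular I_measure p (finite_rank_op S u w f) \<le> K * Lp_modular I_measure p f"
    by (rule finite_rank_op_bounded[OF p S u w u1]) (rule that)
  define T :: "(real \<Rightarrow> 'x) \<Rightarrow> real \<Rightarrow> 'x" where "T = finite_rank_op S u w"
  define a where "a = (2::real) powr (p - 1)"
  have "(2 * 2 :: real) powr (p - 1) = a * a" unfolding a_def by (rule powr_mult)
  then have "a * a = (2 * 2) powr (p - 1)" by (rule sym)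
  also have "(2 * 2 :: real) = 4" by simp
  finally have aa: "a * a = 4 powr (p - 1)" .
  have a: "0 \<le> a" unfolding a_def by simp
  define L where "L = a * a * C + a * K"
  have L: "0 \<le> L" using a(1) C K(1) by (simp add: L_def)
  \<comment> \<open>The accuracy is chosen after the rank-dependent \<open>K\<close>, so
    \<open>K\<close> enters only the error \<open>e\<close>.\<close>
  define d where "d = e / (L + 1)"
  have d: "0 < d" using e L by (simp add: d_def)
  obtain g where g: "g \<in> trig_span" "g \<in> Lp_space I_measure p" "Lp_modular I_measure p (\<lambda>x. f x - g x) < d"
    using trig_span_dense[OF f p d] by blast
  note fg = Lp_diff(1)[OF f g(2) p]
  have Tsplit: "T f = (\<lambda>x. T g x + T (\<lambda>x. f x - g x) x)"
    using finite_rank_op_add[OF g(2) fg p w, of S u] by (auto simp: T_def)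
  have "Lp_modular I_measure p (\<lambda>x. T g x + T (\<lambda>x. f x - g x) x)
      \<le> a * (Lp_modular I_measure p (T g) + Lp_modular I_measure p (T (\<lambda>x. f x - g x)))"
    unfolding a_def T_def by (rule Lp_add(2)[OF finite_rank_op_Lp[OF p u] finite_rank_op_Lp[OF p u] p])
  also have "\<dots> \<le> a * (C * (a * (Lp_modular I_measure p f + d)) + K * d)"
  proof (intro mult_left_mono add_mono a)
    have "Lp_modular I_measure p (\<lambda>x. f x - (f x - g x)) \<le> a * (Lp_modular I_measure p f + Lp_modular I_measure p (\<lambda>x. f x - g x))"
      unfolding a_def by (rule Lp_diff(2)[OF f fg p])
    also have "\<dots> \<le> a * (Lp_modular I_measure p f + d)" using g(3) a by (intro mult_left_mono) auto
    finally have "Lp_modular I_measure p g \<le> a * (Lp_modular I_measure p f + d)" by simp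
    then have "C * Lp_modular I_measure p g \<le> C * (a * (Lp_modular I_measure p f + d))" using C by (rule mult_left_mono)
    then show "Lp_modular I_measure p (T g) \<le> C * (a * (Lp_modular I_measure p f + d))"
      using trig[OF g(1,2)] unfolding T_def by linarith
    have "K * Lp_modular I_measure p (\<lambda>x. f x - g x) \<le> K * d" using g(3) K(1) by (intro mult_left_mono) auto
    then show "Lp_modular I_measure p (T (\<lambda>x. f x - g x)) \<le> K * d"
      using K(2)[OF fg] unfolding T_def by linarith
  qed
  also have "\<dots> = a * a * C * Lp_modular I_measure p f + d * L" by (simp add: L_def algebra_simps)
  also have "\<dots> \<le> a * a * C * Lp_modular I_measure p f + e"
  proof -
    have "d * (L + 1) = e" using L by (simp add: d_def)
    then have "d * L \<le> e" using d by (simp add: algebra_simps)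
    then show ?thesis by simp
  qed
  finally show "Lp_modular I_measure p (finite_rank_op S u w f) \<le> 4 powr (p - 1) * C * Lp_modular I_measure p f + e"
    unfolding Tsplit[symmetric] aa unfolding T_def .
qed

lemma weighted_integral_trig:
  fixes a b :: "nat \<Rightarrow> 'x::banach"
  assumes f: "\<And>x. f x = (\<Sum>k\<le>N. cos (real k * x) *\<^sub>R a k + sin (real k * x) *\<^sub>R b k)"
  shows "weighted_integral (\<lambda>x. cos (real j * x)) f = (if j \<le> N then (if j = 0 then 2 * pi else pi) *\<^sub>R a j else 0)"
    and "weighted_integral (\<lambda>x. sin (real j * x)) f = (if j \<le> N then (if j = 0 then 0 else pi) *\<^sub>R b j else 0)"
proof -
  have I: "has_strong_integral I_measure (\<lambda>x. g x *\<^sub>R z) (i *\<^sub>R z)"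
    if "continuous_on {0..2*pi} g" "(g has_integral i) {0..2*pi}" for g i and z :: 'x
    using has_strong_integral_scaleR_left[OF integral_I_measure(1)[OF that(1)], of z]
      integral_I_measure(2)[OF that(1)] integral_unique[OF that(2)] by simp
  have cc: "((\<lambda>x. cos (real j * x) * cos (real k * x)) has_integral (if j = k then if j = 0 then 2 * pi else pi else 0)) {0..2*pi}" for k
  proof (cases "j > 0 \<or> k > 0")
    case True then show ?thesis using has_integral_cos_cos[OF True] by (auto split: if_splits)
  next
    case False then show ?thesis using has_integral_cos_int[of 0] by simp
  qed
  have ss: "((\<lambda>x. sin (real j * x) * sin (real k * x)) has_integral (if j = k then if j = 0 then 0 else pi else 0)) {0..2*pi}" for k
  proof (cases "j > 0 \<or> k > 0")
    case True then show ?thesis using has_integral_sin_sin[OF True] by (auto split: if_splits)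
  next
    case False then show ?thesis by simp
  qed
  have sc: "((\<lambda>x. cos (real j * x) * sin (real k * x)) has_integral 0) {0..2*pi}" for k
    using has_integral_sin_cos[of k j] by (simp add: mult.commute)
  have "has_strong_integral I_measure (\<lambda>x. \<Sum>k\<le>N. (cos (real j * x) * cos (real k * x)) *\<^sub>R a k + (cos (real j * x) * sin (real k * x)) *\<^sub>R b k)
     (\<Sum>k\<le>N. (if j = k then if j = 0 then 2 * pi else pi else 0) *\<^sub>R a k + 0 *\<^sub>R b k)"
    by (intro has_strong_integral_sum has_strong_integral_add I cc sc continuous_intros)
  moreover have "(\<Sum>k\<le>N. (if j = k then if j = 0 then 2 * pi else pi else 0) *\<^sub>R a k + 0 *\<^sub>R b k)
     = (if j \<le> N then (if j = 0 then 2 * pi else pi) *\<^sub>R a j else 0)"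
  proof -
    have "(\<Sum>k\<le>N. (if j = k then if j = 0 then 2 * pi else pi else 0) *\<^sub>R a k + 0 *\<^sub>R b k)
       = (\<Sum>k\<le>N. if j = k then (if j = 0 then 2 * pi else pi) *\<^sub>R a k else 0)" by (intro sum.cong) auto
    then show ?thesis by (simp add: sum.delta)
  qed
  ultimately show "weighted_integral (\<lambda>x. cos (real j * x)) f = (if j \<le> N then (if j = 0 then 2 * pi else pi) *\<^sub>R a j else 0)"
    unfolding weighted_integral_def f
    by (intro strong_integral_eq) (simp add: scaleR_sum_right scaleR_add_right)
  have "has_strong_integral I_measure (\<lambda>x. \<Sum>k\<le>N. (sin (real j * x) * cos (real k * x)) *\<^sub>R a k + (sin (real j * x) * sin (real k * x)) *\<^sub>R b k)
     (\<Sum>k\<le>N. 0 *\<^sub>R a k + (if j = k then if j = 0 then 0 else pi else 0) *\<^sub>R b k)"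
    by (intro has_strong_integral_sum has_strong_integral_add I ss has_integral_sin_cos continuous_intros)
  moreover have "(\<Sum>k\<le>N. 0 *\<^sub>R a k + (if j = k then if j = 0 then 0 else pi else 0) *\<^sub>R b k)
     = (if j \<le> N then (if j = 0 then 0 else pi) *\<^sub>R b j else 0)"
  proof -
    have "(\<Sum>k\<le>N. 0 *\<^sub>R a k + (if j = k then if j = 0 then 0 else pi else 0) *\<^sub>R b k)
       = (\<Sum>k\<le>N. if j = k then (if j = 0 then 0 else pi) *\<^sub>R b k else 0)" by (intro sum.cong) auto
    then show ?thesis by (simp add: sum.delta)
  qed
  ultimately show "weighted_integral (\<lambda>x. sin (real j * x)) f = (if j \<le> N then (if j = 0 then 0 else pi) *\<^sub>R b j else 0)"
    unfolding weighted_integral_def f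
    by (intro strong_integral_eq) (simp add: scaleR_sum_right scaleR_add_right)
qed

text \<open>Equal to pi times the cosine part of the Fourier partial sum. The 1/2 at k = 0
  compensates that 1 integrates to 2 * pi while the square of cos (k x) integrates to pi.\<close>

definition cos_partial_sum :: "nat \<Rightarrow> (real \<Rightarrow> 'x::real_normed_vector) \<Rightarrow> real \<Rightarrow> 'x" where
  "cos_partial_sum n = finite_rank_op {..n} (\<lambda>k x. (if k = 0 then 1 / 2 else 1) * cos (real k * x)) (\<lambda>k x. cos (real k * x))"

definition sin_partial_sum :: "nat \<Rightarrow> (real \<Rightarrow> 'x::real_normed_vector) \<Rightarrow> real \<Rightarrow> 'x" where
  "sin_partial_sum n = finite_rank_op {..n} (\<lambda>k x. sin (real k * x)) (\<lambda>k x. sin (real k * x))"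

lemma partial_sum_Lp:
  fixes f :: "real \<Rightarrow> 'x::banach"
  assumes "1 < p"
  shows "cos_partial_sum n f \<in> Lp_space I_measure p" "sin_partial_sum n f \<in> Lp_space I_measure p"
  unfolding cos_partial_sum_def sin_partial_sum_def
  by (intro finite_rank_op_Lp assms continuous_intros)+

lemma cos_sin_partial_sums_bounded:
  fixes sc :: "'k::real_normed_field \<Rightarrow> 'x::banach \<Rightarrow> 'x"
  assumes sc: "normed_scaling sc" and umd: "UMD sc" and p: "1 < p"
  obtains C where "0 \<le> C"
    "\<And>n (f :: real \<Rightarrow> 'x). f \<in> Lp_space I_measure p \<Longrightarrow> Lp_modular I_measure p (cos_partial_sum n f) \<le> C * Lp_modular I_measure p f"
    "\<And>n (f :: real \<Rightarrow> 'x). f \<in> Lp_space I_measure p \<Longrightarrow> Lp_modular I_measure p (sin_partial_sum n f) \<le> C * Lp_modular I_measure p f"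
proof -
  obtain C where C: "0 \<le> C"
    "\<And>N (a :: nat \<Rightarrow> 'x) b n.
       circle_modular p (\<lambda>x. \<Sum>k\<le>N. (if k \<le> n then cos (real k * x) else 0) *\<^sub>R a k)
       \<le> C * circle_modular p (\<lambda>x. \<Sum>k\<le>N. cos (real k * x) *\<^sub>R a k + sin (real k * x) *\<^sub>R b k)"
    "\<And>N (a :: nat \<Rightarrow> 'x) b n.
       circle_modular p (\<lambda>x. \<Sum>k\<le>N. (if k \<le> n then sin (real k * x) else 0) *\<^sub>R b k)
       \<le> C * circle_modular p (\<lambda>x. \<Sum>k\<le>N. cos (real k * x) *\<^sub>R a k + sin (real k * x) *\<^sub>R b k)"
    using trig_partial_sums_bounded[OF assms] by blast
  define D where "D = pi powr p * C"
  have D: "0 \<le> D" using C(1) by (simp add: D_def)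
  have cont_if: "continuous_on A (\<lambda>x. (if P then cos (real k * x) else 0 :: real))" "continuous_on A (\<lambda>x. (if P then sin (real k * x) else 0 :: real))" for A P k
    by (cases P; simp; intro continuous_intros)+
  have trig: "Lp_modular I_measure p (cos_partial_sum n g) \<le> D * Lp_modular I_measure p g \<and>
     Lp_modular I_measure p (sin_partial_sum n g) \<le> D * Lp_modular I_measure p g" if gt: "g \<in> trig_span" for g :: "real \<Rightarrow> 'x" and n
  proof -
    obtain N a b where g: "\<And>x. g x = (\<Sum>k\<le>N. cos (real k * x) *\<^sub>R a k + sin (real k * x) *\<^sub>R b k)"
      using gt unfolding trig_span_def by blast
    define u where "u x = (\<Sum>k\<le>N. (if k \<le> n then cos (real k * x) else 0) *\<^sub>R a k)" for x :: real
    define v where "v x = (\<Sum>k\<le>N. (if k \<le> n then sin (real k * x) else 0) *\<^sub>R b k)" for x :: real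
    have swap: "(\<Sum>k\<le>n. if k \<le> N then h k else 0) = (\<Sum>k\<le>N. if k \<le> n then h k else 0)" for h :: "nat \<Rightarrow> 'x"
    proof -
      have "(\<Sum>k\<le>n. if k \<le> N then h k else 0) = (\<Sum>k\<in>{..n} \<inter> {k. k \<le> N}. h k)"
        by (subst sum.inter_restrict) auto
      also have "{..n} \<inter> {k. k \<le> N} = {..N} \<inter> {k. k \<le> n}" by auto
      also have "(\<Sum>k\<in>{..N} \<inter> {k. k \<le> n}. h k) = (\<Sum>k\<le>N. if k \<le> n then h k else 0)"
        by (subst sum.inter_restrict) auto
      finally show ?thesis .
    qed
    have cu: "cos_partial_sum n g x = pi *\<^sub>R u x" for x
    proof -
      have "cos_partial_sum n g x = (\<Sum>k\<le>n. if k \<le> N then (pi * cos (real k * x)) *\<^sub>R a k else 0)"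
        unfolding cos_partial_sum_def finite_rank_op_def weighted_integral_trig(1)[OF g] by (intro sum.cong) auto
      also have "\<dots> = pi *\<^sub>R u x"
        unfolding swap u_def scaleR_sum_right by (intro sum.cong) auto
      finally show ?thesis .
    qed
    have sv: "sin_partial_sum n g x = pi *\<^sub>R v x" for x
    proof -
      have "sin_partial_sum n g x = (\<Sum>k\<le>n. if k \<le> N then (pi * sin (real k * x)) *\<^sub>R b k else 0)"
        unfolding sin_partial_sum_def finite_rank_op_def weighted_integral_trig(2)[OF g] by (intro sum.cong) auto
      also have "\<dots> = pi *\<^sub>R v x"
        unfolding swap v_def scaleR_sum_right by (intro sum.cong) auto
      finally show ?thesis .
    qed
    have cont: "continuous_on {0..2*pi} (\<lambda>x. pi *\<^sub>R u x)" "continuous_on {0..2*pi} (\<lambda>x. pi *\<^sub>R v x)" "continuous_on {0..2*pi} g"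
      unfolding u_def v_def g by (intro continuous_intros cont_if)+
    have gm: "Lp_modular I_measure p g = circle_modular p (\<lambda>x. \<Sum>k\<le>N. cos (real k * x) *\<^sub>R a k + sin (real k * x) *\<^sub>R b k)"
      using Lp_modular_eq_circle_modular[OF cont(3) p] by (simp add: g[abs_def])
    have "Lp_modular I_measure p (cos_partial_sum n g) = pi powr p * circle_modular p u"
      unfolding cu[abs_def] Lp_modular_eq_circle_modular[OF cont(1) p] circle_modular_scaleR by simp
    moreover have "Lp_modular I_measure p (sin_partial_sum n g) = pi powr p * circle_modular p v"
      unfolding sv[abs_def] Lp_modular_eq_circle_modular[OF cont(2) p] circle_modular_scaleR by simp
    moreover have "circle_modular p u \<le> C * Lp_modular I_measure p g" "circle_modular p v \<le> C * Lp_modular I_measure p g"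
      unfolding gm u_def v_def by (rule C(2,3))+
    ultimately show ?thesis by (simp add: D_def mult.assoc mult_left_mono)
  qed
  show thesis
  proof (rule that[of "4 powr (p - 1) * D"])
    show "0 \<le> 4 powr (p - 1) * D" using D by simp
    fix n and f :: "real \<Rightarrow> 'x" assume f: "f \<in> Lp_space I_measure p"
    have half: "\<bar>(if k = 0 then 1 / 2 else 1) * cos y\<bar> \<le> 1" for k :: nat and y :: real
      by (auto simp: abs_mult intro: order_trans[OF abs_cos_le_one])
    show "Lp_modular I_measure p (cos_partial_sum n f) \<le> 4 powr (p - 1) * D * Lp_modular I_measure p f"
      unfolding cos_partial_sum_def
      by (rule finite_rank_op_extension[OF p _ _ _ half D _ f])
         (use trig in \<open>auto simp: cos_partial_sum_def intro!: continuous_intros\<close>)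
    show "Lp_modular I_measure p (sin_partial_sum n f) \<le> 4 powr (p - 1) * D * Lp_modular I_measure p f"
      unfolding sin_partial_sum_def
      by (rule finite_rank_op_extension[OF p _ _ _ abs_sin_le_one D _ f])
         (use trig in \<open>auto simp: sin_partial_sum_def intro!: continuous_intros\<close>)
  qed
qed

section \<open>The perturbed trigonometric system\<close>

lemma t_op_eq_weighted_integral:
  assumes "normed_scaling sc"
  shows "t_op sc k f = weighted_integral (v_real k) f"
  unfolding t_op_def weighted_integral_def v_def by (simp add: normed_scaling_of_real[OF assms])

text \<open>Real scalars act through \<open>of_real\<close> and therefore commute with the scalar
  \<open>c\<close>.\<close>

lemma normed_scaling_bounded_linear:
  fixes sc :: "'k::real_normed_field \<Rightarrow> 'x::real_normed_vector \<Rightarrow> 'x"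
  assumes "normed_scaling sc"
  shows "bounded_linear (sc c)"
proof -
  interpret vector_space sc using assms by (simp add: normed_scaling_def)
  show ?thesis
  proof (rule bounded_linear_intro[of _ "norm c"])
    show "sc c (x + y) = sc c x + sc c y" for x y by (rule scale_right_distrib)
    show "sc c (r *\<^sub>R x) = r *\<^sub>R sc c x" for r x
      unfolding normed_scaling_of_real[OF assms, symmetric] by (simp add: mult.commute)
    show "norm (sc c x) \<le> norm x * norm c" for x
      using assms by (simp add: normed_scaling_def mult.commute)
  qed
qed

text \<open>The factor 2 * pi - y of the weights moves onto \<open>f\<close>, and the factor x of
  the sine functions moves out of the sum. The product of - 2k / pi^2 and - x / (2k) is x / pi^2, so
  no factor depending on k survives.\<close>

lemma partial_sum_op_eq:
  fixes sc :: "'k::real_normed_field \<Rightarrow> 'x::banach \<Rightarrow> 'x"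
  assumes sc: "normed_scaling sc" and f: "f \<in> Lp_space I_measure p" and p: "1 < p"
  shows "partial_sum_op sc n f x =
     (1 / pi\<^sup>2) *\<^sub>R (cos_partial_sum n (\<lambda>y. (2 * pi - y) *\<^sub>R f y) x + x *\<^sub>R sin_partial_sum n f x)"
proof -
  define g where "g y = (2 * pi - y) *\<^sub>R f y" for y
  define A where "A k = weighted_integral (\<lambda>y. cos (real k * y)) g" for k
  define B where "B k = weighted_integral (\<lambda>y. sin (real k * y)) f" for k
  have Ag: "A k = weighted_integral (\<lambda>y. (2 * pi - y) * cos (real k * y)) f" for k
    unfolding A_def g_def weighted_integral_def by (simp add: mult.commute)
  have vc: "v_real (CosIx k) = (\<lambda>y. (if k = 0 then 1 / (2 * pi\<^sup>2) else 1 / pi\<^sup>2) * ((2 * pi - y) * cos (real k * y)))" for k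
    by auto
  have vs: "v_real (SinIx k) = (\<lambda>y. (- (2 * real k / pi\<^sup>2)) * sin (real k * y))" for k by auto
  have tc: "t_op sc (CosIx k) f = (if k = 0 then 1 / (2 * pi\<^sup>2) else 1 / pi\<^sup>2) *\<^sub>R A k" for k
    unfolding t_op_eq_weighted_integral[OF sc] vc Ag
    by (rule weighted_integral_cmult[OF f p]) (intro continuous_intros)
  have ts: "t_op sc (SinIx k) f = (- (2 * real k / pi\<^sup>2)) *\<^sub>R B k" for k
    unfolding t_op_eq_weighted_integral[OF sc] vs B_def
    by (rule weighted_integral_cmult[OF f p]) (intro continuous_intros)
  have phi: "sc (phi k x) z = phi_real k x *\<^sub>R z" for k z
    unfolding phi_def by (rule normed_scaling_of_real[OF sc])
  have set: "{..n} = insert 0 {1..n}" by auto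
  have c: "cos_partial_sum n g x = (1/2) *\<^sub>R A 0 + (\<Sum>k=1..n. cos (real k * x) *\<^sub>R A k)"
    unfolding cos_partial_sum_def finite_rank_op_def A_def[symmetric] set by simp
  have s: "sin_partial_sum n f x = (\<Sum>k=1..n. sin (real k * x) *\<^sub>R B k)"
    unfolding sin_partial_sum_def finite_rank_op_def B_def[symmetric] set by simp
  have term0: "sc (phi (CosIx 0) x) (t_op sc (CosIx 0) f) = (1 / pi\<^sup>2) *\<^sub>R (1/2) *\<^sub>R A 0"
    unfolding phi tc by simp
  have termk: "sc (phi (CosIx k) x) (t_op sc (CosIx k) f) + sc (phi (SinIx k) x) (t_op sc (SinIx k) f)
     = (1 / pi\<^sup>2) *\<^sub>R (cos (real k * x) *\<^sub>R A k + x *\<^sub>R sin (real k * x) *\<^sub>R B k)" if "k \<in> {1..n}" for k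
    unfolding phi tc ts using that by (simp add: scaleR_add_right field_simps)
  have "partial_sum_op sc n f x = (1 / pi\<^sup>2) *\<^sub>R (1/2) *\<^sub>R A 0
      + (\<Sum>k=1..n. (1 / pi\<^sup>2) *\<^sub>R (cos (real k * x) *\<^sub>R A k + x *\<^sub>R sin (real k * x) *\<^sub>R B k))"
    unfolding partial_sum_op_def term0 using termk by simp
  also have "\<dots> = (1 / pi\<^sup>2) *\<^sub>R (cos_partial_sum n g x + x *\<^sub>R sin_partial_sum n f x)"
    unfolding c s by (simp add: scaleR_add_right scaleR_sum_right sum.distrib add.assoc)
  finally show ?thesis unfolding g_def .
qed

lemma partial_sum_op_bounded:
  fixes sc :: "'k::real_normed_field \<Rightarrow> 'x::banach \<Rightarrow> 'x"
  assumes sc: "normed_scaling sc" and umd: "UMD sc" and p: "1 < p"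
  obtains C where "0 < C"
    "\<And>n f. f \<in> Lp_space I_measure p \<Longrightarrow> partial_sum_op sc n f \<in> Lp_space I_measure p"
    "\<And>n f. f \<in> Lp_space I_measure p \<Longrightarrow> Lp_norm I_measure p (partial_sum_op sc n f) \<le> C * Lp_norm I_measure p f"
proof -
  obtain C where C: "0 \<le> C"
    "\<And>n (f :: real \<Rightarrow> 'x). f \<in> Lp_space I_measure p \<Longrightarrow> Lp_modular I_measure p (cos_partial_sum n f) \<le> C * Lp_modular I_measure p f"
    "\<And>n (f :: real \<Rightarrow> 'x). f \<in> Lp_space I_measure p \<Longrightarrow> Lp_modular I_measure p (sin_partial_sum n f) \<le> C * Lp_modular I_measure p f"
    using cos_sin_partial_sums_bounded[OF assms] by blast
  \<comment> \<open>Bounds both multipliers, 2 * pi - y before the cosine sum and x after the sine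
    sum.\<close>
  define b where "b = (2 * pi) powr p"
  define D where "D = (1 / pi\<^sup>2) powr p * (2 powr (p - 1) * (C * b + b * C))"
  have D: "0 \<le> D" using C(1) by (simp add: D_def b_def)
  have main: "partial_sum_op sc n f \<in> Lp_space I_measure p \<and> Lp_modular I_measure p (partial_sum_op sc n f) \<le> D * Lp_modular I_measure p f"
    if f: "f \<in> Lp_space I_measure p" for n and f :: "real \<Rightarrow> 'x"
  proof -
    define g where "g y = (2 * pi - y) *\<^sub>R f y" for y
    define s where "s x = x *\<^sub>R sin_partial_sum n f x" for x
    define h where "h x = cos_partial_sum n g x + s x" for x
    have g: "g \<in> Lp_space I_measure p" "Lp_modular I_measure p g \<le> b * Lp_modular I_measure p f"
    proof -
      have c: "continuous_on {0..2*pi} (\<lambda>y. 2 * pi - y)" by (intro continuous_intros)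
      show "g \<in> Lp_space I_measure p" "Lp_modular I_measure p g \<le> b * Lp_modular I_measure p f"
        unfolding g_def[abs_def] b_def by (rule Lp_I_scaleR[OF f p c, of "2 * pi"]; simp)+
    qed
    have s: "s \<in> Lp_space I_measure p" "Lp_modular I_measure p s \<le> b * Lp_modular I_measure p (sin_partial_sum n f)"
      unfolding s_def[abs_def] b_def by (rule Lp_I_scaleR[OF partial_sum_Lp(2)[OF p] p continuous_on_id, of "2 * pi"]; simp)+
    have h: "h \<in> Lp_space I_measure p"
      unfolding h_def[abs_def] by (rule Lp_add(1)[OF partial_sum_Lp(1)[OF p] s(1) p])
    have "Lp_modular I_measure p h \<le> 2 powr (p - 1) * (Lp_modular I_measure p (cos_partial_sum n g) + Lp_modular I_measure p s)"
      unfolding h_def[abs_def] by (rule Lp_add(2)[OF partial_sum_Lp(1)[OF p] s(1) p])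
    also have "\<dots> \<le> 2 powr (p - 1) * (C * (b * Lp_modular I_measure p f) + b * (C * Lp_modular I_measure p f))"
    proof (intro mult_left_mono add_mono)
      show "Lp_modular I_measure p (cos_partial_sum n g) \<le> C * (b * Lp_modular I_measure p f)"
        by (rule order_trans[OF C(2)[OF g(1)]]) (rule mult_left_mono[OF g(2) C(1)])
      show "Lp_modular I_measure p s \<le> b * (C * Lp_modular I_measure p f)"
        by (rule order_trans[OF s(2)]) (rule mult_left_mono[OF C(3)[OF f]], simp add: b_def)
    qed simp
    finally have hb: "Lp_modular I_measure p h \<le> 2 powr (p - 1) * (C * b + b * C) * Lp_modular I_measure p f"
      by (simp add: algebra_simps)
    have P: "partial_sum_op sc n f = (\<lambda>x. (1 / pi\<^sup>2) *\<^sub>R h x)"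
      by (rule ext) (simp only: partial_sum_op_eq[OF sc f p] h_def s_def g_def[abs_def])
    have P2: "partial_sum_op sc n f \<in> Lp_space I_measure p"
      "Lp_modular I_measure p (partial_sum_op sc n f) \<le> (1 / pi\<^sup>2) powr p * Lp_modular I_measure p h"
      unfolding P by (rule Lp_I_scaleR[OF h p continuous_on_const, of "1 / pi\<^sup>2"]; simp)+
    have "(1 / pi\<^sup>2) powr p * Lp_modular I_measure p h \<le> (1 / pi\<^sup>2) powr p * (2 powr (p - 1) * (C * b + b * C) * Lp_modular I_measure p f)"
      by (rule mult_left_mono[OF hb]) simp
    from order_trans[OF P2(2) this] have "Lp_modular I_measure p (partial_sum_op sc n f) \<le> D * Lp_modular I_measure p f"
      by (simp only: D_def mult.assoc)
    with P2(1) show ?thesis by blast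
  qed
  show thesis
  proof (rule that[of "D powr (1 / p) + 1"])
    show "0 < D powr (1 / p) + 1" by (simp add: add_nonneg_pos)
    fix n and f :: "real \<Rightarrow> 'x" assume f: "f \<in> Lp_space I_measure p"
    show "partial_sum_op sc n f \<in> Lp_space I_measure p" using main[OF f] by blast
    have "Lp_norm I_measure p (partial_sum_op sc n f) \<le> (D * Lp_modular I_measure p f) powr (1 / p)"
      unfolding Lp_norm_modular using main[OF f, of n] p by (intro powr_mono2 Lp_modular_nonneg) auto
    also have "\<dots> = D powr (1 / p) * Lp_norm I_measure p f"
      by (simp add: powr_mult Lp_norm_modular)
    also have "\<dots> \<le> (D powr (1 / p) + 1) * Lp_norm I_measure p f"
      by (intro mult_right_mono) (simp_all add: Lp_norm_modular)
    finally show "Lp_norm I_measure p (partial_sum_op sc n f) \<le> (D powr (1 / p) + 1) * Lp_norm I_measure p f" .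
  qed
qed

section \<open>Completeness, biorthonormality and uniqueness\<close>

lemma scalar_system_phi:
  assumes p: "1 < p"
  shows "scalar_system I_measure p trig_indices (phi :: trig_index \<Rightarrow> real \<Rightarrow> 'k::real_normed_field)"
  unfolding scalar_system_def
proof (intro conjI ballI)
  show "countable trig_indices" by (auto simp: trig_indices_def)
  fix k
  show "(phi k :: real \<Rightarrow> 'k) \<in> Lp_space I_measure p"
  proof -
    have "strongly_measurable I_measure (\<lambda>x. of_real (phi_real k x) :: 'k)"
      by (rule strongly_measurable_bounded_linear[OF bounded_linear_of_real strongly_measurable_borel])
         (rule continuous_borel_I[OF continuous_phi_real])
    then show ?thesis
      using Lp_spaceD(2)[OF continuous_Lp_I[OF continuous_phi_real p, of k]] by (simp add: phi_def[abs_def] Lp_space_def)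
  qed
qed

lemma tensor_approx_phi:
  fixes sc :: "'k::real_normed_field \<Rightarrow> 'x::banach \<Rightarrow> 'x"
  assumes sc: "normed_scaling sc" and p: "1 < p" and g: "g \<in> Lp_space I_measure p" and e: "0 < e"
  shows "\<exists>F z. finite F \<and> F \<subseteq> trig_indices \<and> Lp_norm I_measure p (\<lambda>x. g x - (\<Sum>k\<in>F. sc (phi k x) (z k))) < e"
proof -
  obtain h where h: "h \<in> phi_span" "Lp_modular I_measure p (\<lambda>x. g x - h x) < e powr p"
    using phi_span_dense[OF g p, of "e powr p"] e by auto
  obtain F z where F: "finite F" "F \<subseteq> trig_indices" "\<And>x. h x = (\<Sum>k\<in>F. phi_real k x *\<^sub>R z k)"
    using h(1) unfolding phi_span_def by blast
  have hx: "h x = (\<Sum>k\<in>F. sc (phi k x) (z k))" for x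
    unfolding F(3) phi_def by (simp add: normed_scaling_of_real[OF sc])
  have "Lp_norm I_measure p (\<lambda>x. g x - h x) < (e powr p) powr (1 / p)"
    unfolding Lp_norm_modular using h(2) p by (intro powr_less_mono2 Lp_modular_nonneg) auto
  also have "\<dots> = e" using e p by (simp add: powr_powr)
  finally show ?thesis unfolding hx using F(1,2) by blast
qed

lemma bounded_linear_Lp_add:
  assumes "bounded_linear_Lp sc M p T" "f \<in> Lp_space M p" "g \<in> Lp_space M p"
  shows "T (\<lambda>x. f x + g x) = T f + T g"
  using assms unfolding bounded_linear_Lp_def by blast

lemma bounded_linear_Lp_sum:
  assumes T: "bounded_linear_Lp sc I_measure p T" and p: "1 < p"
    and f: "\<And>k. k \<in> F \<Longrightarrow> f k \<in> Lp_space I_measure p"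
  shows "T (\<lambda>x. \<Sum>k\<in>F. f k x) = (\<Sum>k\<in>F. T (f k))"
proof -
  note add = bounded_linear_Lp_add[OF T]
  have zero: "T (\<lambda>x. 0) = 0" using add[OF Lp_zero[OF p] Lp_zero[OF p]] by simp
  show ?thesis using f
  proof (induction F rule: infinite_finite_induct)
    case (insert k F)
    have "T (\<lambda>x. f k x + (\<Sum>k\<in>F. f k x)) = T (f k) + T (\<lambda>x. \<Sum>k\<in>F. f k x)"
      by (rule add) (use insert.prems in \<open>auto intro!: Lp_sum p\<close>)
    with insert show ?case by simp
  qed (simp_all add: zero)
qed

lemma bounded_linear_Lp_t_op:
  fixes sc :: "'k::real_normed_field \<Rightarrow> 'x::banach \<Rightarrow> 'x"
  assumes sc: "normed_scaling sc" and p: "1 < p"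
  shows "bounded_linear_Lp sc I_measure p (t_op sc k)"
  unfolding bounded_linear_Lp_def t_op_eq_weighted_integral[OF sc]
proof (intro conjI ballI allI)
  fix f g :: "real \<Rightarrow> 'x" assume "f \<in> Lp_space I_measure p" "g \<in> Lp_space I_measure p"
  then show "weighted_integral (v_real k) (\<lambda>x. f x + g x) = weighted_integral (v_real k) f + weighted_integral (v_real k) g"
    by (rule weighted_integral_add[OF _ _ p continuous_v_real])
next
  fix c and f :: "real \<Rightarrow> 'x" assume "f \<in> Lp_space I_measure p"
  then show "weighted_integral (v_real k) (\<lambda>x. sc c (f x)) = sc c (weighted_integral (v_real k) f)"
    by (rule weighted_integral_bounded_linear[OF _ p continuous_v_real normed_scaling_bounded_linear[OF sc]])
next
  obtain K where "\<And>f :: real \<Rightarrow> 'x. f \<in> Lp_space I_measure p \<Longrightarrow> norm (weighted_integral (v_real k) f) \<le> K * Lp_norm I_measure p f"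
    using weighted_integral_bounded[OF p continuous_v_real, of k] by metis
  then show "\<exists>C. \<forall>f\<in>Lp_space I_measure p. norm (weighted_integral (v_real k) f :: 'x) \<le> C * Lp_norm I_measure p f" by blast
qed

lemma tensor_biorthonormal_t_op:
  fixes sc :: "'k::real_normed_field \<Rightarrow> 'x::banach \<Rightarrow> 'x"
  assumes sc: "normed_scaling sc" and p: "1 < p"
  shows "tensor_biorthonormal sc I_measure p trig_indices phi (t_op sc)"
  unfolding tensor_biorthonormal_def
proof (intro conjI ballI allI scalar_system_phi[OF p] bounded_linear_Lp_t_op[OF sc p])
  fix n k and z :: 'x assume "n \<in> trig_indices" "k \<in> trig_indices"
  then show "t_op sc n (\<lambda>x. sc (phi k x) z) = (if n = k then z else 0)"
    unfolding t_op_eq_weighted_integral[OF sc] phi_def normed_scaling_of_real[OF sc]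
    by (subst weighted_integral_tensor) (auto simp: biorthonormal_integral intro!: continuous_intros continuous_v_real continuous_phi_real)
qed

text \<open>Biorthonormality prescribes both operators on elementary tensors, hence on the span;
  completeness and boundedness carry the equality to the whole space.\<close>

lemma tensor_biorthonormal_unique:
  fixes sc :: "'k::real_normed_field \<Rightarrow> 'x::banach \<Rightarrow> 'x"
  assumes sc: "normed_scaling sc" and p: "1 < p"
    and s: "tensor_biorthonormal sc I_measure p trig_indices phi s"
    and t: "tensor_biorthonormal sc I_measure p trig_indices phi t"
    and n: "n \<in> trig_indices" and f: "f \<in> Lp_space I_measure p"
  shows "s n f = t n f"
proof -
  note sb = s[unfolded tensor_biorthonormal_def] and tb = t[unfolded tensor_biorthonormal_def]
  have sl: "bounded_linear_Lp sc I_measure p (s n)" and tl: "bounded_linear_Lp sc I_measure p (t n)"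
    using sb tb n by blast+
  obtain C where C: "\<And>f. f \<in> Lp_space I_measure p \<Longrightarrow> norm (s n f) \<le> C * Lp_norm I_measure p f"
    using sl unfolding bounded_linear_Lp_def by blast
  obtain D where D: "\<And>f. f \<in> Lp_space I_measure p \<Longrightarrow> norm (t n f) \<le> D * Lp_norm I_measure p f"
    using tl unfolding bounded_linear_Lp_def by blast
  have tensor_Lp: "(\<lambda>x. sc (phi k x) z) \<in> Lp_space I_measure p" for k z
  proof -
    have "strongly_measurable I_measure (\<lambda>x. phi_real k x *\<^sub>R z)"
      by (rule strongly_measurable_scaleR[OF continuous_borel_I[OF continuous_phi_real] strongly_measurable_const])
    moreover have "integrable I_measure (\<lambda>x. \<bar>phi_real k x\<bar> powr p * norm z powr p)"
      using Lp_spaceD(2)[OF continuous_Lp_I[OF continuous_phi_real p, of k]] by simp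
    ultimately show ?thesis
      unfolding phi_def normed_scaling_of_real[OF sc] by (rule Lp_space_dominated(1)) (simp add: powr_mult)
  qed
  have small: "norm (s n f - t n f) \<le> e" if e: "0 < e" for e
  proof -
    \<comment> \<open>The bounds \<open>C\<close> and \<open>D\<close> come without a sign, hence
      the absolute values; the 1 keeps the denominator positive.\<close>
    define d where "d = e / (\<bar>C\<bar> + \<bar>D\<bar> + 1)"
    have d: "0 < d" using e by (simp add: d_def)
    obtain F z where F: "finite F" "F \<subseteq> trig_indices" "Lp_norm I_measure p (\<lambda>x. f x - (\<Sum>k\<in>F. sc (phi k x) (z k))) < d"
      using tensor_approx_phi[OF sc p f d] by blast
    define g where "g x = (\<Sum>k\<in>F. sc (phi k x) (z k))" for x
    have g: "g \<in> Lp_space I_measure p" unfolding g_def[abs_def] by (intro Lp_sum p tensor_Lp)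
    note fg = Lp_diff(1)[OF f g p]
    have eq: "s n g = t n g"
    proof -
      have "s n g = (\<Sum>k\<in>F. s n (\<lambda>x. sc (phi k x) (z k)))"
        unfolding g_def[abs_def] by (rule bounded_linear_Lp_sum[OF sl p tensor_Lp])
      also have "\<dots> = (\<Sum>k\<in>F. t n (\<lambda>x. sc (phi k x) (z k)))"
        using sb tb n F(2) by (intro sum.cong refl) (simp add: subset_iff)
      also have "\<dots> = t n g"
        unfolding g_def[abs_def] by (rule bounded_linear_Lp_sum[OF tl p tensor_Lp, symmetric])
      finally show ?thesis .
    qed
    have "s n (\<lambda>x. (f x - g x) + g x) = s n (\<lambda>x. f x - g x) + s n g"
      "t n (\<lambda>x. (f x - g x) + g x) = t n (\<lambda>x. f x - g x) + t n g"
      by (rule bounded_linear_Lp_add[OF sl fg g], rule bounded_linear_Lp_add[OF tl fg g])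
    then have "norm (s n f - t n f) = norm (s n (\<lambda>x. f x - g x) - t n (\<lambda>x. f x - g x))"
      by (simp add: eq)
    also have "\<dots> \<le> C * Lp_norm I_measure p (\<lambda>x. f x - g x) + D * Lp_norm I_measure p (\<lambda>x. f x - g x)"
      by (rule order_trans[OF norm_triangle_ineq4]) (intro add_mono C D fg)
    also have "\<dots> \<le> (\<bar>C\<bar> + \<bar>D\<bar> + 1) * Lp_norm I_measure p (\<lambda>x. f x - g x)"
    proof -
      have "0 \<le> Lp_norm I_measure p (\<lambda>x. f x - g x)" by (simp add: Lp_norm_modular)
      then have "(C + D) * Lp_norm I_measure p (\<lambda>x. f x - g x) \<le> (\<bar>C\<bar> + \<bar>D\<bar> + 1) * Lp_norm I_measure p (\<lambda>x. f x - g x)"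
        by (intro mult_right_mono) linarith
      then show ?thesis by (simp only: distrib_right)
    qed
    also have "\<dots> \<le> (\<bar>C\<bar> + \<bar>D\<bar> + 1) * d"
      using F(3) unfolding g_def by (intro mult_left_mono) linarith+
    also have "\<dots> = e"
    proof -
      have "\<bar>C\<bar> + \<bar>D\<bar> + 1 \<noteq> 0" by linarith
      then show ?thesis unfolding d_def by (rule nonzero_mult_div_cancel_left[of _ e, folded times_divide_eq_right])
    qed
    finally show ?thesis .
  qed
  have "norm (s n f - t n f) \<le> 0"
  proof (rule field_le_epsilon)
    fix e :: real assume "0 < e"
    from small[OF this] show "norm (s n f - t n f) \<le> 0 + e" by simp
  qed
  then show ?thesis by simp
qed

theorem theorem3p1:
  fixes sc :: "'k::real_normed_field \<Rightarrow> 'x::banach \<Rightarrow> 'x" and p :: real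
  assumes "normed_scaling sc"
    and "UMD sc"
    and "1 < p"
  shows "tensor_complete sc I_measure p trig_indices phi \<and>
    tensor_biorthonormal sc I_measure p trig_indices phi (t_op sc) \<and>
    (\<forall>t. tensor_biorthonormal sc I_measure p trig_indices phi t \<longrightarrow>
       (\<forall>k\<in>trig_indices. \<forall>f\<in>Lp_space I_measure p. t k f = t_op sc k f)) \<and>
    (\<exists>C>0. \<forall>n\<ge>1. \<forall>f\<in>Lp_space I_measure p.
       partial_sum_op sc n f \<in> Lp_space I_measure p \<and>
       Lp_norm I_measure p (partial_sum_op sc n f) \<le> C * Lp_norm I_measure p f)"
proof (intro conjI)
  show "tensor_complete sc I_measure p trig_indices phi"
    unfolding tensor_complete_def
    using scalar_system_phi[OF assms(3)] tensor_approx_phi[OF assms(1,3)] by blast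
  show t: "tensor_biorthonormal sc I_measure p trig_indices phi (t_op sc)"
    by (rule tensor_biorthonormal_t_op[OF assms(1,3)])
  show "\<forall>t. tensor_biorthonormal sc I_measure p trig_indices phi t \<longrightarrow>
       (\<forall>k\<in>trig_indices. \<forall>f\<in>Lp_space I_measure p. t k f = t_op sc k f)"
    using tensor_biorthonormal_unique[OF assms(1,3) _ t] by blast
  show "\<exists>C>0. \<forall>n\<ge>1. \<forall>f\<in>Lp_space I_measure p.
       partial_sum_op sc n f \<in> Lp_space I_measure p \<and>
       Lp_norm I_measure p (partial_sum_op sc n f) \<le> C * Lp_norm I_measure p f"
    using partial_sum_op_bounded[OF assms] by metis
qed

end
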